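(* Let $0<C_1\le C_2$ and let $(\Psi^j)_{j=0}^\infty$ be a sequence of polynomials with $\Psi^j\in\Pi_{N_j}(\mathbb{S}^{d-1})$ for each $j\in\mathbb{N}_0$. Then $\mathcal{X}[(\Psi^j)_{j=0}^\infty]$ is a frame for $L^2(\mathbb{S}^{d-1})$ with lower and upper frame bounds $C_1$ and $C_2$, respectively, i.e. $$C_1\|f\|_{L^2(\mathbb{S}^{d-1})}^2\le\sum_{j=0}^\infty\sum_{r=1}^{r_j}\mu_{j,r}\,|\langle f,T^d(g_{j,r})\Psi^j\rangle_{\mathbb{S}^{d-1}}|^2\le C_2\|f\|_{L^2(\mathbb{S}^{d-1})}^2\qquad\text{for all } f\in L^2(\mathbb{S}^{d-1}),$$ if and only if $$C_1\le(\dim\mathcal{H}_n^d)^{-1}\sum_{j=0}^\infty\sum_{k\in\mathcal{I}_n^d}|\Psi^j(n,k)|^2\le C_2\qquad\text{for each } n\in\mathbb{N}_0.$$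
   Context: Fix $d\ge3$. $\mathbb{S}^{d-1}$ is the unit sphere in $\mathbb{R}^d$ and $\omega_{d-1}$ is the rotation-invariant measure on it normalized by $\omega_{d-1}(\mathbb{S}^{d-1})=1$; $L^2(\mathbb{S}^{d-1})$ (complex-valued functions) has inner product $\langle f_1,f_2\rangle_{\mathbb{S}^{d-1}}=\int f_1\overline{f_2}\,\mathrm{d}\omega_{d-1}$. $\mathcal{H}_n^d$ is the space of spherical harmonics of degree $n$ (restrictions to $\mathbb{S}^{d-1}$ of complex harmonic homogeneous polynomials of degree $n$ on $\mathbb{R}^d$), and $\Pi_N(\mathbb{S}^{d-1})=\bigoplus_{n=0}^N\mathcal{H}_n^d$ is the space of restrictions to the sphere of polynomials of degree at most $N$. For each $n\in\mathbb{N}_0$, $\mathcal{I}_n^d$ is an index set of cardinality $\dim\mathcal{H}_n^d$ and $\{Y_k^{d,n}: k\in\mathcal{I}_n^d\}$ is a fixed orthonormal basis of $\mathcal{H}_n^d$. Fourier coefficients are written $f(n,k)=\langle f,Y_k^{d,n}\rangle_{\mathbb{S}^{d-1}}$. $\mu_d$ is the normalized Haar measure on $SO(d)$, and $(T^d(g)f)(x)=f(g^{-1}x)$ for $g\in SO(d)$. Let $t_{k,m}^{d,n}(g)=\langle T^d(g)Y_m^{d,n},Y_k^{d,n}\rangle_{\mathbb{S}^{d-1}}$ and $\mathcal{M}_N^1(SO(d))=\mathrm{span}\{t_{k,m}^{d,n}: k,m\in\mathcal{I}_n^d,\ 0\le n\le N\}$. Fix an increasing sequence $(N_j)_{j=0}^\infty\subset\mathbb{N}_0$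 and, for every $j\in\mathbb{N}_0$, points $g_{j,r}\in SO(d)$ and weights $\mu_{j,r}>0$, $r=1,\dots,r_j$, such that $$\int_{SO(d)}f_1f_2\,\mathrm{d}\mu_d=\sum_{r=1}^{r_j}\mu_{j,r}f_1(g_{j,r})f_2(g_{j,r})\quad\text{for all } f_1,f_2\in\mathcal{M}_{N_j}^1(SO(d)).$$ For a sequence $(\Psi^j)_{j=0}^\infty$ with $\Psi^j\in\Pi_{N_j}(\mathbb{S}^{d-1})$ put $$\mathcal{X}[(\Psi^j)_{j=0}^\infty]=\{\sqrt{\mu_{j,r}}\,T^d(g_{j,r})\Psi^j:\ r=1,\dots,r_j,\ j\in\mathbb{N}_0\},$$ regarded as a (canonically ordered) sequence of elements of $L^2(\mathbb{S}^{d-1})$. *)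

theory Defs
  imports "HOL-Analysis.Analysis" "HOL-Library.Function_Algebras"
begin

definition SO :: "(real ^ 'd ^ 'd) set" where
  "SO = {g. rotation_matrix g}"

abbreviation unit_sphere :: "(real ^ 'd) set" where
  "unit_sphere \<equiv> sphere 0 1"

text \<open>
  The following two predicates determine the measures uniquely. A finite Borel measure on these
  compact metric spaces is automatically regular, so regularity is not listed.
\<close>

definition normalized_sphere_measure :: "(real ^ 'd) measure \<Rightarrow> bool" where
  "normalized_sphere_measure \<omega> \<longleftrightarrow>
     sets \<omega> = sets (restrict_space borel unit_sphere) \<and>
     emeasure \<omega> unit_sphere = 1 \<and>
     (\<forall>g\<in>SO. \<forall>A\<in>sets \<omega>. emeasure \<omega> ((\<lambda>x. g *v x) ` A) = emeasure \<omega> A)"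

definition normalized_Haar_SO :: "(real ^ 'd ^ 'd) measure \<Rightarrow> bool" where
  "normalized_Haar_SO \<mu> \<longleftrightarrow>
     sets \<mu> = sets (restrict_space borel SO) \<and>
     emeasure \<mu> SO = 1 \<and>
     (\<forall>g\<in>SO. \<forall>A\<in>sets \<mu>. emeasure \<mu> ((\<lambda>h. g ** h) ` A) = emeasure \<mu> A)"

text \<open>
  Elements of \<open>L\<^sup>2\<close> are represented by square-integrable functions, not by equivalence classes;
  their values outside \<open>space \<omega>\<close> are irrelevant.
\<close>

definition L2_space :: "'a measure \<Rightarrow> ('a \<Rightarrow> complex) set" where
  "L2_space \<omega> = {f. f \<in> borel_measurable \<omega> \<and> integrable \<omega> (\<lambda>x. (cmod (f x))\<^sup>2)}"

definition L2_inner :: "'a measure \<Rightarrow> ('a \<Rightarrow> complex) \<Rightarrow> ('a \<Rightarrow> complex) \<Rightarrow> complex" where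
  "L2_inner \<omega> f1 f2 = (\<integral>x. f1 x * cnj (f2 x) \<partial>\<omega>)"

definition L2_norm :: "'a measure \<Rightarrow> ('a \<Rightarrow> complex) \<Rightarrow> real" where
  "L2_norm \<omega> f = sqrt (\<integral>x. (cmod (f x))\<^sup>2 \<partial>\<omega>)"

text \<open>
  A frame with given bounds, for an arbitrarily indexed family: the terms are nonnegative, so the
  unordered sum in \<open>ennreal\<close> always exists and agrees with the sum in any ordering of the index set.
\<close>

definition frame_with_bounds ::
  "'a measure \<Rightarrow> 'i set \<Rightarrow> ('i \<Rightarrow> 'a \<Rightarrow> complex) \<Rightarrow> real \<Rightarrow> real \<Rightarrow> bool" where
  "frame_with_bounds \<omega> J X C1 C2 \<longleftrightarrow>
     (\<forall>i\<in>J. X i \<in> L2_space \<omega>) \<and>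
     (\<forall>f\<in>L2_space \<omega>.
        ennreal (C1 * (L2_norm \<omega> f)\<^sup>2) \<le> (\<Sum>\<^sub>\<infinity>i\<in>J. ennreal ((cmod (L2_inner \<omega> f (X i)))\<^sup>2)) \<and>
        (\<Sum>\<^sub>\<infinity>i\<in>J. ennreal ((cmod (L2_inner \<omega> f (X i)))\<^sup>2)) \<le> ennreal (C2 * (L2_norm \<omega> f)\<^sup>2))"

global_interpretation cfun: vector_space "\<lambda>(c::complex) (f :: 'a \<Rightarrow> complex) x. c * f x"
  by unfold_locales (auto simp: fun_eq_iff algebra_simps)

definition monomial :: "('d \<Rightarrow> nat) \<Rightarrow> real ^ 'd \<Rightarrow> complex" where
  "monomial \<alpha> x = (\<Prod>i\<in>UNIV. complex_of_real (x $ i) ^ \<alpha> i)"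

definition homogeneous_polys :: "nat \<Rightarrow> (real ^ 'd \<Rightarrow> complex) set" where
  "homogeneous_polys n =
     {p. \<exists>c. \<forall>x. p x = (\<Sum>\<alpha> | (\<Sum>i\<in>UNIV. \<alpha> i) = n. c \<alpha> * monomial \<alpha> x)}"

definition partial :: "'d \<Rightarrow> (real ^ 'd \<Rightarrow> complex) \<Rightarrow> real ^ 'd \<Rightarrow> complex" where
  "partial i p x = vector_derivative (\<lambda>t. p (x + t *\<^sub>R axis i 1)) (at 0)"

definition laplacian :: "(real ^ 'd \<Rightarrow> complex) \<Rightarrow> real ^ 'd \<Rightarrow> complex" where
  "laplacian p x = (\<Sum>i\<in>UNIV. partial i (partial i p) x)"

text \<open>
  Functions on the sphere are extended by \<open>0\<close>, so that restrictions of polynomials form a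
  complex vector space of the correct dimension inside \<open>real ^ 'd \<Rightarrow> complex\<close>.
\<close>

definition sphere_restrict :: "(real ^ 'd \<Rightarrow> complex) \<Rightarrow> real ^ 'd \<Rightarrow> complex" where
  "sphere_restrict p x = (if x \<in> unit_sphere then p x else 0)"

definition spherical_harmonics :: "nat \<Rightarrow> (real ^ 'd \<Rightarrow> complex) set" where
  "spherical_harmonics n =
     sphere_restrict ` {p \<in> homogeneous_polys n. \<forall>x. laplacian p x = 0}"

definition sphere_polys :: "nat \<Rightarrow> (real ^ 'd \<Rightarrow> complex) set" where
  "sphere_polys N = {(\<lambda>x. \<Sum>n\<le>N. h n x) |h. \<forall>n\<le>N. h n \<in> spherical_harmonics n}"

definition orthonormal_basis_harmonics ::
  "(real ^ 'd) measure \<Rightarrow> nat \<Rightarrow> 'k set \<Rightarrow> ('k \<Rightarrow> real ^ 'd \<Rightarrow> complex) \<Rightarrow> bool" where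
  "orthonormal_basis_harmonics \<omega> n I Y \<longleftrightarrow>
     finite I \<and> card I = cfun.dim (spherical_harmonics n :: (real ^ 'd \<Rightarrow> complex) set) \<and>
     (\<forall>k\<in>I. Y k \<in> spherical_harmonics n) \<and>
     (\<forall>k\<in>I. \<forall>m\<in>I. L2_inner \<omega> (Y k) (Y m) = (if k = m then 1 else 0)) \<and>
     cfun.span (Y ` I) = spherical_harmonics n"

definition rotate_fun :: "real ^ 'd ^ 'd \<Rightarrow> (real ^ 'd \<Rightarrow> complex) \<Rightarrow> real ^ 'd \<Rightarrow> complex" where
  "rotate_fun g f x = f (matrix_inv g *v x)"

definition matrix_coeff ::
  "(real ^ 'd) measure \<Rightarrow> (nat \<Rightarrow> 'k \<Rightarrow> real ^ 'd \<Rightarrow> complex) \<Rightarrow> nat \<Rightarrow> 'k \<Rightarrow> 'k \<Rightarrow>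
     real ^ 'd ^ 'd \<Rightarrow> complex" where
  "matrix_coeff \<omega> Y n k m g = L2_inner \<omega> (rotate_fun g (Y n m)) (Y n k)"

text \<open>
  Members of this span are functions on all matrices; only their values on \<open>SO\<close> are ever used.
\<close>

definition SO_polys ::
  "(real ^ 'd) measure \<Rightarrow> (nat \<Rightarrow> 'k set) \<Rightarrow> (nat \<Rightarrow> 'k \<Rightarrow> real ^ 'd \<Rightarrow> complex) \<Rightarrow> nat \<Rightarrow>
     (real ^ 'd ^ 'd \<Rightarrow> complex) set" where
  "SO_polys \<omega> I Y N =
     cfun.span {matrix_coeff \<omega> Y n k m |n k m. n \<le> N \<and> k \<in> I n \<and> m \<in> I n}"

text \<open>
  Points \<open>g 1, \<dots>, g r\<close> in \<open>SO(d)\<close> with positive weights \<open>w 1, \<dots>, w r\<close>, exact for products of two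
  elements of the function space \<open>M\<close>.
\<close>

definition quadrature_SO ::
  "(real ^ 'd ^ 'd) measure \<Rightarrow> (real ^ 'd ^ 'd \<Rightarrow> complex) set \<Rightarrow> nat \<Rightarrow>
     (nat \<Rightarrow> real ^ 'd ^ 'd) \<Rightarrow> (nat \<Rightarrow> real) \<Rightarrow> bool" where
  "quadrature_SO \<mu> M r g w \<longleftrightarrow>
     (\<forall>i\<in>{1..r}. g i \<in> SO \<and> 0 < w i) \<and>
     (\<forall>f1\<in>M. \<forall>f2\<in>M.
        (\<integral>h. f1 h * f2 h \<partial>\<mu>) = (\<Sum>i=1..r. complex_of_real (w i) * f1 (g i) * f2 (g i)))"

definition wavelet_system ::
  "(nat \<Rightarrow> nat \<Rightarrow> real ^ 'd ^ 'd) \<Rightarrow> (nat \<Rightarrow> nat \<Rightarrow> real) \<Rightarrow> (nat \<Rightarrow> real ^ 'd \<Rightarrow> complex) \<Rightarrow>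
     nat \<times> nat \<Rightarrow> real ^ 'd \<Rightarrow> complex" where
  "wavelet_system g w \<Psi> =
     (\<lambda>(j, i) x. complex_of_real (sqrt (w j i)) * rotate_fun (g j i) (\<Psi> j) x)"

end

theory Submission
  imports Defs "HOL-Computational_Algebra.Polynomial"
begin

text \<open>
  Exactness of the quadrature turns the sum over \<open>r\<close> into the average of \<open>|\<langle>f, T(g) \<Psi>\<^sup>j\<rangle>|\<^sup>2\<close> over
  \<open>SO(d)\<close>, and Schur orthogonality evaluates this average as
  \<open>\<Sum>\<^sub>n (dim \<H>\<^sub>n)\<^bsup>-1\<^esup> (\<Sum>\<^sub>k |f(n,k)|\<^sup>2) (\<Sum>\<^sub>k |\<Psi>\<^sup>j(n,k)|\<^sup>2)\<close>. By Parseval's identity the frame inequality is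
  then a weighted form of \<open>\<parallel>f\<parallel>\<^sup>2\<close>, and testing it on \<open>f = Y\<^sub>k\<close> isolates the weight of a single degree.

  Schur's lemma is obtained from reproducing kernels: a rotation-invariant form on
  \<open>\<H>\<^sub>n \<times> \<H>\<^sub>m\<close> is described by a kernel \<open>b(x, y)\<close> that is symmetric, because for \<open>d \<ge> 3\<close> some rotation
  exchanges \<open>x\<close> and \<open>y\<close>. For \<open>n \<noteq> m\<close> the functions \<open>b(x, \<cdot>)\<close> thus lie in \<open>\<H>\<^sub>n \<inter> \<H>\<^sub>m = 0\<close>; for \<open>n = m\<close>
  they are zonal, and \<open>\<H>\<^sub>n\<close> contains only one zonal function up to scaling.
\<close>

section \<open>Homogeneous polynomial functions\<close>

text \<open>The hypotheses provide orthonormality only within one degree, quadrature only for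
  products without conjugation, and no completeness of the harmonics. Orthogonality of different
  degrees is therefore Schur's lemma applied to the inner product itself. The conjugate factor of a
  squared modulus is again a polynomial on the group, because the harmonics are closed under
  conjugation. Completeness rests on the stability of sums of harmonics under multiplication by
  coordinates, which makes Stone-Weierstrass applicable. The condition d >= 3 supplies the
  rotations: the reflection exchanging two points has determinant -1, and a second reflection in a
  direction orthogonal to both points repairs this without moving them. A general \<open>f\<close>
  need not be continuous, but its pairing with a rotated polynomial is a finite combination of
  pairings of basis functions, so the group average only involves continuous functions. All series
  live in \<open>ennreal\<close>: reordering them requires no summability, and an infinite weight is
  refuted by the upper frame bound.\<close>

inductive hpoly :: "nat \<Rightarrow> (real ^ 'd \<Rightarrow> complex) \<Rightarrow> bool" where
  const: "hpoly 0 (\<lambda>x. c)"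
| coord: "hpoly 1 (\<lambda>x. complex_of_real (x $ i))"
| add: "hpoly n p \<Longrightarrow> hpoly n q \<Longrightarrow> hpoly n (\<lambda>x. p x + q x)"
| mult: "hpoly m p \<Longrightarrow> hpoly n q \<Longrightarrow> hpoly (m + n) (\<lambda>x. p x * q x)"

lemma hpoly_coord': "hpoly (Suc 0) (\<lambda>x. complex_of_real (x $ i))"
  using hpoly.coord by simp

lemma hpoly_cmult: "hpoly n p \<Longrightarrow> hpoly n (\<lambda>x. c * p x)"
  using hpoly.mult[OF hpoly.const] by simp

lemma hpoly_zero: "hpoly n (\<lambda>x. 0)"
proof (induction n)
  case (Suc n)
  show ?case
    using hpoly.mult[OF Suc.IH hpoly_coord'] by simp
qed (rule hpoly.const)

lemma hpoly_sum: "(\<And>i. i \<in> A \<Longrightarrow> hpoly n (p i)) \<Longrightarrow> hpoly n (\<lambda>x. \<Sum>i\<in>A. p i x)"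
  by (induction A rule: infinite_finite_induct) (auto intro: hpoly_zero hpoly.add)

lemma hpoly_power: "hpoly n p \<Longrightarrow> hpoly (k * n) (\<lambda>x. p x ^ k)"
  by (induction k) (auto intro: hpoly.const hpoly.mult)

lemma hpoly_prod:
  "(\<And>i. i \<in> A \<Longrightarrow> hpoly (n i) (p i)) \<Longrightarrow> hpoly (\<Sum>i\<in>A. n i) (\<lambda>x. \<Prod>i\<in>A. p i x)"
  by (induction A rule: infinite_finite_induct) (auto intro: hpoly.const hpoly.mult)

lemma hpoly_continuous: "hpoly n p \<Longrightarrow> continuous_on S p"
  by (induction rule: hpoly.induct) (auto intro!: continuous_intros)

lemma finite_multi_indices: "finite {\<alpha> :: 'd::finite \<Rightarrow> nat. (\<Sum>i\<in>UNIV. \<alpha> i) = n}"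
proof (rule finite_subset)
  show "{\<alpha> :: 'd \<Rightarrow> nat. (\<Sum>i\<in>UNIV. \<alpha> i) = n} \<subseteq> Pi\<^sub>E UNIV (\<lambda>_. {..n})"
    by (auto intro: member_le_sum)
qed (auto intro: finite_PiE)

lemma hpoly_monomial: "hpoly (\<Sum>i\<in>UNIV. \<alpha> i) (monomial \<alpha>)"
proof -
  have "hpoly (\<Sum>i\<in>UNIV. \<alpha> i) (\<lambda>x. \<Prod>i\<in>UNIV. complex_of_real (x $ i) ^ \<alpha> i)"
    using hpoly_prod[of UNIV \<alpha> "\<lambda>i x. complex_of_real (x $ i) ^ \<alpha> i"] hpoly_power[OF hpoly_coord']
    by fastforce
  then show ?thesis
    by (simp add: monomial_def[abs_def])
qed

lemma homogeneous_polys_monomial: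
  "(\<Sum>i\<in>UNIV. \<alpha> i) = n \<Longrightarrow> (\<lambda>x. c * monomial \<alpha> x) \<in> homogeneous_polys n"
  by (auto simp: homogeneous_polys_def finite_multi_indices if_distrib[of "\<lambda>c. c * _"] cong: if_cong
        intro!: exI[of _ "\<lambda>\<beta>. if \<beta> = \<alpha> then c else 0"])

lemma homogeneous_polys_add:
  assumes "p \<in> homogeneous_polys n" "q \<in> homogeneous_polys n"
  shows "(\<lambda>x. p x + q x) \<in> homogeneous_polys n"
proof -
  obtain c d where "\<And>x. p x = (\<Sum>\<alpha> | (\<Sum>i\<in>UNIV. \<alpha> i) = n. c \<alpha> * monomial \<alpha> x)"
     "\<And>x. q x = (\<Sum>\<alpha> | (\<Sum>i\<in>UNIV. \<alpha> i) = n. d \<alpha> * monomial \<alpha> x)"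
    using assms by (auto simp: homogeneous_polys_def)
  then show ?thesis
    by (auto simp: homogeneous_polys_def sum.distrib ring_distribs intro!: exI[of _ "\<lambda>\<alpha>. c \<alpha> + d \<alpha>"])
qed

lemma homogeneous_polys_sum:
  "(\<And>i. i \<in> A \<Longrightarrow> p i \<in> homogeneous_polys n) \<Longrightarrow> (\<lambda>x. \<Sum>i\<in>A. p i x) \<in> homogeneous_polys n"
proof (induction A rule: infinite_finite_induct)
  case (insert i A)
  then show ?case
    by (simp add: homogeneous_polys_add)
qed (auto simp: homogeneous_polys_def intro!: exI[of _ "\<lambda>_. 0"])

lemma monomial_add: "monomial (\<lambda>i. \<alpha> i + \<beta> i) x = monomial \<alpha> x * monomial \<beta> x"
  by (simp add: monomial_def power_add prod.distrib)

lemma hpoly_imp_homogeneous: "hpoly n p \<Longrightarrow> p \<in> homogeneous_polys n"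
  for p :: "real ^ 'd \<Rightarrow> complex"
proof (induction rule: hpoly.induct)
  case (const c)
  show ?case
    using homogeneous_polys_monomial[of "\<lambda>_. 0" 0 c] by (simp add: monomial_def)
next
  case (coord i)
  have "monomial (\<lambda>j. if j = i then 1 else 0) x = complex_of_real (x $ i)" for x :: "real ^ 'd"
    by (simp add: monomial_def if_distrib[of "\<lambda>k. _ ^ k"] prod.delta cong: if_cong)
  then show ?case
    using homogeneous_polys_monomial[of "\<lambda>j. if j = i then 1 else 0" 1 1] by (simp cong: if_cong)
next
  case (mult m p n q)
  obtain c d where c: "\<And>x. p x = (\<Sum>\<alpha> | (\<Sum>i\<in>UNIV. \<alpha> i) = m. c \<alpha> * monomial \<alpha> x)"
     and d: "\<And>x. q x = (\<Sum>\<alpha> | (\<Sum>i\<in>UNIV. \<alpha> i) = n. d \<alpha> * monomial \<alpha> x)"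
    using mult.IH by (auto simp: homogeneous_polys_def)
  have "p x * q x = (\<Sum>\<alpha> | (\<Sum>i\<in>UNIV. \<alpha> i) = m. \<Sum>\<beta> | (\<Sum>i\<in>UNIV. \<beta> i) = n.
          (c \<alpha> * d \<beta>) * monomial (\<lambda>i. \<alpha> i + \<beta> i) x)" for x
    unfolding c d sum_product by (simp add: monomial_add mult_ac)
  then show ?case
    by (auto intro!: homogeneous_polys_sum homogeneous_polys_monomial simp: sum.distrib)
qed (rule homogeneous_polys_add)

text \<open>The inductive form is what the calculus below runs on: product rules, substitution of
  matrices and conjugation follow by induction on the generation of a polynomial, for which the
  coefficient sum of the definition is inconvenient.\<close>

lemma homogeneous_polys_eq: "homogeneous_polys n = {p. hpoly n p}"
proof safe
  fix p :: "real ^ 'd \<Rightarrow> complex"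
  assume "p \<in> homogeneous_polys n"
  then obtain c where "p = (\<lambda>x. \<Sum>\<alpha> | (\<Sum>i\<in>UNIV. \<alpha> i) = n. c \<alpha> * monomial \<alpha> x)"
    by (auto simp: homogeneous_polys_def fun_eq_iff)
  then show "hpoly n p"
    using hpoly_monomial by (auto intro!: hpoly_sum hpoly_cmult)
qed (rule hpoly_imp_homogeneous)

lemma hpoly_scaleR: "hpoly n p \<Longrightarrow> p (c *\<^sub>R x) = of_real c ^ n * p x"
  by (induction rule: hpoly.induct) (auto simp: algebra_simps power_add)

text \<open>Homogeneity carries values from the sphere along rays. The origin is reached by scaling
  with 0 and has to be covered too, since a polynomial of degree 0 need not vanish there.\<close>

lemma hpoly_eq_sphere:
  fixes p q :: "real ^ 'd \<Rightarrow> complex"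
  assumes "hpoly n p" "hpoly n q" "\<And>x. x \<in> unit_sphere \<Longrightarrow> p x = q x"
  shows "p = q"
proof
  fix x
  have eq: "p y = q y" if "y \<noteq> 0" for y
  proof -
    have "p (norm y *\<^sub>R (y /\<^sub>R norm y)) = q (norm y *\<^sub>R (y /\<^sub>R norm y))"
      using assms(3)[of "y /\<^sub>R norm y"] that
      by (subst hpoly_scaleR[OF assms(1)], subst hpoly_scaleR[OF assms(2)]) simp
    moreover have "norm y *\<^sub>R (y /\<^sub>R norm y) = y"
      using that by simp
    ultimately show ?thesis
      by simp
  qed
  show "p x = q x"
  proof (cases "x = 0")
    case True
    define e :: "real ^ 'd" where "e = axis undefined 1"
    have e: "e \<in> unit_sphere" by (simp add: e_def)
    have "p (0 *\<^sub>R e) = q (0 *\<^sub>R e)"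
      unfolding hpoly_scaleR[OF assms(1)] hpoly_scaleR[OF assms(2)] using assms(3)[OF e] by simp
    then show ?thesis
      using True by simp
  qed (rule eq)
qed

lemma hpoly_compose_matrix: "hpoly n p \<Longrightarrow> hpoly n (\<lambda>x. p (A *v x))"
  for A :: "real ^ 'd ^ 'd"
proof (induction rule: hpoly.induct)
  case (coord i)
  show ?case
    unfolding matrix_vector_mult_def
    by (auto intro!: hpoly_sum hpoly_cmult hpoly_coord')
qed (auto intro: hpoly.intros)

lemma hpoly_cnj: "hpoly n p \<Longrightarrow> hpoly n (\<lambda>x. cnj (p x))"
proof (induction rule: hpoly.induct)
  case (coord i)
  then show ?case
    by (auto intro: hpoly_coord')
qed (auto intro: hpoly.intros)

section \<open>The Laplacian of homogeneous polynomials\<close>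

lemma partial_const [simp]: "partial i (\<lambda>x. c) = (\<lambda>x. 0)"
  by (simp add: partial_def[abs_def])

lemma partial_coord: "partial i (\<lambda>x :: real ^ 'd. complex_of_real (x $ j)) = (\<lambda>x. if i = j then 1 else 0)"
proof
  fix x :: "real ^ 'd"
  have comp: "(x + t *\<^sub>R axis i 1) $ j = x $ j + (if i = j then t else 0)" for t
    by (simp add: axis_def)
  have "((\<lambda>t. complex_of_real ((x + t *\<^sub>R axis i 1) $ j)) has_vector_derivative
      (if i = j then 1 else 0)) (at 0)"
    unfolding comp by (cases "i = j") (auto simp: has_vector_derivative_def scaleR_conv_of_real intro!: derivative_eq_intros)
  then show "partial i (\<lambda>x :: real ^ 'd. complex_of_real (x $ j)) x = (if i = j then 1 else 0)"
    unfolding partial_def by (rule vector_derivative_at)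
qed

lemma hpoly_differentiable:
  "hpoly n p \<Longrightarrow> (\<lambda>t. p (x + t *\<^sub>R axis i 1)) differentiable (at 0)"
proof (induction rule: hpoly.induct)
  case (coord j)
  show ?case
    by (auto simp: axis_def intro!: derivative_intros)
qed (auto intro: differentiable_add differentiable_mult)

lemma hpoly_has_partial:
  "hpoly n p \<Longrightarrow> ((\<lambda>t. p (x + t *\<^sub>R axis i 1)) has_vector_derivative partial i p x) (at 0)"
  unfolding partial_def using hpoly_differentiable vector_derivative_works by blast

lemma partial_add:
  "hpoly m p \<Longrightarrow> hpoly n q \<Longrightarrow> partial i (\<lambda>x. p x + q x) = (\<lambda>x. partial i p x + partial i q x)"
  by (rule ext, subst partial_def, rule vector_derivative_at)
     (intro has_vector_derivative_add hpoly_has_partial)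

lemma partial_mult:
  assumes "hpoly m p" "hpoly n q"
  shows "partial i (\<lambda>x. p x * q x) = (\<lambda>x. partial i p x * q x + p x * partial i q x)"
proof
  fix x
  show "partial i (\<lambda>x. p x * q x) x = partial i p x * q x + p x * partial i q x"
    using has_vector_derivative_mult[OF hpoly_has_partial[OF assms(1), of x i] hpoly_has_partial[OF assms(2)]]
    by (subst partial_def, intro vector_derivative_at) (simp add: add.commute)
qed

lemma partial_cmult: "hpoly n p \<Longrightarrow> partial i (\<lambda>x. c * p x) = (\<lambda>x. c * partial i p x)"
  using partial_mult[OF hpoly.const, of n p i c] by simp

text \<open>The vanishing in degree 0 strengthens the induction: under truncated subtraction
  \<open>m - 1 + n\<close> and \<open>m + n - 1\<close> differ when \<open>m = 0\<close> and
  \<open>n > 0\<close>, and exactly there the summand in question is zero.\<close>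

lemma hpoly_partial_degree:
  "hpoly n p \<Longrightarrow> hpoly (n - 1) (partial i p) \<and> (n = 0 \<longrightarrow> partial i p = (\<lambda>x. 0))"
proof (induction rule: hpoly.induct)
  case (const c)
  then show ?case by (simp add: hpoly.const)
next
  case (coord j)
  then show ?case by (simp add: partial_coord hpoly.const)
next
  case (add n p q)
  then show ?case by (auto simp: partial_add[OF add.hyps] intro: hpoly.add)
next
  case (mult m p n q)
  have "hpoly (m + n - 1) (\<lambda>x. partial i p x * q x)"
    using mult hpoly.mult[of "m - 1" "partial i p" n q] by (cases "m = 0") (auto simp: hpoly_zero)
  moreover have "hpoly (m + n - 1) (\<lambda>x. p x * partial i q x)"
    using mult hpoly.mult[of m p "n - 1" "partial i q"] by (cases "n = 0") (auto simp: hpoly_zero)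
  ultimately show ?case
    using mult by (auto simp: partial_mult[OF mult.hyps] intro: hpoly.add)
qed

lemma hpoly_partial: "hpoly n p \<Longrightarrow> hpoly (n - 1) (partial i p)"
  using hpoly_partial_degree by blast

lemma partial_sum:
  "(\<And>j. j \<in> A \<Longrightarrow> hpoly n (p j)) \<Longrightarrow> partial i (\<lambda>x. \<Sum>j\<in>A. p j x) = (\<lambda>x. \<Sum>j\<in>A. partial i (p j) x)"
proof (induction A rule: infinite_finite_induct)
  case (insert j A)
  then have "partial i (\<lambda>x. p j x + (\<Sum>j\<in>A. p j x)) = (\<lambda>x. partial i (p j) x + partial i (\<lambda>x. \<Sum>j\<in>A. p j x) x)"
    by (intro partial_add[of n _ n] hpoly_sum) auto
  then show ?case
    using insert by simp
qed auto

lemma partial_commute: "hpoly n p \<Longrightarrow> partial i (partial j p) = partial j (partial i p)"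
proof (induction rule: hpoly.induct)
  case (add n p q)
  then show ?case
    by (simp add: partial_add[OF add.hyps] partial_add[OF hpoly_partial hpoly_partial, OF add.hyps])
next
  case (mult m p n q)
  note h = mult.hyps hpoly_partial[OF mult.hyps(1)] hpoly_partial[OF mult.hyps(2)]
  show ?case
    by (simp add: partial_mult[OF mult.hyps] partial_add[OF hpoly.mult[OF h(3) h(2)] hpoly.mult[OF h(1) h(4)]]
        partial_mult[OF h(3) h(2)] partial_mult[OF h(1) h(4)] mult.IH)
       (simp add: algebra_simps)
qed (simp_all add: partial_coord)

lemma euler_identity:
  "hpoly n p \<Longrightarrow> (\<Sum>i\<in>UNIV. complex_of_real (x $ i) * partial i p x) = of_nat n * p x"
proof (induction rule: hpoly.induct)
  case (coord i)
  then show ?case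
    by (simp add: partial_coord if_distrib[of "\<lambda>a. _ * a"] cong: if_cong)
next
  case (add n p q)
  then show ?case
    by (simp add: partial_add[OF add.hyps] ring_distribs sum.distrib)
next
  case (mult m p n q)
  have "(\<Sum>i\<in>UNIV. complex_of_real (x $ i) * partial i (\<lambda>x. p x * q x) x) =
     (\<Sum>i\<in>UNIV. complex_of_real (x $ i) * partial i p x) * q x +
     p x * (\<Sum>i\<in>UNIV. complex_of_real (x $ i) * partial i q x)"
    by (simp add: partial_mult[OF mult.hyps] sum_distrib_left sum_distrib_right
        sum.distrib[symmetric] algebra_simps)
  then show ?case
    by (simp only: mult.IH) (simp add: algebra_simps)
qed auto

lemma laplacian_add:
  assumes "hpoly m p" "hpoly n q"
  shows "laplacian (\<lambda>x. p x + q x) x = laplacian p x + laplacian q x"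
  by (simp add: laplacian_def partial_add[OF assms]
      partial_add[OF hpoly_partial hpoly_partial, OF assms] sum.distrib)

lemma laplacian_const [simp]: "laplacian (\<lambda>x. c) x = 0"
  by (simp add: laplacian_def)

lemma laplacian_mult:
  assumes "hpoly m p" "hpoly n q"
  shows "laplacian (\<lambda>x. p x * q x) x =
    laplacian p x * q x + 2 * (\<Sum>i\<in>UNIV. partial i p x * partial i q x) + p x * laplacian q x"
proof -
  note h = assms hpoly_partial[OF assms(1)] hpoly_partial[OF assms(2)]
  have "partial i (partial i (\<lambda>x. p x * q x)) x = partial i (partial i p) x * q x +
    2 * (partial i p x * partial i q x) + p x * partial i (partial i q) x" for i
    by (simp add: partial_mult[OF assms] partial_add[OF hpoly.mult[OF h(3) h(2)] hpoly.mult[OF h(1) h(4)]]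
        partial_mult[OF h(3) h(2)] partial_mult[OF h(1) h(4)])
  then show ?thesis
    by (simp add: laplacian_def sum.distrib sum_distrib_left sum_distrib_right)
qed

lemma laplacian_cmult: "hpoly n p \<Longrightarrow> laplacian (\<lambda>x. c * p x) x = c * laplacian p x"
  using laplacian_mult[OF hpoly.const, of n p c] by simp

lemma laplacian_coord: "laplacian (\<lambda>x. complex_of_real (x $ j)) x = 0"
  by (simp add: laplacian_def partial_coord)

lemma laplacian_coord_mult:
  assumes "hpoly n p"
  shows "laplacian (\<lambda>x. complex_of_real (x $ j) * p x) x =
    2 * partial j p x + complex_of_real (x $ j) * laplacian p x"
  by (simp add: laplacian_mult[OF hpoly.coord assms] laplacian_coord partial_coord
      if_distrib[of "\<lambda>a. a * _"] cong: if_cong)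

lemma laplacian_partial:
  assumes "hpoly n p"
  shows "laplacian (partial i p) = partial i (laplacian p)"
proof -
  note h = hpoly_partial[OF hpoly_partial[OF assms]]
  have "partial j (partial j (partial i p)) = partial i (partial j (partial j p))" for j
    using partial_commute[OF assms, of j i] partial_commute[OF hpoly_partial[OF assms], of j i] by simp
  then show ?thesis
    unfolding laplacian_def[abs_def] by (subst partial_sum[OF h]) simp
qed

section \<open>Multiplication by the squared norm\<close>

definition nsq :: "real ^ 'd \<Rightarrow> complex" where
  "nsq x = (\<Sum>i\<in>UNIV. complex_of_real (x $ i) * complex_of_real (x $ i))"

lemma nsq_eq: "nsq x = complex_of_real ((norm x)\<^sup>2)"
  by (simp add: nsq_def power2_norm_eq_inner inner_vec_def)

lemma hpoly_nsq: "hpoly 2 nsq"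
proof -
  have "hpoly 2 (\<lambda>x. complex_of_real (x $ i) * complex_of_real (x $ i))" for i
    using hpoly.mult[OF hpoly.coord[of i] hpoly.coord[of i]] by (simp add: numeral_2_eq_2)
  then show ?thesis
    unfolding nsq_def[abs_def] by (rule hpoly_sum)
qed

lemma partial_nsq: "partial i nsq x = 2 * complex_of_real (x $ i)"
  unfolding nsq_def[abs_def]
  by (subst partial_sum[OF hpoly.mult[OF hpoly.coord hpoly.coord]])
     (simp add: partial_mult[OF hpoly.coord hpoly.coord] partial_coord sum.distrib
      if_distrib[of "\<lambda>a. a * _"] if_distrib[of "\<lambda>a. _ * a"] cong: if_cong)

lemma laplacian_nsq: "laplacian nsq (x :: real ^ 'd) = of_nat (2 * CARD('d))"
proof -
  have "partial i nsq = (\<lambda>x :: real ^ 'd. 2 * complex_of_real (x $ i))" for i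
    by (simp add: fun_eq_iff partial_nsq)
  then show ?thesis
    by (simp add: laplacian_def partial_cmult[OF hpoly.coord] partial_coord)
qed

text \<open>The gradient of the squared norm is 2x, so the cross term of the product rule is four
  times the Euler operator; this is the origin of \<open>4 * n\<close>.\<close>

lemma laplacian_nsq_mult:
  fixes p :: "real ^ 'd \<Rightarrow> complex"
  assumes "hpoly n p"
  shows "laplacian (\<lambda>x. nsq x * p x) x = of_nat (2 * CARD('d) + 4 * n) * p x + nsq x * laplacian p x"
proof -
  have "(\<Sum>i\<in>UNIV. partial i nsq x * partial i p x) = 2 * (of_nat n * p x)"
    unfolding euler_identity[OF assms, of x, symmetric] by (simp add: partial_nsq sum_distrib_left mult_ac)
  then show ?thesis
    by (simp add: laplacian_mult[OF hpoly_nsq assms] laplacian_nsq algebra_simps)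
qed

text \<open>The factor is kept as a natural number, which makes its positivity immediate: every
  further squared norm adds twice the dimension plus four times the degree of the polynomial it
  multiplies.\<close>

lemma laplacian_nsq_power_mult:
  fixes p :: "real ^ 'd \<Rightarrow> complex"
  assumes p: "hpoly n p" and harm: "\<And>x. laplacian p x = 0"
  shows "\<exists>c>0. \<forall>x. laplacian (\<lambda>x. nsq x ^ Suc k * p x) x = of_nat c * nsq x ^ k * p x"
proof (induction k)
  case 0
  have "0 < 2 * CARD('d) + 4 * n"
    by simp
  then show ?case
    using laplacian_nsq_mult[OF p] harm by (intro exI[of _ "2 * CARD('d) + 4 * n"]) simp
next
  case (Suc k)
  then obtain c where c: "c > 0" "\<And>x. laplacian (\<lambda>x. nsq x ^ Suc k * p x) x = of_nat c * nsq x ^ k * p x"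
    by blast
  define m where "m = Suc k * 2 + n"
  have h: "hpoly m (\<lambda>x. nsq x ^ Suc k * p x)"
    unfolding m_def using hpoly_power[OF hpoly_nsq] p by (intro hpoly.mult)
  have "laplacian (\<lambda>x. nsq x ^ Suc (Suc k) * p x) x = of_nat (c + 2 * CARD('d) + 4 * m) * nsq x ^ Suc k * p x" for x
  proof -
    have "laplacian (\<lambda>x. nsq x ^ Suc (Suc k) * p x) x = laplacian (\<lambda>x. nsq x * (nsq x ^ Suc k * p x)) x"
      by (simp add: mult.assoc)
    also have "\<dots> = of_nat (2 * CARD('d) + 4 * m) * (nsq x ^ Suc k * p x) + nsq x * (of_nat c * nsq x ^ k * p x)"
      by (simp only: laplacian_nsq_mult[OF h] c(2))
    finally show ?thesis
      by (simp add: algebra_simps)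
  qed
  then show ?case
    using c(1) by (intro exI[of _ "c + 2 * CARD('d) + 4 * m"]) auto
qed

section \<open>Linear substitution and conjugation\<close>

lemma partial_compose_matrix:
  fixes A :: "real ^ 'd ^ 'd"
  shows "hpoly n p \<Longrightarrow> partial i (\<lambda>x. p (A *v x)) = (\<lambda>x. \<Sum>j\<in>UNIV. of_real (A $ j $ i) * partial j p (A *v x))"
proof (induction rule: hpoly.induct)
  case (coord k)
  have "partial i (\<lambda>x. \<Sum>j\<in>UNIV. complex_of_real (A $ k $ j) * complex_of_real (x $ j)) = (\<lambda>x. complex_of_real (A $ k $ i))"
    by (subst partial_sum[OF hpoly_cmult[OF hpoly.coord]])
       (simp add: partial_cmult[OF hpoly.coord] partial_coord if_distrib[of "\<lambda>a. _ * a"] cong: if_cong)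
  then show ?case
    by (simp add: matrix_vector_mult_def partial_coord if_distrib[of "\<lambda>a. _ * a"] cong: if_cong)
next
  case (add n p q)
  show ?case
    by (simp add: partial_add[OF add.hyps] add.IH ring_distribs sum.distrib
      partial_add[OF hpoly_compose_matrix hpoly_compose_matrix, OF add.hyps])
next
  case (mult m p n q)
  show ?case
    by (simp add: partial_mult[OF mult.hyps] mult.IH
      partial_mult[OF hpoly_compose_matrix hpoly_compose_matrix, OF mult.hyps])
      (simp add: ring_distribs sum.distrib sum_distrib_left sum_distrib_right mult_ac)
qed simp

text \<open>The Laplacian is the trace of the Hessian, which the substitution conjugates by
  \<open>A\<close>. Summing over the differentiation index first leaves the inner products of the
  rows of \<open>A\<close>.\<close>

lemma laplacian_compose_orthogonal:
  fixes A :: "real ^ 'd ^ 'd"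
  assumes p: "hpoly n p" and A: "orthogonal_matrix A"
  shows "laplacian (\<lambda>x. p (A *v x)) x = laplacian p (A *v x)"
proof -
  have AA: "(\<Sum>i\<in>UNIV. A $ j $ i * A $ k $ i) = (if j = k then 1 else 0)" for j k
  proof -
    have "(A ** transpose A) $ j $ k = (mat 1 :: real ^ 'd ^ 'd) $ j $ k"
      using A by (simp add: orthogonal_matrix_def)
    then show ?thesis
      by (simp add: matrix_matrix_mult_def transpose_def mat_def)
  qed
  have p2: "partial i (\<lambda>x. partial j p (A *v x)) =
     (\<lambda>x. \<Sum>k\<in>UNIV. of_real (A $ k $ i) * partial k (partial j p) (A *v x))" for i j
    by (rule partial_compose_matrix[OF hpoly_partial[OF p]])
  have "partial i (partial i (\<lambda>x. p (A *v x))) = (\<lambda>x. \<Sum>j\<in>UNIV. of_real (A $ j $ i) *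
      partial i (\<lambda>x. partial j p (A *v x)) x)" for i
    unfolding partial_compose_matrix[OF p]
    by (subst partial_sum[OF hpoly_cmult[OF hpoly_compose_matrix[OF hpoly_partial[OF p]]]])
       (simp add: partial_cmult[OF hpoly_compose_matrix[OF hpoly_partial[OF p]]])
  then have "laplacian (\<lambda>x. p (A *v x)) x = (\<Sum>i\<in>UNIV. \<Sum>j\<in>UNIV. \<Sum>k\<in>UNIV.
     of_real (A $ j $ i * A $ k $ i) * partial k (partial j p) (A *v x))"
    by (simp add: laplacian_def p2 sum_distrib_left mult_ac)
  also have "\<dots> = (\<Sum>j\<in>UNIV. \<Sum>k\<in>UNIV. \<Sum>i\<in>UNIV.
     of_real (A $ j $ i * A $ k $ i) * partial k (partial j p) (A *v x))"
    by (subst sum.swap, intro sum.cong sum.swap refl)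
  also have "\<dots> = (\<Sum>j\<in>UNIV. \<Sum>k\<in>UNIV. of_real (if j = k then 1 else 0) * partial k (partial j p) (A *v x))"
    by (simp add: AA flip: sum_distrib_right of_real_sum of_real_mult)
  also have "\<dots> = laplacian p (A *v x)"
    by (simp add: laplacian_def if_distrib[of complex_of_real] if_distrib[of "\<lambda>a. a * _"] cong: if_cong)
  finally show ?thesis .
qed

lemma partial_cnj: "hpoly n p \<Longrightarrow> partial i (\<lambda>x. cnj (p x)) = (\<lambda>x. cnj (partial i p x))"
proof (induction rule: hpoly.induct)
  case (add n p q)
  show ?case
    by (simp add: partial_add[OF add.hyps] add.IH partial_add[OF hpoly_cnj hpoly_cnj, OF add.hyps])
next
  case (mult m p n q)
  show ?case
    by (simp add: partial_mult[OF mult.hyps] mult.IH partial_mult[OF hpoly_cnj hpoly_cnj, OF mult.hyps])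
qed (auto simp: partial_coord)

lemma laplacian_cnj: "hpoly n p \<Longrightarrow> laplacian (\<lambda>x. cnj (p x)) x = cnj (laplacian p x)"
  by (simp add: laplacian_def partial_cnj partial_cnj[OF hpoly_partial])

text \<open>As a rewrite rule this would turn \<open>transpose g *v x\<close> into
  \<open>x v* g\<close> and hide the inverse rotation from the lemmas about
  \<open>*v\<close>.\<close>

declare transpose_matrix_vector [simp del]

section \<open>Rotations\<close>

lemma SO_transpose: "g \<in> SO \<Longrightarrow> transpose g \<in> SO"
  by (auto simp: SO_def rotation_matrix_def det_transpose)

lemma SO_mult: "g \<in> SO \<Longrightarrow> h \<in> SO \<Longrightarrow> g ** h \<in> SO"
  by (auto simp: SO_def rotation_matrix_def det_mul orthogonal_matrix_mul)

lemma SO_transpose_mult: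
  assumes "g \<in> SO"
  shows "transpose g ** g = mat 1" "g ** transpose g = mat 1"
  using assms by (auto simp: SO_def rotation_matrix_def orthogonal_matrix_def)

lemma matrix_inv_SO:
  assumes g: "g \<in> SO"
  shows "matrix_inv g = transpose g"
proof -
  have "\<exists>B. g ** B = mat 1 \<and> B ** g = mat 1"
    using SO_transpose_mult[OF g] by blast
  then have "g ** matrix_inv g = mat 1"
    unfolding matrix_inv_def by (rule someI2_ex) simp
  then have "transpose g ** (g ** matrix_inv g) = transpose g"
    by simp
  then show ?thesis
    by (simp add: matrix_mul_assoc SO_transpose_mult[OF g])
qed

lemma SO_inner:
  assumes "g \<in> SO"
  shows "(g *v x) \<bullet> (g *v y) = x \<bullet> y"
  using SO_transpose_mult(1)[OF assms]
  by (metis dot_lmul_matrix matrix_vector_mul_assoc matrix_vector_mul_lid transpose_matrix_vector)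

lemma SO_norm: "g \<in> SO \<Longrightarrow> norm (g *v x) = norm x"
  by (simp add: norm_eq_sqrt_inner SO_inner)

lemma rotate_fun_SO: "g \<in> SO \<Longrightarrow> rotate_fun g f x = f (transpose g *v x)"
  by (simp add: rotate_fun_def matrix_inv_SO)

lemma rotate_fun_transpose_SO: "g \<in> SO \<Longrightarrow> rotate_fun (transpose g) f x = f (g *v x)"
  using rotate_fun_SO[OF SO_transpose] by simp

text \<open>The Householder reflection along \<open>v\<close>. Conjugating a diagonal sign change by
  an orthogonal \<open>Q\<close> that carries a coordinate axis to the direction of \<open>v\<close>
  makes orthogonality and determinant visible; the explicit formula \<open>S\<close> then gives the
  action on vectors.\<close>

lemma reflection_exists:
  fixes v :: "real ^ 'd"
  assumes "v \<noteq> 0"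
  obtains S where "orthogonal_matrix S" "det S = -1" "S *v v = - v" "\<And>w. v \<bullet> w = 0 \<Longrightarrow> S *v w = w"
proof -
  obtain k :: 'd where True by blast
  obtain Q where Q: "orthogonal_matrix Q" "Q *v axis k 1 = v /\<^sub>R norm v"
    using orthogonal_matrix_exists_basis[of "v /\<^sub>R norm v" k] assms by auto
  define D :: "real ^ 'd ^ 'd" where "D = (\<chi> i j. if i = j then (if i = k then -1 else 1) else 0)"
  have D: "D *v x = x - (2 * (x $ k)) *\<^sub>R axis k 1" for x
    by (simp add: D_def matrix_vector_mult_def vec_eq_iff axis_def if_distrib[of "\<lambda>a. a * _"] cong: if_cong)
  have "orthogonal_matrix D"
    unfolding orthogonal_matrix
    by (auto simp: D_def matrix_matrix_mult_def transpose_def mat_def vec_eq_iff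
        if_distrib[of "\<lambda>a. a * _"] cong: if_cong)
  then have oS: "orthogonal_matrix (Q ** D ** transpose Q)"
    using Q by (simp add: orthogonal_matrix_mul)
  have "det D = -1"
    by (subst det_diagonal) (auto simp: D_def prod.delta)
  moreover have "det Q * det Q = 1"
    using det_orthogonal_matrix[OF Q(1)] by auto
  ultimately have dS: "det (Q ** D ** transpose Q) = -1"
    by (simp add: det_mul det_transpose mult_ac)
  have QQ: "Q *v (transpose Q *v x) = x" "transpose Q *v (Q *v x) = x" for x
    using Q(1) by (simp_all add: matrix_vector_mul_assoc orthogonal_matrix_def)
  have k: "(transpose Q *v x) $ k = (v \<bullet> x) / norm v" for x
  proof -
    have "(transpose Q *v x) $ k = (transpose Q *v x) \<bullet> axis k 1"
      by (simp add: inner_axis)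
    also have "\<dots> = x \<bullet> (Q *v axis k 1)"
      by (metis dot_lmul_matrix transpose_matrix_vector)
    finally show ?thesis
      by (simp add: Q(2) inner_commute divide_inverse mult.commute)
  qed
  have S: "(Q ** D ** transpose Q) *v x = x - (2 * (v \<bullet> x) / (norm v)\<^sup>2) *\<^sub>R v" for x
    by (simp add: D QQ k matrix_vector_mult_diff_distrib matrix_vector_mult_scaleR Q(2) power2_eq_square
        divide_inverse flip: matrix_vector_mul_assoc)
  show ?thesis
  proof (rule that[OF oS dS])
    have "2 * (v \<bullet> v) / (norm v)\<^sup>2 = 2"
      using assms by (simp add: power2_norm_eq_inner)
    then show "(Q ** D ** transpose Q) *v v = - v"
      unfolding S by (simp add: scaleR_2)
  qed (simp add: S)
qed

text \<open>The reflection along \<open>x - y\<close> works: equal norms make \<open>x + y\<close>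
  orthogonal to \<open>x - y\<close>, hence fixed, and \<open>x\<close> and \<open>y\<close> are
  half the sum and half the difference of these two vectors.\<close>

lemma reflection_swap:
  fixes x y :: "real ^ 'd"
  assumes "norm x = norm y" "x \<noteq> y"
  obtains S where "orthogonal_matrix S" "det S = -1" "S *v x = y" "S *v y = x"
    "\<And>w. w \<bullet> x = w \<bullet> y \<Longrightarrow> S *v w = w"
proof -
  obtain S where S: "orthogonal_matrix S" "det S = -1" "S *v (x - y) = - (x - y)"
    "\<And>w. (x - y) \<bullet> w = 0 \<Longrightarrow> S *v w = w"
    using reflection_exists[of "x - y"] assms(2) by auto
  have "x \<bullet> x = y \<bullet> y"
    using assms(1) by (simp add: norm_eq)
  then have *: "S *v (x + y) = x + y"
    by (intro S(4)) (simp add: algebra_simps inner_commute)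
  have "S *v x = (1 / 2) *\<^sub>R (S *v (x + y) + S *v (x - y))"
    "S *v y = (1 / 2) *\<^sub>R (S *v (x + y) - S *v (x - y))"
    by (simp_all add: algebra_simps matrix_vector_mult_diff_distrib flip: scaleR_2)
  then have "S *v x = y" "S *v y = x"
    unfolding * S(3) by (simp_all flip: scaleR_2)
  moreover have "S *v w = w" if "w \<bullet> x = w \<bullet> y" for w
    using that by (intro S(4)) (simp add: inner_diff_left inner_commute[of w])
  ultimately show ?thesis
    using that S(1,2) by blast
qed

text \<open>In dimension at least 3 some \<open>v\<close> is orthogonal to both images. The
  reflection along \<open>v\<close> leaves them in place and turns the determinant into 1.\<close>

lemma reflection_to_SO:
  fixes S :: "real ^ 'd ^ 'd"
  assumes d: "3 \<le> CARD('d)" and S: "orthogonal_matrix S" "det S = -1"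
  obtains h where "h \<in> SO" "h *v x = S *v x" "h *v y = S *v y"
proof -
  have "dim {S *v x, S *v y} \<le> card {S *v x, S *v y}"
    by (rule dim_le_card') simp
  also have "\<dots> < DIM(real ^ 'd)"
    using d card_insert_le_m1[of 2 "{S *v y}" "S *v x"] by simp
  finally obtain v where v: "v \<noteq> 0" "\<And>w. w \<in> span {S *v x, S *v y} \<Longrightarrow> orthogonal v w"
    by (rule orthogonal_to_subspace_exists) blast
  obtain R where R: "orthogonal_matrix R" "det R = -1" "\<And>w. v \<bullet> w = 0 \<Longrightarrow> R *v w = w"
    using reflection_exists[OF v(1)] by blast
  show ?thesis
  proof (rule that)
    show "R ** S \<in> SO"
      using R S by (simp add: SO_def rotation_matrix_def orthogonal_matrix_mul det_mul)
    show "(R ** S) *v x = S *v x" "(R ** S) *v y = S *v y"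
      using R(3) v(2) by (simp_all add: orthogonal_def span_base flip: matrix_vector_mul_assoc)
  qed
qed

lemma SO_one: "mat 1 \<in> SO"
  by (simp add: SO_def rotation_matrix_def orthogonal_matrix_id)

text \<open>The stabilizer of \<open>e\<close> is transitive on each parallel of the sphere: the
  reflection exchanging \<open>y\<close> and \<open>y'\<close> already fixes \<open>e\<close>, and
  the determinant is then corrected without disturbing \<open>e\<close> or
  \<open>y'\<close>.\<close>

lemma SO_move:
  fixes y y' e :: "real ^ 'd"
  assumes "3 \<le> CARD('d)" "norm y = norm y'" "e \<bullet> y = e \<bullet> y'"
  obtains h where "h \<in> SO" "h *v e = e" "h *v y = y'"
proof (cases "y = y'")
  case True
  then show ?thesis
    using that[of "mat 1"] SO_one by simp
next
  case False
  then obtain S where S: "orthogonal_matrix S" "det S = -1" "S *v y = y'" "S *v e = e"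
    using reflection_swap[OF assms(2)] assms(3) by metis
  show ?thesis
    using reflection_to_SO[OF assms(1) S(1,2), of e y] that S by auto
qed

text \<open>Transitivity alone would not suffice for the symmetry of invariant kernels; a true
  exchange is required, which in the plane would be available only for equal or opposite
  points.\<close>

lemma SO_swap:
  fixes x y :: "real ^ 'd"
  assumes "3 \<le> CARD('d)" "norm x = norm y"
  obtains h where "h \<in> SO" "h *v x = y" "h *v y = x"
proof (cases "x = y")
  case True
  then show ?thesis
    using that[of "mat 1"] SO_one by simp
next
  case False
  then obtain S where S: "orthogonal_matrix S" "det S = -1" "S *v x = y" "S *v y = x"
    using reflection_swap[OF assms(2)] by metis
  show ?thesis
    using reflection_to_SO[OF assms(1) S(1,2), of x y] that S by auto
qed

section \<open>Spherical harmonics\<close>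

lemma spherical_harmonics_iff:
  "f \<in> spherical_harmonics n \<longleftrightarrow> (\<exists>p. hpoly n p \<and> (\<forall>x. laplacian p x = 0) \<and> f = sphere_restrict p)"
  by (auto simp: spherical_harmonics_def homogeneous_polys_eq)

lemma spherical_harmonicsE:
  assumes "f \<in> spherical_harmonics n"
  obtains p where "hpoly n p" "\<And>x. laplacian p x = 0" "f = sphere_restrict p"
  using assms by (auto simp: spherical_harmonics_iff)

lemma spherical_harmonicsI:
  "hpoly n p \<Longrightarrow> (\<And>x. laplacian p x = 0) \<Longrightarrow> f = sphere_restrict p \<Longrightarrow> f \<in> spherical_harmonics n"
  by (auto simp: spherical_harmonics_iff)

lemma spherical_harmonics_zero: "(\<lambda>x. 0) \<in> spherical_harmonics n"
  by (rule spherical_harmonicsI[OF hpoly_zero]) (auto simp: sphere_restrict_def)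

lemma spherical_harmonics_add:
  assumes "f \<in> spherical_harmonics n" "f' \<in> spherical_harmonics n"
  shows "(\<lambda>x. f x + f' x) \<in> spherical_harmonics n"
proof -
  obtain p q where "hpoly n p" "\<And>x. laplacian p x = 0" "f = sphere_restrict p"
     "hpoly n q" "\<And>x. laplacian q x = 0" "f' = sphere_restrict q"
    using assms by (auto elim!: spherical_harmonicsE)
  then show ?thesis
    by (intro spherical_harmonicsI[of n "\<lambda>x. p x + q x"])
       (auto simp: sphere_restrict_def laplacian_add intro: hpoly.add)
qed

lemma spherical_harmonics_cmult:
  assumes "f \<in> spherical_harmonics n"
  shows "(\<lambda>x. c * f x) \<in> spherical_harmonics n"
proof -
  obtain p where "hpoly n p" "\<And>x. laplacian p x = 0" "f = sphere_restrict p"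
    using assms by (auto elim!: spherical_harmonicsE)
  then show ?thesis
    by (intro spherical_harmonicsI[of n "\<lambda>x. c * p x"])
       (auto simp: sphere_restrict_def laplacian_cmult intro: hpoly_cmult)
qed

lemma spherical_harmonics_diff:
  assumes "f \<in> spherical_harmonics n" "f' \<in> spherical_harmonics n"
  shows "(\<lambda>x. f x - f' x) \<in> spherical_harmonics n"
  using spherical_harmonics_add[OF assms(1) spherical_harmonics_cmult[OF assms(2), of "-1"]] by simp

lemma spherical_harmonics_sum:
  "(\<And>i. i \<in> A \<Longrightarrow> f i \<in> spherical_harmonics n) \<Longrightarrow> (\<lambda>x. \<Sum>i\<in>A. f i x) \<in> spherical_harmonics n"
  by (induction A rule: infinite_finite_induct)
     (auto intro: spherical_harmonics_zero spherical_harmonics_add)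

lemma spherical_harmonics_cnj:
  assumes "f \<in> spherical_harmonics n"
  shows "(\<lambda>x. cnj (f x)) \<in> spherical_harmonics n"
proof -
  obtain p where "hpoly n p" "\<And>x. laplacian p x = 0" "f = sphere_restrict p"
    using assms by (auto elim!: spherical_harmonicsE)
  then show ?thesis
    by (intro spherical_harmonicsI[of n "\<lambda>x. cnj (p x)"])
       (auto simp: sphere_restrict_def laplacian_cnj intro: hpoly_cnj)
qed

lemma spherical_harmonics_rotate:
  assumes f: "f \<in> spherical_harmonics n" and g: "g \<in> SO"
  shows "rotate_fun g f \<in> spherical_harmonics n"
proof -
  obtain p where p: "hpoly n p" "\<And>x. laplacian p x = 0" "f = sphere_restrict p"
    using f by (auto elim!: spherical_harmonicsE)
  have o: "orthogonal_matrix (transpose g)"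
    using SO_transpose[OF g] by (simp add: SO_def rotation_matrix_def)
  show ?thesis
    by (intro spherical_harmonicsI[of n "\<lambda>x. p (transpose g *v x)"] hpoly_compose_matrix p(1))
       (auto simp: p laplacian_compose_orthogonal[OF p(1) o] sphere_restrict_def rotate_fun_SO[OF g]
         SO_norm[OF SO_transpose[OF g]])
qed

lemma spherical_harmonics_outside:
  "f \<in> spherical_harmonics n \<Longrightarrow> x \<notin> unit_sphere \<Longrightarrow> f x = 0"
  by (auto simp: spherical_harmonics_iff sphere_restrict_def)

lemma continuous_on_sphere_restrict:
  "continuous_on unit_sphere p \<Longrightarrow> continuous_on unit_sphere (sphere_restrict p)"
  by (rule continuous_on_eq) (auto simp: sphere_restrict_def)

lemma spherical_harmonics_continuous:
  "f \<in> spherical_harmonics n \<Longrightarrow> continuous_on unit_sphere f"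
  by (auto elim!: spherical_harmonicsE intro!: continuous_on_sphere_restrict intro: hpoly_continuous)

text \<open>
  The difference of the degrees must be even by parity, and then the Laplacian of
  \<open>|x|\<^bsup>2k\<^esup> p\<close> is a nonzero multiple of \<open>|x|\<^bsup>2k-2\<^esup> p\<close>.
\<close>

lemma spherical_harmonics_Int_less:
  fixes f :: "real ^ 'd \<Rightarrow> complex"
  assumes m: "f \<in> spherical_harmonics m" and n: "f \<in> spherical_harmonics n" and mn: "m < n"
  shows "f x = 0"
proof -
  obtain p where p: "hpoly m p" "\<And>x. laplacian p x = 0" "f = sphere_restrict p"
    using m by (auto elim!: spherical_harmonicsE)
  obtain q where q: "hpoly n q" "\<And>x. laplacian q x = 0" "f = sphere_restrict q"
    using n by (auto elim!: spherical_harmonicsE)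
  have pq: "p x = q x" if "x \<in> unit_sphere" for x
    using p(3) q(3) that by (metis sphere_restrict_def)
  have "p x = 0" if x: "x \<in> unit_sphere" for x
  proof (cases "even (m + n)")
    case False
    have "p ((-1) *\<^sub>R x) = (-1) ^ m * p x" "q ((-1) *\<^sub>R x) = (-1) ^ n * q x"
      using hpoly_scaleR[OF p(1), of "-1" x] hpoly_scaleR[OF q(1), of "-1" x] by simp_all
    moreover have "p ((-1) *\<^sub>R x) = q ((-1) *\<^sub>R x)"
      using x by (intro pq) auto
    ultimately show ?thesis
      using False pq[OF x] by (cases "even m") (auto simp: minus_one_power_iff eq_neg_iff_add_eq_0
        neg_eq_iff_add_eq_0)
  next
    case True
    then have "even (n - m)"
      using mn by auto
    then obtain j where "n - m = 2 * j"
      by (rule evenE)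
    moreover from this obtain k where "j = Suc k"
      using mn by (cases j) auto
    ultimately have k: "n = m + 2 * Suc k"
      using mn by simp
    have "hpoly n (\<lambda>x. nsq x ^ Suc k * p x)"
      using hpoly.mult[OF hpoly_power[OF hpoly_nsq, of "Suc k"] p(1)] unfolding k by (simp add: algebra_simps)
    then have "(\<lambda>x. nsq x ^ Suc k * p x) = q"
      by (rule hpoly_eq_sphere[OF _ q(1)]) (auto simp: nsq_eq pq)
    then have "laplacian (\<lambda>x. nsq x ^ Suc k * p x) x = 0"
      using q(2) by simp
    moreover obtain c where "c > 0" "\<And>x. laplacian (\<lambda>x. nsq x ^ Suc k * p x) x = of_nat c * nsq x ^ k * p x"
      using laplacian_nsq_power_mult[OF p(1,2)] by blast
    ultimately show ?thesis
      using x by (auto simp: nsq_eq)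
  qed
  then show ?thesis
    by (simp add: p(3) sphere_restrict_def)
qed

lemma spherical_harmonics_Int:
  assumes "f \<in> spherical_harmonics m" "f \<in> spherical_harmonics n" "m \<noteq> n"
  shows "f x = 0"
  using assms spherical_harmonics_Int_less by (metis nat_neq_iff)

text \<open>Powers of \<open>z\<close>, a coordinate plus \<i> times another one, are harmonic
  because the gradient of \<open>z\<close> is isotropic: its squared entries add up to 1 - 1 =
  0.\<close>

lemma spherical_harmonics_nonzero:
  assumes "2 \<le> CARD('d)"
  obtains f where "f \<in> (spherical_harmonics n :: (real ^ 'd \<Rightarrow> complex) set)" "f \<noteq> (\<lambda>x. 0)"
proof -
  obtain i j :: 'd where ij: "i \<noteq> j"
    using assms by (metis card_2_iff' UNIV_I card_le_Suc0_iff_eq finite not_less_eq_eq numeral_2_eq_2)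
  define z where "z = (\<lambda>x :: real ^ 'd. complex_of_real (x $ i) + \<i> * complex_of_real (x $ j))"
  have z: "hpoly 1 z"
    unfolding z_def by (intro hpoly.add hpoly_cmult hpoly.coord)
  have dz: "partial k z x = (if k = i then 1 else 0) + \<i> * (if k = j then 1 else 0)" for k x
    unfolding z_def by (simp add: partial_add[OF hpoly.coord hpoly_cmult[OF hpoly.coord]]
      partial_cmult[OF hpoly.coord] partial_coord)
  have lz: "laplacian z x = 0" for x
    by (simp add: laplacian_def dz[abs_def])
  have zn: "hpoly n (\<lambda>x. z x ^ n)" for n
    using hpoly_power[OF z, of n] by simp
  have dzz: "(\<Sum>k\<in>UNIV. partial k z x * partial k z x) = 0" for x
  proof -
    have "(\<Sum>k\<in>UNIV. partial k z x * partial k z x) = (\<Sum>k\<in>UNIV. (if k = i then 1 else 0) - (if k = j then 1 else 0))"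
      using ij by (intro sum.cong) (auto simp: dz)
    then show ?thesis
      by (simp add: sum_subtractf)
  qed
  \<comment> \<open>For exponent 0 the truncated \<open>n - 1\<close> is harmless, as the factor
    \<open>of_nat n\<close> vanishes.\<close>
  have dzn: "partial k (\<lambda>x. z x ^ n) x = of_nat n * z x ^ (n - 1) * partial k z x" for k n x
  proof (induction n)
    case (Suc n)
    have "partial k (\<lambda>x. z x ^ Suc n) x = partial k z x * z x ^ n + z x * partial k (\<lambda>x. z x ^ n) x"
      unfolding power_Suc by (simp only: partial_mult[OF z zn])
    then show ?case
      unfolding Suc.IH by (cases n) (simp_all add: algebra_simps)
  qed simp
  have "laplacian (\<lambda>x. z x ^ n) x = 0" for x
  proof (induction n)
    case (Suc n)
    have "(\<Sum>k\<in>UNIV. partial k z x * partial k (\<lambda>x. z x ^ n) x) =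
       of_nat n * z x ^ (n - 1) * (\<Sum>k\<in>UNIV. partial k z x * partial k z x)"
      by (simp add: dzn sum_distrib_left mult_ac)
    then show ?case
      by (simp add: laplacian_mult[OF z zn] lz Suc dzz)
  qed simp
  then have "sphere_restrict (\<lambda>x. z x ^ n) \<in> spherical_harmonics n"
    by (intro spherical_harmonicsI[OF zn]) auto
  moreover have "sphere_restrict (\<lambda>x. z x ^ n) (axis i 1) = 1"
    using ij by (simp add: sphere_restrict_def z_def) (simp add: axis_def)
  then have "sphere_restrict (\<lambda>x. z x ^ n) \<noteq> (\<lambda>x. 0)"
    by (metis zero_neq_one)
  ultimately show ?thesis
    using that by blast
qed

section \<open>Polynomials on the sphere\<close>

lemma spherical_harmonics_subset_sphere_polys:
  assumes "f \<in> spherical_harmonics n" "n \<le> N"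
  shows "f \<in> sphere_polys N"
  using assms unfolding sphere_polys_def
  by (auto simp: spherical_harmonics_zero if_distrib[of "\<lambda>h. h _"] cong: if_cong
     intro!: exI[of _ "\<lambda>m. if m = n then f else (\<lambda>x. 0)"])

lemma sphere_polys_add:
  assumes "f \<in> sphere_polys N" "f' \<in> sphere_polys N"
  shows "(\<lambda>x. f x + f' x) \<in> sphere_polys N"
proof -
  obtain h h' where "f = (\<lambda>x. \<Sum>n\<le>N. h n x)" "\<And>n. n \<le> N \<Longrightarrow> h n \<in> spherical_harmonics n"
     "f' = (\<lambda>x. \<Sum>n\<le>N. h' n x)" "\<And>n. n \<le> N \<Longrightarrow> h' n \<in> spherical_harmonics n"
    using assms by (auto simp: sphere_polys_def)
  then show ?thesis
    unfolding sphere_polys_def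
    by (auto simp: sum.distrib intro!: exI[of _ "\<lambda>n x. h n x + h' n x"] spherical_harmonics_add)
qed

lemma sphere_polys_cmult:
  assumes "f \<in> sphere_polys N"
  shows "(\<lambda>x. c * f x) \<in> sphere_polys N"
proof -
  obtain h where "f = (\<lambda>x. \<Sum>n\<le>N. h n x)" "\<And>n. n \<le> N \<Longrightarrow> h n \<in> spherical_harmonics n"
    using assms by (auto simp: sphere_polys_def)
  then show ?thesis
    unfolding sphere_polys_def
    by (auto simp: sum_distrib_left intro!: exI[of _ "\<lambda>n x. c * h n x"] spherical_harmonics_cmult)
qed

lemma sphere_polys_zero: "(\<lambda>x. 0) \<in> sphere_polys N"
  by (rule spherical_harmonics_subset_sphere_polys[OF spherical_harmonics_zero, of N]) simp

lemma sphere_polys_sum: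
  "(\<And>i. i \<in> A \<Longrightarrow> f i \<in> sphere_polys N) \<Longrightarrow> (\<lambda>x. \<Sum>i\<in>A. f i x) \<in> sphere_polys N"
  by (induction A rule: infinite_finite_induct)
     (auto intro: sphere_polys_zero sphere_polys_add)

lemma sphere_polys_cnj:
  assumes "f \<in> sphere_polys N"
  shows "(\<lambda>x. cnj (f x)) \<in> sphere_polys N"
proof -
  obtain h where "f = (\<lambda>x. \<Sum>n\<le>N. h n x)" "\<And>n. n \<le> N \<Longrightarrow> h n \<in> spherical_harmonics n"
    using assms by (auto simp: sphere_polys_def)
  then show ?thesis
    unfolding sphere_polys_def
    by (auto intro!: exI[of _ "\<lambda>n x. cnj (h n x)"] spherical_harmonics_cnj)
qed

lemma sphere_polys_continuous: "f \<in> sphere_polys N \<Longrightarrow> continuous_on unit_sphere f"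
  by (auto simp: sphere_polys_def intro!: continuous_on_sum intro: spherical_harmonics_continuous)

lemma sphere_polys_mono:
  assumes "f \<in> sphere_polys M" "M \<le> N"
  shows "f \<in> sphere_polys N"
proof -
  obtain h where h: "f = (\<lambda>x. \<Sum>n\<le>M. h n x)" "\<And>n. n \<le> M \<Longrightarrow> h n \<in> spherical_harmonics n"
    using assms by (auto simp: sphere_polys_def)
  show ?thesis
    unfolding h(1) using h(2) assms(2)
    by (intro sphere_polys_sum) (meson atMost_iff order_trans spherical_harmonics_subset_sphere_polys)
qed

text \<open>For harmonic \<open>p\<close> of degree \<open>n\<close>, the polynomial \<open>x\<^sub>i p - |x|\<^sup>2 \<partial>\<^sub>i p / (d + 2n - 2)\<close> is harmonic.\<close>

lemma sphere_polys_coord_mult_harmonic: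
  fixes f :: "real ^ 'd \<Rightarrow> complex"
  assumes d: "3 \<le> CARD('d)" and f: "f \<in> spherical_harmonics n"
  shows "(\<lambda>x. complex_of_real (x $ i) * f x) \<in> sphere_polys (Suc n)"
proof -
  obtain p where p: "hpoly n p" "\<And>x. laplacian p x = 0" "f = sphere_restrict p"
    using f by (auto elim!: spherical_harmonicsE)
  define D where "D = complex_of_nat (CARD('d) + 2 * n - 2)"
  have D: "D \<noteq> 0"
    using d unfolding D_def of_nat_eq_0_iff by linarith
  define q where "q = partial i p"
  have "laplacian p = (\<lambda>x. 0)"
    using p(2) by blast
  then have q: "hpoly (n - 1) q" "laplacian q x = 0" for x
    using hpoly_partial[OF p(1)] laplacian_partial[OF p(1), of i] by (auto simp: q_def)
  have q0: "q = (\<lambda>x. 0)" if "n = 0"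
    using hpoly_partial_degree[OF p(1)] that by (simp add: q_def)
  have nq: "hpoly (Suc n) (\<lambda>x. nsq x * q x)"
    using hpoly.mult[OF hpoly_nsq q(1)] q0 by (cases n) (auto simp: hpoly_zero)
  have xp: "hpoly (Suc n) (\<lambda>x. complex_of_real (x $ i) * p x)"
    using hpoly.mult[OF hpoly.coord p(1)] by simp
  have lap: "laplacian (\<lambda>x. complex_of_real (x $ i) * p x + (- 1 / D) * (nsq x * q x)) x = 0" for x
  proof -
    \<comment> \<open>The derivative \<open>q\<close> has degree \<open>n - 1\<close>, which
      explains the choice of \<open>D\<close>: the Laplacian of the correction cancels the term
      \<open>2 * q x\<close> of the product rule. In degree 0, where the subtraction truncates,
      \<open>q\<close> is zero.\<close>
    have "of_nat (2 * CARD('d) + 4 * (n - 1)) * q x = 2 * D * q x"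
    proof (cases n)
      case (Suc m)
      then have "complex_of_nat (2 * CARD('d) + 4 * (n - 1)) = 2 * D"
        unfolding D_def by simp
      then show ?thesis by simp
    qed (simp add: q0)
    then show ?thesis
      using D by (simp only: laplacian_add[OF xp hpoly_cmult[OF nq]] laplacian_cmult[OF nq]
        laplacian_nsq_mult[OF q(1)] q(2) laplacian_coord_mult[OF p(1)] p(2)) (simp add: q_def)
  qed
  have 1: "sphere_restrict (\<lambda>x. complex_of_real (x $ i) * p x + (- 1 / D) * (nsq x * q x)) \<in> sphere_polys (Suc n)"
    by (rule spherical_harmonics_subset_sphere_polys[OF _ order_refl],
        rule spherical_harmonicsI[OF hpoly.add[OF xp hpoly_cmult[OF nq]] lap refl])
  have 2: "sphere_restrict q \<in> sphere_polys (Suc n)"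
    using q by (intro spherical_harmonics_subset_sphere_polys[of _ "n - 1"] spherical_harmonicsI[of _ q]) auto
  \<comment> \<open>On the sphere the squared norm is 1, so the subtracted term restricts to a
    multiple of \<open>q\<close>, which is itself harmonic.\<close>
  have "(\<lambda>x. complex_of_real (x $ i) * f x) = (\<lambda>x.
     sphere_restrict (\<lambda>x. complex_of_real (x $ i) * p x + (- 1 / D) * (nsq x * q x)) x + (1 / D) * sphere_restrict q x)"
    by (auto simp: p(3) sphere_restrict_def nsq_eq)
  then show ?thesis
    using sphere_polys_add[OF 1 sphere_polys_cmult[OF 2]] by (simp only:)
qed

lemma sphere_polys_coord_mult:
  fixes f :: "real ^ 'd \<Rightarrow> complex"
  assumes d: "3 \<le> CARD('d)" and f: "f \<in> sphere_polys N"
  shows "(\<lambda>x. complex_of_real (x $ i) * f x) \<in> sphere_polys (Suc N)"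
proof -
  obtain h where h: "f = (\<lambda>x. \<Sum>n\<le>N. h n x)" "\<And>n. n \<le> N \<Longrightarrow> h n \<in> spherical_harmonics n"
    using f by (auto simp: sphere_polys_def)
  show ?thesis
    unfolding h(1) sum_distrib_left
    by (intro sphere_polys_sum sphere_polys_mono[OF sphere_polys_coord_mult_harmonic[OF d h(2)]]) auto
qed

text \<open>\<open>sphere_polys\<close> consists by definition of sums of harmonics. Acting on an
  arbitrary member \<open>f\<close> lets the induction absorb the factors of a product one after the
  other; with \<open>f\<close> the constant 1 every restricted polynomial is reached.\<close>

lemma sphere_polys_hpoly_mult:
  fixes f :: "real ^ 'd \<Rightarrow> complex"
  assumes d: "3 \<le> CARD('d)"
  shows "hpoly n p \<Longrightarrow> f \<in> sphere_polys N \<Longrightarrow> (\<lambda>x. p x * f x) \<in> sphere_polys (n + N)"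
proof (induction arbitrary: f N rule: hpoly.induct)
  case (add n p q)
  then show ?case
    by (simp add: ring_distribs sphere_polys_add)
next
  case (mult m p n q)
  then show ?case
    by (simp add: mult.assoc add.assoc)
qed (use sphere_polys_coord_mult[OF d] in \<open>simp_all add: sphere_polys_cmult\<close>)

lemma sphere_polys_hpoly:
  fixes p :: "real ^ 'd \<Rightarrow> complex"
  assumes d: "3 \<le> CARD('d)" and p: "hpoly n p" and n: "n \<le> N"
  shows "sphere_restrict p \<in> sphere_polys N"
proof -
  have "sphere_restrict (\<lambda>x :: real ^ 'd. 1) \<in> sphere_polys 0"
    by (intro spherical_harmonics_subset_sphere_polys[OF _ order_refl]
      spherical_harmonicsI[OF hpoly.const[of 1]]) auto
  from sphere_polys_hpoly_mult[OF d p this]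
  have "(\<lambda>x. p x * sphere_restrict (\<lambda>x :: real ^ 'd. 1) x) \<in> sphere_polys n"
    by simp
  also have "(\<lambda>x. p x * sphere_restrict (\<lambda>x :: real ^ 'd. 1) x) = sphere_restrict p"
    by (auto simp: sphere_restrict_def)
  finally show ?thesis
    using sphere_polys_mono n by blast
qed

section \<open>Zonal harmonics\<close>

text \<open>On the circle every square of \<open>t\<close> becomes \<open>1 - s\<^sup>2\<close>, so
  at most one factor \<open>t\<close> survives. It is counted through \<open>pCons 0 B\<close>,
  which has degree 0 when \<open>B = 0\<close>; requiring \<open>degree B + 1 \<le> n\<close> would
  fail for constants.\<close>

lemma hpoly_on_great_circle:
  fixes p :: "real ^ 'd \<Rightarrow> complex"
  assumes "hpoly n p"
  shows "\<exists>A B :: complex poly. degree A \<le> n \<and> degree (pCons 0 B) \<le> n \<and>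
    (\<forall>s t. s\<^sup>2 + t\<^sup>2 = 1 \<longrightarrow> p (s *\<^sub>R e + t *\<^sub>R e') = poly A (of_real s) + of_real t * poly B (of_real s))"
  using assms
proof (induction rule: hpoly.induct)
  case (const c)
  show ?case
    by (rule exI[of _ "[:c:]"], rule exI[of _ 0]) simp
next
  case (coord i)
  show ?case
    by (rule exI[of _ "[:0, of_real (e $ i):]"], rule exI[of _ "[:of_real (e' $ i):]"]) simp
next
  case (add n p q)
  obtain A B A' B' where "degree A \<le> n" "degree (pCons 0 B) \<le> n"
    "\<And>s t. s\<^sup>2 + t\<^sup>2 = 1 \<Longrightarrow> p (s *\<^sub>R e + t *\<^sub>R e') = poly A (of_real s) + of_real t * poly B (of_real s)"
    "degree A' \<le> n" "degree (pCons 0 B') \<le> n"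
    "\<And>s t. s\<^sup>2 + t\<^sup>2 = 1 \<Longrightarrow> q (s *\<^sub>R e + t *\<^sub>R e') = poly A' (of_real s) + of_real t * poly B' (of_real s)"
    using add.IH by metis
  then show ?case
    using degree_add_le[of "pCons 0 B" n "pCons 0 B'"]
    by (intro exI[of _ "A + A'"] exI[of _ "B + B'"]) (auto simp: degree_add_le algebra_simps)
next
  case (mult m p n q)
  obtain A B A' B' where AB: "degree A \<le> m" "degree (pCons 0 B) \<le> m"
    "\<And>s t. s\<^sup>2 + t\<^sup>2 = 1 \<Longrightarrow> p (s *\<^sub>R e + t *\<^sub>R e') = poly A (of_real s) + of_real t * poly B (of_real s)"
    "degree A' \<le> n" "degree (pCons 0 B') \<le> n"
    "\<And>s t. s\<^sup>2 + t\<^sup>2 = 1 \<Longrightarrow> q (s *\<^sub>R e + t *\<^sub>R e') = poly A' (of_real s) + of_real t * poly B' (of_real s)"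
    using mult.IH by metis
  have B: "degree B \<le> m" "degree B' \<le> n"
    using AB(2,5) by (auto split: if_splits simp: degree_pCons_eq_if)
  show ?case
  proof (intro exI conjI allI impI)
    have le: "degree (P * Q) \<le> m + n" if "degree P \<le> m" "degree Q \<le> n" for P Q :: "complex poly"
      using degree_mult_le[of P Q] that by linarith
    \<comment> \<open>The product of the two parts odd in \<open>t\<close> contributes
      \<open>B * B'\<close> minus \<open>s * B\<close> times \<open>s * B'\<close>; written with
      \<open>pCons 0\<close>, its degree bound is evident.\<close>
    show "degree (A * A' + B * B' - pCons 0 B * pCons 0 B') \<le> m + n"
      by (intro degree_add_le degree_diff_le le AB B)
    have "pCons 0 (A * B' + B * A') = A * pCons 0 B' + pCons 0 B * A'"
      by simp
    then show "degree (pCons 0 (A * B' + B * A')) \<le> m + n"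
      by (metis degree_add_le le AB(1,2,4,5))
    fix s t :: real
    assume st: "s\<^sup>2 + t\<^sup>2 = 1"
    then have "complex_of_real t * complex_of_real t = 1 - complex_of_real s * complex_of_real s"
      by (metis add_diff_cancel_left' of_real_1 of_real_diff of_real_mult power2_eq_square)
    then show "p (s *\<^sub>R e + t *\<^sub>R e') * q (s *\<^sub>R e + t *\<^sub>R e') =
       poly (A * A' + B * B' - pCons 0 B * pCons 0 B') (of_real s) + of_real t * poly (A * B' + B * A') (of_real s)"
      by (simp add: AB(3,6)[OF st]) algebra
  qed
qed

text \<open>A rotation about \<open>e\<close> takes \<open>x\<close> to either of two mirror points
  of a fixed great circle through \<open>e\<close>. Averaging the two values cancels the part odd in
  \<open>t\<close> and leaves a polynomial in \<open>e \<bullet> x\<close>.\<close>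

lemma zonal_harmonic_eq_poly:
  fixes f :: "real ^ 'd \<Rightarrow> complex"
  assumes d: "3 \<le> CARD('d)" and f: "f \<in> spherical_harmonics n" and e: "norm e = 1"
    and inv: "\<And>h x. h \<in> SO \<Longrightarrow> h *v e = e \<Longrightarrow> x \<in> unit_sphere \<Longrightarrow> f (h *v x) = f x"
  obtains A where "degree A \<le> n" "f = sphere_restrict (\<lambda>x. poly A (of_real (e \<bullet> x)))"
proof -
  obtain p where p: "hpoly n p" "f = sphere_restrict p"
    using f by (auto elim!: spherical_harmonicsE)
  obtain v where v: "v \<noteq> 0" "orthogonal e v"
    using orthogonal_to_vector_exists[of e] d by auto
  define e' where "e' = v /\<^sub>R norm v"
  have e': "norm e' = 1" "e \<bullet> e' = 0"
    using v by (auto simp: e'_def orthogonal_def)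
  obtain A B where AB: "degree A \<le> n"
    "\<And>s t. s\<^sup>2 + t\<^sup>2 = 1 \<Longrightarrow> p (s *\<^sub>R e + t *\<^sub>R e') = poly A (of_real s) + of_real t * poly B (of_real s)"
    using hpoly_on_great_circle[OF p(1)] by blast
  have "f x = poly A (of_real (e \<bullet> x))" if x: "x \<in> unit_sphere" for x
  proof -
    define s where "s = e \<bullet> x"
    have "\<bar>s\<bar> \<le> 1"
      using Cauchy_Schwarz_ineq2[of e x] e x by (simp add: s_def)
    then have s: "s\<^sup>2 \<le> 1"
      by (simp add: abs_square_le_1)
    define t where "t = sqrt (1 - s\<^sup>2)"
    have circ: "s\<^sup>2 + u\<^sup>2 = 1 \<and> f x = p (s *\<^sub>R e + u *\<^sub>R e')" if u: "u = t \<or> u = -t" for u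
    proof -
      have su: "s\<^sup>2 + u\<^sup>2 = 1"
        using s u by (auto simp: t_def)
      have n1: "norm (s *\<^sub>R e + u *\<^sub>R e') = 1"
        using su e e' by (simp add: norm_eq_1 inner_add_left inner_add_right inner_commute[of e' e]
          power2_eq_square)
      have "norm x = norm (s *\<^sub>R e + u *\<^sub>R e')" "e \<bullet> x = e \<bullet> (s *\<^sub>R e + u *\<^sub>R e')"
        using x e e' by (simp_all only: n1) (simp_all add: inner_add_right norm_eq_1 s_def)
      then obtain h where "h \<in> SO" "h *v e = e" "h *v x = s *\<^sub>R e + u *\<^sub>R e'"
        using SO_move[OF d] by blast
      then have "f x = f (s *\<^sub>R e + u *\<^sub>R e')"
        using inv x by metis
      then show ?thesis
        using su n1 by (simp add: p(2) sphere_restrict_def)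
    qed
    have "f x = poly A (of_real s) + of_real t * poly B (of_real s)"
      "f x = poly A (of_real s) - of_real t * poly B (of_real s)"
      using circ[of t] circ[of "-t"] AB(2)[of s t] AB(2)[of s "-t"] by auto
    then have "2 * f x = 2 * poly A (of_real s)"
      by algebra
    then show ?thesis
      by (simp add: s_def)
  qed
  then have "f = sphere_restrict (\<lambda>x. poly A (of_real (e \<bullet> x)))"
    by (auto simp: fun_eq_iff sphere_restrict_def p(2))
  then show ?thesis
    using that AB(1) by blast
qed

lemma sphere_polys_zonal:
  fixes e :: "real ^ 'd"
  assumes d: "3 \<le> CARD('d)" and A: "degree A \<le> N"
  shows "sphere_restrict (\<lambda>x. poly A (of_real (e \<bullet> x))) \<in> sphere_polys N"
proof -
  have lin: "hpoly 1 (\<lambda>x :: real ^ 'd. complex_of_real (e \<bullet> x))"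
    unfolding inner_vec_def by (auto intro!: hpoly_sum hpoly_cmult hpoly_coord')
  have lin': "hpoly i (\<lambda>x :: real ^ 'd. complex_of_real (e \<bullet> x) ^ i)" for i
    using hpoly_power[OF lin, of i] by simp
  have "sphere_restrict (\<lambda>x. poly A (of_real (e \<bullet> x))) =
     (\<lambda>x. \<Sum>i\<le>degree A. coeff A i * sphere_restrict (\<lambda>x. complex_of_real (e \<bullet> x) ^ i) x)"
    by (auto simp: fun_eq_iff sphere_restrict_def poly_altdef)
  also have "\<dots> \<in> sphere_polys N"
    using A
    by (intro sphere_polys_sum sphere_polys_cmult sphere_polys_hpoly[OF d lin']) auto
  finally show ?thesis .
qed

section \<open>Square-integrable functions\<close>

lemma borel_measurable_cnj [measurable (raw)]:
  "f \<in> borel_measurable M \<Longrightarrow> (\<lambda>x. cnj (f x)) \<in> borel_measurable M"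
  by (rule measurable_compose[OF _ borel_measurable_continuous_onI]) (auto intro: continuous_intros)

lemma L2_integrable_mult:
  assumes "f \<in> L2_space M" "f' \<in> L2_space M"
  shows "integrable M (\<lambda>x. f x * cnj (f' x))"
proof (rule Bochner_Integration.integrable_bound)
  show "integrable M (\<lambda>x. (cmod (f x))\<^sup>2 + (cmod (f' x))\<^sup>2)"
    using assms by (auto simp: L2_space_def)
  show "(\<lambda>x. f x * cnj (f' x)) \<in> borel_measurable M"
    using assms by (auto simp: L2_space_def)
  have "a * b \<le> a\<^sup>2 + b\<^sup>2" for a b :: real
    using sum_squares_bound[of a b] sum_squares_bound[of a "-b"] by simp
  then show "AE x in M. norm (f x * cnj (f' x)) \<le> norm ((cmod (f x))\<^sup>2 + (cmod (f' x))\<^sup>2)"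
    by (auto simp: norm_mult)
qed

lemma L2_space_cmult: "f \<in> L2_space M \<Longrightarrow> (\<lambda>x. c * f x) \<in> L2_space M"
  by (auto simp: L2_space_def norm_mult power_mult_distrib)

lemma cmod_add_squared_le: "(cmod (a + b))\<^sup>2 \<le> 2 * (cmod a)\<^sup>2 + 2 * (cmod b)\<^sup>2"
proof -
  have "(cmod (a + b))\<^sup>2 \<le> (cmod a + cmod b)\<^sup>2"
    by (intro power_mono norm_triangle_ineq) auto
  then show ?thesis
    using sum_squares_bound[of "cmod a" "cmod b"] by (simp add: power2_sum)
qed

lemma L2_space_add:
  assumes "f \<in> L2_space M" "f' \<in> L2_space M"
  shows "(\<lambda>x. f x + f' x) \<in> L2_space M"
proof -
  have "integrable M (\<lambda>x. (cmod (f x + f' x))\<^sup>2)"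
  proof (rule Bochner_Integration.integrable_bound)
    show "integrable M (\<lambda>x. 2 * (cmod (f x))\<^sup>2 + 2 * (cmod (f' x))\<^sup>2)"
      using assms by (auto simp: L2_space_def)
    show "(\<lambda>x. (cmod (f x + f' x))\<^sup>2) \<in> borel_measurable M"
      using assms by (auto simp: L2_space_def)
    show "AE x in M. norm ((cmod (f x + f' x))\<^sup>2) \<le> norm (2 * (cmod (f x))\<^sup>2 + 2 * (cmod (f' x))\<^sup>2)"
      by (auto intro: cmod_add_squared_le)
  qed
  then show ?thesis
    using assms by (auto simp: L2_space_def)
qed

lemma L2_space_zero: "(\<lambda>x. 0) \<in> L2_space M"
  by (auto simp: L2_space_def)

lemma L2_space_diff: "f \<in> L2_space M \<Longrightarrow> f' \<in> L2_space M \<Longrightarrow> (\<lambda>x. f x - f' x) \<in> L2_space M"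
  using L2_space_add[OF _ L2_space_cmult, of f M f' "-1"] by simp

lemma L2_space_sum:
  "(\<And>i. i \<in> A \<Longrightarrow> f i \<in> L2_space M) \<Longrightarrow> (\<lambda>x. \<Sum>i\<in>A. f i x) \<in> L2_space M"
  by (induction A rule: infinite_finite_induct) (auto intro: L2_space_zero L2_space_add)

lemma L2_inner_commute: "L2_inner M f f' = cnj (L2_inner M f' f)"
  unfolding L2_inner_def by (subst Bochner_Integration.integral_cnj[symmetric]) (simp add: mult.commute)

lemma L2_inner_cmult_left: "L2_inner M (\<lambda>x. c * f x) f' = c * L2_inner M f f'"
  by (simp add: L2_inner_def mult.assoc)

lemma L2_inner_cmult_right: "L2_inner M f (\<lambda>x. c * f' x) = cnj c * L2_inner M f f'"
  by (simp add: L2_inner_def mult.left_commute)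

lemma L2_inner_zero [simp]: "L2_inner M (\<lambda>x. 0) f = 0" "L2_inner M f (\<lambda>x. 0) = 0"
  by (simp_all add: L2_inner_def)

lemma L2_inner_add_left:
  assumes "f \<in> L2_space M" "f' \<in> L2_space M" "g \<in> L2_space M"
  shows "L2_inner M (\<lambda>x. f x + f' x) g = L2_inner M f g + L2_inner M f' g"
  by (simp add: L2_inner_def ring_distribs L2_integrable_mult[OF assms(1,3)] L2_integrable_mult[OF assms(2,3)])

lemma L2_inner_diff_left:
  assumes "f \<in> L2_space M" "f' \<in> L2_space M" "g \<in> L2_space M"
  shows "L2_inner M (\<lambda>x. f x - f' x) g = L2_inner M f g - L2_inner M f' g"
  by (simp add: L2_inner_def left_diff_distrib L2_integrable_mult[OF assms(1,3)] L2_integrable_mult[OF assms(2,3)])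

lemma L2_inner_sum_left:
  assumes "\<And>i. i \<in> A \<Longrightarrow> f i \<in> L2_space M" "g \<in> L2_space M"
  shows "L2_inner M (\<lambda>x. \<Sum>i\<in>A. f i x) g = (\<Sum>i\<in>A. L2_inner M (f i) g)"
  using assms(1)
proof (induction A rule: infinite_finite_induct)
  case (insert i A)
  then show ?case
    using L2_inner_add_left[OF _ L2_space_sum[of A f] assms(2), of "f i"] by simp
qed simp_all

lemma L2_inner_sum_right:
  assumes "\<And>i. i \<in> A \<Longrightarrow> f i \<in> L2_space M" "g \<in> L2_space M"
  shows "L2_inner M g (\<lambda>x. \<Sum>i\<in>A. f i x) = (\<Sum>i\<in>A. L2_inner M g (f i))"
  by (subst L2_inner_commute, subst L2_inner_sum_left[OF assms])
     (auto simp: L2_inner_commute[of M g] intro: sum.cong)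

lemma L2_inner_self: "L2_inner M f f = of_real ((L2_norm M f)\<^sup>2)"
proof -
  have "L2_inner M f f = (\<integral>x. complex_of_real ((cmod (f x))\<^sup>2) \<partial>M)"
    by (simp add: L2_inner_def complex_norm_square del: of_real_power)
  also have "\<dots> = of_real (\<integral>x. (cmod (f x))\<^sup>2 \<partial>M)"
    by (rule integral_complex_of_real)
  finally show ?thesis
    by (simp add: L2_norm_def)
qed

lemma L2_inner_cong:
  "(\<And>x. x \<in> space M \<Longrightarrow> f x = f' x) \<Longrightarrow> (\<And>x. x \<in> space M \<Longrightarrow> h x = h' x) \<Longrightarrow>
    L2_inner M f h = L2_inner M f' h'"
  unfolding L2_inner_def by (intro Bochner_Integration.integral_cong) auto

section \<open>Invariant measures\<close>

text \<open>Invariance is postulated for images of sets, whereas a change of variables needs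
  preimages. The preimage under \<open>T\<close> is the image under its inverse \<open>T'\<close>,
  hence the hypothesis on \<open>T'\<close>.\<close>

lemma distr_eq_of_invariant_image:
  fixes M :: "'a :: topological_space measure"
  assumes M: "sets M = sets (restrict_space borel S)"
    and T: "continuous_on S T" "T \<in> S \<rightarrow> S"
    and T': "T' \<in> S \<rightarrow> S" "\<And>x. x \<in> S \<Longrightarrow> T (T' x) = x" "\<And>x. x \<in> S \<Longrightarrow> T' (T x) = x"
    and inv: "\<And>A. A \<in> sets M \<Longrightarrow> emeasure M (T' ` A) = emeasure M A"
  shows "T \<in> M \<rightarrow>\<^sub>M M" "distr M M T = M"
proof -
  have space: "space M = S"
    using sets_eq_imp_space_eq[OF M] by (simp add: space_restrict_space)
  have "T \<in> borel_measurable (restrict_space borel S)"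
    by (rule borel_measurable_continuous_on_restrict[OF T(1)])
  then have "T \<in> restrict_space borel S \<rightarrow>\<^sub>M restrict_space borel S"
    using T(2) by (intro measurable_restrict_space2) (auto simp: space_restrict_space)
  then show meas: "T \<in> M \<rightarrow>\<^sub>M M"
    by (simp add: measurable_cong_sets[OF M M])
  show "distr M M T = M"
  proof (rule measure_eqI)
    fix A assume "A \<in> sets (distr M M T)"
    then have A: "A \<in> sets M" by simp
    then have AS: "A \<subseteq> S"
      using sets.sets_into_space space by blast
    have "T -` A \<inter> S = T' ` A"
      using AS T T' by (auto simp: image_iff Pi_iff subset_iff) metis
    then show "emeasure (distr M M T) A = emeasure M A"
      by (simp add: emeasure_distr[OF meas A] space inv[OF A])
  qed simp
qed

section \<open>Rotations of square-integrable functions on the sphere\<close>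

locale sphere_measure =
  fixes \<omega> :: "(real ^ 'd) measure"
  assumes normalized: "normalized_sphere_measure \<omega>"
begin

lemma sets_sphere: "sets \<omega> = sets (restrict_space borel unit_sphere)"
  using normalized by (simp add: normalized_sphere_measure_def)

lemma space_sphere [simp]: "space \<omega> = unit_sphere"
  using sets_eq_imp_space_eq[OF sets_sphere] by (simp add: space_restrict_space)

sublocale finite_measure \<omega>
  by standard (use normalized in \<open>simp add: normalized_sphere_measure_def\<close>)

lemma continuous_measurable:
  fixes f :: "real ^ 'd \<Rightarrow> 'b :: topological_space"
  shows "continuous_on unit_sphere f \<Longrightarrow> f \<in> borel_measurable \<omega>"
  using borel_measurable_continuous_on_restrict[of unit_sphere f]
  by (simp add: measurable_cong_sets[OF sets_sphere])

lemma continuous_bounded: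
  fixes f :: "real ^ 'd \<Rightarrow> complex"
  assumes "continuous_on unit_sphere f"
  obtains C where "\<And>x. x \<in> unit_sphere \<Longrightarrow> cmod (f x) \<le> C" "C \<ge> 0"
proof -
  have "bounded (f ` unit_sphere)"
    using assms by (intro compact_imp_bounded compact_continuous_image) auto
  then obtain C where "\<And>x. x \<in> unit_sphere \<Longrightarrow> cmod (f x) \<le> C"
    unfolding bounded_iff by blast
  then show ?thesis
    using that[of "max C 0"] by (simp add: le_max_iff_disj)
qed

lemma continuous_L2:
  assumes "continuous_on unit_sphere f"
  shows "f \<in> L2_space \<omega>"
proof -
  obtain C where C: "\<And>x. x \<in> unit_sphere \<Longrightarrow> cmod (f x) \<le> C" "C \<ge> 0"
    using continuous_bounded[OF assms] by blast
  have "integrable \<omega> (\<lambda>x. (cmod (f x))\<^sup>2)"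
    using C continuous_measurable[OF assms]
    by (intro integrable_const_bound[of _ "C\<^sup>2"]) (auto intro!: AE_I2 power_mono)
  then show ?thesis
    using continuous_measurable[OF assms] by (simp add: L2_space_def)
qed

lemma rotation_invariant:
  assumes g: "g \<in> SO"
  shows "(\<lambda>x. g *v x) \<in> \<omega> \<rightarrow>\<^sub>M \<omega>" "distr \<omega> \<omega> (\<lambda>x. g *v x) = \<omega>"
proof -
  have inv: "emeasure \<omega> ((\<lambda>x. transpose g *v x) ` A) = emeasure \<omega> A" if "A \<in> sets \<omega>" for A
    using normalized SO_transpose[OF g] that unfolding normalized_sphere_measure_def by blast
  have c: "continuous_on unit_sphere (\<lambda>x. g *v x)"
    by (intro continuous_intros)
  have "(\<lambda>x. g *v x) \<in> unit_sphere \<rightarrow> unit_sphere" "(\<lambda>x. transpose g *v x) \<in> unit_sphere \<rightarrow> unit_sphere"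
    using SO_norm[OF g] SO_norm[OF SO_transpose[OF g]] by auto
  note * = distr_eq_of_invariant_image[OF sets_sphere c this _ _ inv]
  show "(\<lambda>x. g *v x) \<in> \<omega> \<rightarrow>\<^sub>M \<omega>" "distr \<omega> \<omega> (\<lambda>x. g *v x) = \<omega>"
    by (intro *; simp add: matrix_vector_mul_assoc SO_transpose_mult[OF g])+
qed

lemma L2_inner_rotate:
  assumes g: "g \<in> SO" and f: "f \<in> borel_measurable \<omega>" "f' \<in> borel_measurable \<omega>"
  shows "L2_inner \<omega> (rotate_fun g f) (rotate_fun g f') = L2_inner \<omega> f f'"
proof -
  note inv = rotation_invariant[OF SO_transpose[OF g]]
  have "L2_inner \<omega> f f' = (\<integral>x. f x * cnj (f' x) \<partial>distr \<omega> \<omega> (\<lambda>x. transpose g *v x))"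
    by (simp add: inv(2) L2_inner_def)
  also have "\<dots> = (\<integral>x. f (transpose g *v x) * cnj (f' (transpose g *v x)) \<partial>\<omega>)"
    using f by (intro integral_distr inv) auto
  finally show ?thesis
    by (simp add: L2_inner_def rotate_fun_SO[OF g])
qed

lemma rotate_continuous:
  assumes "g \<in> SO" "continuous_on unit_sphere f"
  shows "continuous_on unit_sphere (rotate_fun g f)"
proof -
  have "continuous_on unit_sphere (\<lambda>x. f (transpose g *v x))"
    using SO_norm[OF SO_transpose[OF assms(1)]]
    by (intro continuous_on_compose2[OF assms(2)] continuous_intros) auto
  then show ?thesis
    by (simp add: rotate_fun_SO[OF assms(1)] cong: continuous_on_cong)
qed

lemma rotate_measurable:
  assumes g: "g \<in> SO" and f: "f \<in> borel_measurable \<omega>"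
  shows "rotate_fun g f \<in> borel_measurable \<omega>"
  using measurable_compose[OF rotation_invariant(1)[OF SO_transpose[OF g]] f]
  by (simp add: rotate_fun_SO[OF g] cong: measurable_cong)

lemma rotate_rotate:
  assumes "g \<in> SO" "h \<in> SO"
  shows "rotate_fun g (rotate_fun h f) = rotate_fun (g ** h) f"
  by (simp add: fun_eq_iff rotate_fun_SO[OF assms(1)] rotate_fun_SO[OF assms(2)] rotate_fun_SO[OF SO_mult[OF assms]]
    matrix_transpose_mul matrix_vector_mul_assoc)

lemma L2_inner_rotate_left:
  assumes g: "g \<in> SO" and f: "f \<in> borel_measurable \<omega>" "f' \<in> borel_measurable \<omega>"
  shows "L2_inner \<omega> (rotate_fun g f) f' = L2_inner \<omega> f (rotate_fun (transpose g) f')"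
proof -
  have "rotate_fun g (rotate_fun (transpose g) f') = f'"
    by (simp add: rotate_rotate[OF g SO_transpose[OF g]] SO_transpose_mult[OF g] rotate_fun_SO[OF SO_one] fun_eq_iff
        transpose_mat)
  then show ?thesis
    using L2_inner_rotate[OF g f(1) rotate_measurable[OF SO_transpose[OF g] f(2)]] by simp
qed

end

section \<open>Expansions in the given orthonormal bases\<close>

locale spherical_basis = sphere_measure \<omega>
  for \<omega> :: "(real ^ 'd) measure" +
  fixes I :: "nat \<Rightarrow> 'k set" and Y :: "nat \<Rightarrow> 'k \<Rightarrow> real ^ 'd \<Rightarrow> complex"
  assumes dim: "3 \<le> CARD('d)" and basis: "\<And>n. orthonormal_basis_harmonics \<omega> n (I n) (Y n)"
begin

lemma finite_I [simp]: "finite (I n)"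
  using basis[of n] by (simp add: orthonormal_basis_harmonics_def)

lemma card_I: "card (I n) = cfun.dim (spherical_harmonics n :: (real ^ 'd \<Rightarrow> complex) set)"
  using basis[of n] by (simp add: orthonormal_basis_harmonics_def)

lemma Y_harmonic [simp]: "k \<in> I n \<Longrightarrow> Y n k \<in> spherical_harmonics n"
  using basis[of n] by (simp add: orthonormal_basis_harmonics_def)

lemma Y_orthonormal: "k \<in> I n \<Longrightarrow> l \<in> I n \<Longrightarrow> L2_inner \<omega> (Y n k) (Y n l) = (if k = l then 1 else 0)"
  using basis[of n] by (simp add: orthonormal_basis_harmonics_def)

lemma harmonics_L2: "f \<in> spherical_harmonics n \<Longrightarrow> f \<in> L2_space \<omega>"
  by (intro continuous_L2 spherical_harmonics_continuous)

lemma Y_L2 [simp]: "k \<in> I n \<Longrightarrow> Y n k \<in> L2_space \<omega>"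
  using harmonics_L2 Y_harmonic by blast

lemma sphere_polys_L2: "f \<in> sphere_polys N \<Longrightarrow> f \<in> L2_space \<omega>"
  by (intro continuous_L2 sphere_polys_continuous)

lemma harmonics_measurable: "f \<in> spherical_harmonics n \<Longrightarrow> f \<in> borel_measurable \<omega>"
  by (intro continuous_measurable spherical_harmonics_continuous)

lemma inner_combination:
  assumes "l \<in> I n"
  shows "L2_inner \<omega> (\<lambda>x. \<Sum>k\<in>I n. c k * Y n k x) (Y n l) = c l"
proof -
  have "L2_inner \<omega> (\<lambda>x. \<Sum>k\<in>I n. c k * Y n k x) (Y n l) = (\<Sum>k\<in>I n. c k * L2_inner \<omega> (Y n k) (Y n l))"
    using assms by (subst L2_inner_sum_left) (auto intro: L2_space_cmult simp: L2_inner_cmult_left)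
  also have "\<dots> = c l"
    using assms by (simp add: Y_orthonormal if_distrib[of "\<lambda>a. _ * a"] cong: if_cong)
  finally show ?thesis .
qed

lemma combination_harmonic: "(\<lambda>x. \<Sum>k\<in>I n. c k * Y n k x) \<in> spherical_harmonics n"
  by (intro spherical_harmonics_sum spherical_harmonics_cmult) auto

lemma harmonic_expansion:
  assumes "f \<in> spherical_harmonics n"
  shows "f x = (\<Sum>k\<in>I n. L2_inner \<omega> f (Y n k) * Y n k x)"
proof -
  have "f \<in> cfun.span (Y n ` I n)"
    using assms basis[of n] by (simp add: orthonormal_basis_harmonics_def)
  then have "\<exists>c. f = (\<lambda>x. \<Sum>k\<in>I n. c k * Y n k x)"
  proof (induction rule: cfun.span_induct_alt)
    case base
    show ?case
      by (rule exI[of _ "\<lambda>_. 0"]) (simp add: zero_fun_def)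
  next
    case (step c y z)
    then obtain k d where "k \<in> I n" "y = Y n k" "z = (\<lambda>x. \<Sum>k\<in>I n. d k * Y n k x)"
      by auto
    moreover from this have "(\<Sum>j\<in>I n. (d j + (if j = k then c else 0)) * Y n j x) =
        c * Y n k x + (\<Sum>j\<in>I n. d j * Y n j x)" for x
      by (simp add: ring_distribs sum.distrib if_distrib[of "\<lambda>a. a * _"] cong: if_cong)
    ultimately show ?case
      by (intro exI[of _ "\<lambda>j. d j + (if j = k then c else 0)"]) (auto simp: plus_fun_def fun_eq_iff)
  qed
  then obtain c where f: "f = (\<lambda>x. \<Sum>k\<in>I n. c k * Y n k x)"
    by blast
  show ?thesis
    by (subst f, subst f) (auto simp: inner_combination intro: sum.cong)
qed

lemma harmonic_eqI:
  assumes "f \<in> spherical_harmonics n" "f' \<in> spherical_harmonics n"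
    "\<And>k. k \<in> I n \<Longrightarrow> L2_inner \<omega> f (Y n k) = L2_inner \<omega> f' (Y n k)"
  shows "f = f'"
  using harmonic_expansion[OF assms(1)] harmonic_expansion[OF assms(2)] assms(3)
  by (auto simp: fun_eq_iff)

lemma inner_harmonic:
  assumes f: "f \<in> L2_space \<omega>" and h: "h \<in> spherical_harmonics n"
  shows "L2_inner \<omega> f h = (\<Sum>k\<in>I n. L2_inner \<omega> f (Y n k) * cnj (L2_inner \<omega> h (Y n k)))"
proof -
  have "L2_inner \<omega> f h = L2_inner \<omega> f (\<lambda>x. \<Sum>k\<in>I n. L2_inner \<omega> h (Y n k) * Y n k x)"
    using harmonic_expansion[OF h] by (intro L2_inner_cong) auto
  also have "\<dots> = (\<Sum>k\<in>I n. cnj (L2_inner \<omega> h (Y n k)) * L2_inner \<omega> f (Y n k))"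
    using f by (subst L2_inner_sum_right) (auto intro: L2_space_cmult simp: L2_inner_cmult_right)
  finally show ?thesis
    by (simp add: mult.commute)
qed

section \<open>Schur's lemma for spherical harmonics\<close>

text \<open>The conjugate sits on \<open>x\<close> because the inner product is conjugate-linear in
  its second argument; pairing with \<open>kernel n x\<close> then evaluates a harmonic at
  \<open>x\<close>.\<close>

definition kernel :: "nat \<Rightarrow> real ^ 'd \<Rightarrow> real ^ 'd \<Rightarrow> complex" where
  "kernel n x = (\<lambda>y. \<Sum>k\<in>I n. cnj (Y n k x) * Y n k y)"

lemma kernel_harmonic [simp]: "kernel n x \<in> spherical_harmonics n"
  unfolding kernel_def by (rule combination_harmonic)

lemma inner_kernel: "k \<in> I n \<Longrightarrow> L2_inner \<omega> (kernel n x) (Y n k) = cnj (Y n k x)"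
  unfolding kernel_def by (simp add: inner_combination)

lemma kernel_reproducing:
  assumes "f \<in> spherical_harmonics n"
  shows "L2_inner \<omega> f (kernel n x) = f x"
  using assms by (simp add: inner_harmonic[of f "kernel n x" n] harmonics_L2 inner_kernel harmonic_expansion[of f n x])

text \<open>Both functions represent evaluation at \<open>g *v x\<close>, as the pairings with the
  basis show.\<close>

lemma rotate_kernel:
  assumes g: "g \<in> SO"
  shows "rotate_fun g (kernel n x) = kernel n (g *v x)"
proof (rule harmonic_eqI)
  fix k assume k: "k \<in> I n"
  have "L2_inner \<omega> (rotate_fun g (kernel n x)) (Y n k) = L2_inner \<omega> (kernel n x) (rotate_fun (transpose g) (Y n k))"
    using k by (intro L2_inner_rotate_left g harmonics_measurable[of _ n]) auto
  also have "\<dots> = cnj (rotate_fun (transpose g) (Y n k) x)"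
    using k g by (subst L2_inner_commute, subst kernel_reproducing) (auto intro: spherical_harmonics_rotate SO_transpose)
  finally show "L2_inner \<omega> (rotate_fun g (kernel n x)) (Y n k) = L2_inner \<omega> (kernel n (g *v x)) (Y n k)"
    using k g by (simp add: inner_kernel rotate_fun_transpose_SO)
qed (auto intro: spherical_harmonics_rotate g)

text \<open>For \<open>C k l = B (Y n k) (Y m l)\<close> and an invariant form \<open>B\<close>
  these are the values of \<open>B\<close> on pairs of reproducing kernels. The argument is a bare
  coefficient array so that \<open>B\<close> minus a multiple of the Kronecker symbol can be treated
  as well.\<close>

definition form_kernel :: "nat \<Rightarrow> nat \<Rightarrow> ('k \<Rightarrow> 'k \<Rightarrow> complex) \<Rightarrow> real ^ 'd \<Rightarrow> real ^ 'd \<Rightarrow> complex" where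
  "form_kernel n m C x y = (\<Sum>k\<in>I n. \<Sum>l\<in>I m. cnj (Y n k x) * Y m l y * C k l)"

lemma form_kernel_right: "form_kernel n m C x \<in> spherical_harmonics m"
proof -
  have "form_kernel n m C x = (\<lambda>y. \<Sum>l\<in>I m. (\<Sum>k\<in>I n. cnj (Y n k x) * C k l) * Y m l y)"
    unfolding form_kernel_def[abs_def] sum_distrib_right by (subst sum.swap) (simp add: mult_ac)
  then show ?thesis
    by (simp only: combination_harmonic)
qed

text \<open>In the first variable the basis functions are conjugated, but conjugation maps the
  harmonics of degree \<open>n\<close> to themselves. Together with symmetry this places one section
  in two degrees at once.\<close>

lemma form_kernel_left: "(\<lambda>x. form_kernel n m C x y) \<in> spherical_harmonics n"
proof -
  have "(\<lambda>x. form_kernel n m C x y) = (\<lambda>x. \<Sum>k\<in>I n. (\<Sum>l\<in>I m. Y m l y * C k l) * cnj (Y n k x))"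
    unfolding form_kernel_def[abs_def] sum_distrib_right by (simp add: mult_ac)
  also have "\<dots> \<in> spherical_harmonics n"
    by (intro spherical_harmonics_sum spherical_harmonics_cmult spherical_harmonics_cnj) auto
  finally show ?thesis .
qed

text \<open>Linear independence of the basis is applied twice, first in \<open>y\<close> and then,
  after conjugation, in \<open>x\<close>.\<close>

lemma form_kernel_zero:
  assumes "\<And>x y. form_kernel n m C x y = 0" "k \<in> I n" "l \<in> I m"
  shows "C k l = 0"
proof -
  have *: "(\<Sum>k\<in>I n. cnj (Y n k x) * C k l) = 0" for x
  proof -
    have "(\<lambda>y. \<Sum>l\<in>I m. (\<Sum>k\<in>I n. cnj (Y n k x) * C k l) * Y m l y) = (\<lambda>y. 0)"
      using assms(1)[of x] unfolding form_kernel_def sum_distrib_right by (subst sum.swap) (simp add: mult_ac)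
    then show ?thesis
      using inner_combination[OF assms(3), of "\<lambda>l. \<Sum>k\<in>I n. cnj (Y n k x) * C k l"] by simp
  qed
  have "(\<Sum>k\<in>I n. cnj (C k l) * Y n k x) = 0" for x
    using arg_cong[OF *[of x], of cnj] by (simp add: mult.commute)
  then show ?thesis
    using inner_combination[OF assms(2), of "\<lambda>k. cnj (C k l)"] by simp
qed

text \<open>The first condition is sesquilinearity, phrased as an expansion in the bases, which is
  how the forms below are computed.\<close>

definition invariant_form :: "nat \<Rightarrow> nat \<Rightarrow> ((real ^ 'd \<Rightarrow> complex) \<Rightarrow> (real ^ 'd \<Rightarrow> complex) \<Rightarrow> complex) \<Rightarrow> bool" where
  "invariant_form n m B \<longleftrightarrow>
     (\<forall>u\<in>spherical_harmonics n. \<forall>v\<in>spherical_harmonics m.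
        B u v = (\<Sum>k\<in>I n. \<Sum>l\<in>I m. L2_inner \<omega> u (Y n k) * cnj (L2_inner \<omega> v (Y m l)) * B (Y n k) (Y m l))) \<and>
     (\<forall>g\<in>SO. \<forall>u\<in>spherical_harmonics n. \<forall>v\<in>spherical_harmonics m.
        B (rotate_fun g u) (rotate_fun g v) = B u v)"

lemma invariant_form_kernel:
  assumes "invariant_form n m B"
  shows "form_kernel n m (\<lambda>k l. B (Y n k) (Y m l)) x y = B (kernel n x) (kernel m y)"
proof -
  have "B (kernel n x) (kernel m y) = (\<Sum>k\<in>I n. \<Sum>l\<in>I m. L2_inner \<omega> (kernel n x) (Y n k) *
      cnj (L2_inner \<omega> (kernel m y) (Y m l)) * B (Y n k) (Y m l))"
    using assms kernel_harmonic unfolding invariant_form_def by blast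
  then show ?thesis
    by (simp add: form_kernel_def inner_kernel)
qed

lemma invariant_form_kernel_rotate:
  assumes B: "invariant_form n m B" and g: "g \<in> SO"
  shows "form_kernel n m (\<lambda>k l. B (Y n k) (Y m l)) (g *v x) (g *v y) =
    form_kernel n m (\<lambda>k l. B (Y n k) (Y m l)) x y"
proof -
  have "B (rotate_fun g (kernel n x)) (rotate_fun g (kernel m y)) = B (kernel n x) (kernel m y)"
    using B g kernel_harmonic unfolding invariant_form_def by blast
  then show ?thesis
    by (simp add: invariant_form_kernel[OF B] rotate_kernel[OF g])
qed

text \<open>A rotation interchanging \<open>x\<close> and \<open>y\<close> makes the kernel of an invariant form symmetric.\<close>

lemma invariant_form_kernel_commute:
  assumes B: "invariant_form n m B"
  shows "form_kernel n m (\<lambda>k l. B (Y n k) (Y m l)) x y = form_kernel n m (\<lambda>k l. B (Y n k) (Y m l)) y x"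
proof (cases "x \<in> unit_sphere \<and> y \<in> unit_sphere")
  case True
  then obtain g where "g \<in> SO" "g *v x = y" "g *v y = x"
    using SO_swap[OF dim, of x y] by auto
  then show ?thesis
    using invariant_form_kernel_rotate[OF B, of g x y] by simp
next
  case False
  have "form_kernel n m C x y = 0" if "x \<notin> unit_sphere \<or> y \<notin> unit_sphere" for x y C
    using that spherical_harmonics_outside[OF form_kernel_right[of n m C x], of y]
      spherical_harmonics_outside[OF form_kernel_left[of n m C y], of x] by blast
  then show ?thesis
    using False by metis
qed

lemma schur_inequivalent:
  assumes B: "invariant_form n m B" and nm: "n \<noteq> m" and "k \<in> I n" "l \<in> I m"
  shows "B (Y n k) (Y m l) = 0"
proof (rule form_kernel_zero[of n m "\<lambda>k l. B (Y n k) (Y m l)"])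
  fix x y
  have "(\<lambda>y. form_kernel n m (\<lambda>k l. B (Y n k) (Y m l)) x y) \<in> spherical_harmonics n"
    by (subst invariant_form_kernel_commute[OF B]) (rule form_kernel_left)
  then show "form_kernel n m (\<lambda>k l. B (Y n k) (Y m l)) x y = 0"
    using spherical_harmonics_Int[OF _ form_kernel_right nm] by blast
qed (use assms in auto)

text \<open>The bases are assumed orthonormal degree by degree. Viewing the inner product as an
  invariant form lets Schur's lemma deliver the orthogonality between degrees, without Green's
  formula.\<close>

lemma L2_inner_invariant: "invariant_form n m (L2_inner \<omega>)"
  unfolding invariant_form_def
proof (intro conjI ballI)
  fix u v :: "real ^ 'd \<Rightarrow> complex"
  assume u: "u \<in> spherical_harmonics n" and v: "v \<in> spherical_harmonics m"
  have u': "L2_inner \<omega> u (Y m l) = (\<Sum>k\<in>I n. L2_inner \<omega> u (Y n k) * L2_inner \<omega> (Y n k) (Y m l))" if "l \<in> I m" for l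
    using that by (subst L2_inner_commute, subst inner_harmonic[OF _ u])
      (auto simp: L2_inner_commute[of _ "Y n _" "Y m _"] mult.commute intro!: sum.cong)
  show "L2_inner \<omega> u v = (\<Sum>k\<in>I n. \<Sum>l\<in>I m. L2_inner \<omega> u (Y n k) * cnj (L2_inner \<omega> v (Y m l)) * L2_inner \<omega> (Y n k) (Y m l))"
    unfolding inner_harmonic[OF harmonics_L2[OF u] v]
    by (subst sum.swap) (auto simp: u' sum_distrib_left sum_distrib_right mult_ac intro!: sum.cong)
  show "L2_inner \<omega> (rotate_fun g u) (rotate_fun g v) = L2_inner \<omega> u v" if "g \<in> SO" for g
    using that u v by (intro L2_inner_rotate harmonics_measurable)
qed

lemma Y_orthogonal: "n \<noteq> m \<Longrightarrow> k \<in> I n \<Longrightarrow> l \<in> I m \<Longrightarrow> L2_inner \<omega> (Y n k) (Y m l) = 0"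
  by (rule schur_inequivalent[OF L2_inner_invariant])

lemma harmonics_orthogonal:
  assumes u: "u \<in> spherical_harmonics n" and v: "v \<in> spherical_harmonics m" and "n \<noteq> m"
  shows "L2_inner \<omega> u v = 0"
proof -
  have "L2_inner \<omega> u v = (\<Sum>k\<in>I n. \<Sum>l\<in>I m. L2_inner \<omega> u (Y n k) * cnj (L2_inner \<omega> v (Y m l)) * L2_inner \<omega> (Y n k) (Y m l))"
    using L2_inner_invariant u v unfolding invariant_form_def by blast
  then show ?thesis
    using Y_orthogonal[OF assms(3)] by simp
qed

lemma sphere_polys_orthogonal:
  assumes u: "u \<in> sphere_polys N" and v: "v \<in> spherical_harmonics m" and "N < m"
  shows "L2_inner \<omega> u v = 0"
proof -
  obtain h where h: "u = (\<lambda>x. \<Sum>n\<le>N. h n x)" "\<And>n. n \<le> N \<Longrightarrow> h n \<in> spherical_harmonics n"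
    using u by (auto simp: sphere_polys_def)
  have "L2_inner \<omega> u v = (\<Sum>n\<le>N. L2_inner \<omega> (h n) v)"
    unfolding h(1) using h(2) v by (intro L2_inner_sum_left) (auto intro: harmonics_L2)
  also have "\<dots> = 0"
    using h(2) v assms(3) by (intro sum.neutral) (auto intro!: harmonics_orthogonal[of _ _ v m])
  finally show ?thesis .
qed

lemma sphere_polys_expansion:
  assumes u: "u \<in> sphere_polys N"
  shows "u x = (\<Sum>n\<le>N. \<Sum>k\<in>I n. L2_inner \<omega> u (Y n k) * Y n k x)"
proof -
  obtain h where h: "u = (\<lambda>x. \<Sum>n\<le>N. h n x)" "\<And>n. n \<le> N \<Longrightarrow> h n \<in> spherical_harmonics n"
    using u by (auto simp: sphere_polys_def)
  have "L2_inner \<omega> u (Y n k) = L2_inner \<omega> (h n) (Y n k)" if "n \<le> N" "k \<in> I n" for n k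
  proof -
    have "L2_inner \<omega> u (Y n k) = (\<Sum>m\<le>N. L2_inner \<omega> (h m) (Y n k))"
      unfolding h(1) using h(2) that by (intro L2_inner_sum_left) (auto intro: harmonics_L2)
    also have "\<dots> = (\<Sum>m\<le>N. if m = n then L2_inner \<omega> (h n) (Y n k) else 0)"
      using h(2) that by (intro sum.cong) (auto intro!: harmonics_orthogonal[of _ _ "Y n k" n])
    finally show ?thesis
      using that by simp
  qed
  then have "(\<Sum>n\<le>N. \<Sum>k\<in>I n. L2_inner \<omega> u (Y n k) * Y n k x) = (\<Sum>n\<le>N. \<Sum>k\<in>I n. L2_inner \<omega> (h n) (Y n k) * Y n k x)"
    by (intro sum.cong) auto
  also have "\<dots> = u x"
    using h by (simp add: harmonic_expansion[symmetric])
  finally show ?thesis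
    by simp
qed

text \<open>Without the coefficient of degree \<open>n\<close> the function is a polynomial of
  degree below \<open>n\<close> and thus orthogonal to all harmonics of degree \<open>n\<close>,
  itself included. In degree 0 that coefficient is the whole polynomial.\<close>

lemma zonal_low_degree_zero:
  fixes f :: "real ^ 'd \<Rightarrow> complex"
  assumes f: "f \<in> spherical_harmonics n" and fA: "f = sphere_restrict (\<lambda>x. poly A (of_real (e \<bullet> x)))"
    and A: "degree A \<le> n" "coeff A n = 0"
  shows "f = (\<lambda>x. 0)"
proof (cases n)
  case 0
  then have "A = 0"
    using A by (metis le_zero_eq leading_coeff_0_iff)
  then show ?thesis
    by (simp add: fA sphere_restrict_def[abs_def])
next
  case (Suc m)
  have "degree A \<noteq> n"
    using A(2) Suc by (metis degree_0 leading_coeff_0_iff nat.distinct(1))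
  then have "degree A \<le> m"
    using A(1) Suc by simp
  from sphere_polys_zonal[OF dim this, of e] have "f \<in> sphere_polys m"
    by (simp only: fA)
  then have "L2_inner \<omega> f (Y n k) = 0" if "k \<in> I n" for k
    using that Suc by (intro sphere_polys_orthogonal[of f m]) auto
  then show ?thesis
    by (intro harmonic_eqI[OF f spherical_harmonics_zero]) auto
qed

lemma kernel_rotate:
  assumes g: "g \<in> SO"
  shows "kernel n (g *v x) (g *v y) = kernel n x y"
  using fun_cong[OF rotate_kernel[OF g, of n x], of "g *v y"]
  by (simp add: rotate_fun_SO[OF g] matrix_vector_mul_assoc SO_transpose_mult[OF g])

text \<open>By transitivity the kernel is constant on the diagonal of the sphere, where it equals
  the sum of the squared moduli of the basis; a zero at one point would annihilate every basis
  function.\<close>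

lemma kernel_diagonal_nonzero:
  assumes "I n \<noteq> {}" and e: "e \<in> unit_sphere"
  shows "kernel n e e \<noteq> 0"
proof
  assume 0: "kernel n e e = 0"
  obtain k where k: "k \<in> I n"
    using assms by blast
  have "Y n k x = 0" if x: "x \<in> unit_sphere" for x
  proof -
    obtain g where "g \<in> SO" "g *v e = x"
      using SO_swap[OF dim, of e x] x e by auto
    then have "kernel n x x = 0"
      using kernel_rotate[of g n e e] 0 by simp
    moreover have "kernel n x x = of_real (\<Sum>k\<in>I n. (cmod (Y n k x))\<^sup>2)"
      by (simp add: kernel_def complex_norm_square mult.commute del: of_real_power)
    ultimately have "(\<Sum>k\<in>I n. (cmod (Y n k x))\<^sup>2) = 0"
      by (metis of_real_eq_0_iff)
    then show ?thesis
      using k by (simp add: sum_nonneg_eq_0_iff)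
  qed
  then have "L2_inner \<omega> (Y n k) (Y n k) = 0"
    using L2_inner_cong[of \<omega> "Y n k" "\<lambda>x. 0" "Y n k" "Y n k"] by simp
  then show False
    using Y_orthonormal[OF k k] by simp
qed

text \<open>
  Zonal functions in \<open>\<H>\<^sub>n\<close> are polynomials in \<open>e \<bullet> x\<close> of degree at most \<open>n\<close>. A combination of two of
  them without leading term has lower degree, hence is orthogonal to \<open>\<H>\<^sub>n\<close> and vanishes.
\<close>

lemma form_kernel_proportional:
  assumes B: "invariant_form n n B" and ne: "I n \<noteq> {}" and e: "e \<in> unit_sphere"
  shows "\<exists>c. \<forall>y. form_kernel n n (\<lambda>k l. B (Y n k) (Y n l)) e y = c * kernel n e y"
proof -
  let ?b = "form_kernel n n (\<lambda>k l. B (Y n k) (Y n l))"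
  have e1: "norm e = 1"
    using e by simp
  have "?b e (h *v x) = ?b e x" if "h \<in> SO" "h *v e = e" for h x
    using invariant_form_kernel_rotate[OF B that(1), of e x] that(2) by simp
  then obtain A where A: "degree A \<le> n" "?b e = sphere_restrict (\<lambda>x. poly A (of_real (e \<bullet> x)))"
    using zonal_harmonic_eq_poly[OF dim form_kernel_right e1, of n n "\<lambda>k l. B (Y n k) (Y n l)" e] by metis
  have "kernel n e (h *v x) = kernel n e x" if "h \<in> SO" "h *v e = e" for h x
    using kernel_rotate[OF that(1), of n e x] that(2) by simp
  then obtain A' where A': "degree A' \<le> n" "kernel n e = sphere_restrict (\<lambda>x. poly A' (of_real (e \<bullet> x)))"
    using zonal_harmonic_eq_poly[OF dim kernel_harmonic e1, of n e] by metis
  have nz: "coeff A' n \<noteq> 0"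
  proof
    assume "coeff A' n = 0"
    then have "kernel n e = (\<lambda>x. 0)"
      by (rule zonal_low_degree_zero[OF kernel_harmonic A'(2,1)])
    then show False
      using kernel_diagonal_nonzero[OF ne e] by simp
  qed
  define c where "c = coeff A n / coeff A' n"
  have "(\<lambda>x. ?b e x - c * kernel n e x) = (\<lambda>x. 0)"
  proof (rule zonal_low_degree_zero)
    show "(\<lambda>x. ?b e x - c * kernel n e x) \<in> spherical_harmonics n"
      by (intro spherical_harmonics_diff spherical_harmonics_cmult form_kernel_right kernel_harmonic)
    show "(\<lambda>x. ?b e x - c * kernel n e x) = sphere_restrict (\<lambda>x. poly (A - smult c A') (of_real (e \<bullet> x)))"
      unfolding A(2) A'(2) by (auto simp: sphere_restrict_def)
    show "degree (A - smult c A') \<le> n"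
      using A(1) A'(1) by (intro degree_diff_le order_trans[OF degree_smult_le])
    show "coeff (A - smult c A') n = 0"
      using nz by (simp add: c_def)
  qed
  then have "?b e y = c * kernel n e y" for y
    using fun_cong[of _ _ y] by fastforce
  then show ?thesis
    by blast
qed

text \<open>The factor relating the zonal sections might depend on the pole. It is determined on the
  diagonal, where both kernels are constant by invariance, so one \<open>c\<close> serves all poles.
  Subtracting \<open>c\<close> times the Kronecker symbol, whose form kernel is
  \<open>c * kernel n x y\<close>, leaves vanishing coefficients.\<close>

lemma schur_irreducible:
  assumes B: "invariant_form n n B"
  obtains c where "\<And>k l. k \<in> I n \<Longrightarrow> l \<in> I n \<Longrightarrow> B (Y n k) (Y n l) = (if k = l then c else 0)"
proof (cases "I n = {}")
  case True
  then show ?thesis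
    using that by blast
next
  case ne: False
  let ?b = "form_kernel n n (\<lambda>k l. B (Y n k) (Y n l))"
  define e :: "real ^ 'd" where "e = axis undefined 1"
  have e: "e \<in> unit_sphere"
    by (simp add: e_def)
  define c where "c = ?b e e / kernel n e e"
  have b: "?b x y = c * kernel n x y" if x: "x \<in> unit_sphere" for x y
  proof -
    obtain c' where c': "\<And>y. ?b x y = c' * kernel n x y"
      using form_kernel_proportional[OF B ne x] by blast
    obtain g where g: "g \<in> SO" "g *v e = x"
      using SO_swap[OF dim, of e x] x e by auto
    have "?b x x = ?b e e" "kernel n x x = kernel n e e"
      using invariant_form_kernel_rotate[OF B g(1), of e e] kernel_rotate[OF g(1), of n e e] g(2) by simp_all
    then have "c' = c"
      using c'[of x] kernel_diagonal_nonzero[OF ne e] by (simp add: c_def nonzero_eq_divide_eq)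
    then show ?thesis
      using c' by simp
  qed
  \<comment> \<open>Off the sphere both sides vanish, since harmonics are extended by 0.\<close>
  have b: "?b x y = c * kernel n x y" for x y
  proof (cases "x \<in> unit_sphere")
    case False
    then have "Y n k x = 0" if "k \<in> I n" for k
      using that spherical_harmonics_outside by (metis Y_harmonic)
    then show ?thesis
      by (simp add: form_kernel_def kernel_def)
  qed (rule b)
  show ?thesis
  proof (rule that)
    fix k l assume kl: "k \<in> I n" "l \<in> I n"
    have "B (Y n k) (Y n l) - (if k = l then c else 0) = 0"
    proof (rule form_kernel_zero[OF _ kl, of "\<lambda>k l. B (Y n k) (Y n l) - (if k = l then c else 0)"])
      fix x y
      have "form_kernel n n (\<lambda>k l. B (Y n k) (Y n l) - (if k = l then c else 0)) x y =
        ?b x y - form_kernel n n (\<lambda>k l. if k = l then c else 0) x y"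
        by (simp add: form_kernel_def right_diff_distrib sum_subtractf)
      also have "form_kernel n n (\<lambda>k l. if k = l then c else 0) x y = c * kernel n x y"
        by (simp add: form_kernel_def kernel_def sum_distrib_left if_distrib[of "\<lambda>a. _ * a"] mult_ac cong: if_cong)
      finally show "form_kernel n n (\<lambda>k l. B (Y n k) (Y n l) - (if k = l then c else 0)) x y = 0"
        by (simp add: b)
    qed
    then show "B (Y n k) (Y n l) = (if k = l then c else 0)"
      by simp
  qed
qed

text \<open>This secures a nonzero dimension to divide by and, in each degree, a basis function to
  test with.\<close>

lemma I_nonempty: "I n \<noteq> {}"
proof
  assume *: "I n = {}"
  have "2 \<le> CARD('d)"
    using dim by simp
  then obtain f :: "real ^ 'd \<Rightarrow> complex" where "f \<in> spherical_harmonics n" "f \<noteq> (\<lambda>x. 0)"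
    by (rule spherical_harmonics_nonzero)
  then show False
    using harmonic_expansion[of f n] * by (auto simp: fun_eq_iff)
qed

end

section \<open>Averages over the rotation group\<close>

context spherical_basis
begin

definition power_spectrum :: "(real ^ 'd \<Rightarrow> complex) \<Rightarrow> nat \<Rightarrow> real" where
  "power_spectrum f n = (\<Sum>k\<in>I n. (cmod (L2_inner \<omega> f (Y n k)))\<^sup>2)"

lemma power_spectrum_nonneg: "power_spectrum f n \<ge> 0"
  by (simp add: power_spectrum_def sum_nonneg)

lemma inner_harmonic_left:
  assumes "h \<in> spherical_harmonics n" "f \<in> L2_space \<omega>"
  shows "L2_inner \<omega> h f = (\<Sum>k\<in>I n. L2_inner \<omega> h (Y n k) * L2_inner \<omega> (Y n k) f)"
  by (subst L2_inner_commute, subst inner_harmonic[OF assms(2,1)])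
     (auto simp: L2_inner_commute[of _ "Y n _" f] mult.commute intro!: sum.cong)

lemma inner_sphere_poly:
  assumes f: "f \<in> L2_space \<omega>" and u: "u \<in> sphere_polys N"
  shows "L2_inner \<omega> f u = (\<Sum>n\<le>N. \<Sum>k\<in>I n. L2_inner \<omega> f (Y n k) * L2_inner \<omega> (Y n k) u)"
proof -
  have "L2_inner \<omega> f u = L2_inner \<omega> f (\<lambda>x. \<Sum>n\<le>N. \<Sum>k\<in>I n. L2_inner \<omega> u (Y n k) * Y n k x)"
    using sphere_polys_expansion[OF u] by (intro L2_inner_cong) auto
  also have "\<dots> = (\<Sum>n\<le>N. \<Sum>k\<in>I n. L2_inner \<omega> f (\<lambda>x. L2_inner \<omega> u (Y n k) * Y n k x))"
    using f by (simp add: L2_inner_sum_right L2_space_sum L2_space_cmult)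
  finally show ?thesis
    unfolding L2_inner_cmult_right by (simp add: mult.commute flip: L2_inner_commute[of _ "Y _ _" u])
qed

lemma power_spectrum_harmonic:
  assumes "h \<in> spherical_harmonics n"
  shows "of_real (power_spectrum h n) = L2_inner \<omega> h h"
  unfolding inner_harmonic[OF harmonics_L2[OF assms] assms]
  by (simp add: power_spectrum_def complex_norm_square del: of_real_power)

text \<open>The spectrum in degree \<open>n\<close> is the squared norm of the orthogonal projection
  \<open>q\<close> of \<open>f\<close>. Rotations preserve the harmonics of degree \<open>n\<close>,
  so rotating \<open>f\<close> or \<open>q\<close> produces the same coefficients, and rotating
  \<open>q\<close> keeps its norm.\<close>

lemma power_spectrum_rotate:
  assumes g: "g \<in> SO" and f: "f \<in> L2_space \<omega>"
  shows "power_spectrum (rotate_fun g f) n = power_spectrum f n"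
proof -
  define q where "q = (\<lambda>x. \<Sum>k\<in>I n. L2_inner \<omega> f (Y n k) * Y n k x)"
  have q: "q \<in> spherical_harmonics n"
    unfolding q_def by (rule combination_harmonic)
  have qY: "L2_inner \<omega> q (Y n k) = L2_inner \<omega> f (Y n k)" if "k \<in> I n" for k
    unfolding q_def using that by (rule inner_combination)
  have qh: "L2_inner \<omega> q h = L2_inner \<omega> f h" if "h \<in> spherical_harmonics n" for h
    using that by (simp add: inner_harmonic[OF harmonics_L2[OF q]] inner_harmonic[OF f] qY)
  have meas: "f \<in> borel_measurable \<omega>"
    using f by (simp add: L2_space_def)
  have "L2_inner \<omega> (rotate_fun g f) (Y n k) = L2_inner \<omega> (rotate_fun g q) (Y n k)" if k: "k \<in> I n" for k
    using qh[OF spherical_harmonics_rotate[OF Y_harmonic[OF k] SO_transpose[OF g]]]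
    by (simp add: L2_inner_rotate_left[OF g meas harmonics_measurable[OF Y_harmonic[OF k]]]
      L2_inner_rotate_left[OF g harmonics_measurable[OF q] harmonics_measurable[OF Y_harmonic[OF k]]])
  then have "complex_of_real (power_spectrum (rotate_fun g f) n) = of_real (power_spectrum (rotate_fun g q) n)"
    by (simp add: power_spectrum_def)
  also have "\<dots> = of_real (power_spectrum q n)"
    using q g by (simp add: power_spectrum_harmonic spherical_harmonics_rotate L2_inner_rotate harmonics_measurable)
  also have "\<dots> = of_real (power_spectrum f n)"
    by (simp add: power_spectrum_def qY)
  finally show ?thesis
    by simp
qed

lemma sphere_polys_rotate:
  assumes u: "u \<in> sphere_polys N" and g: "g \<in> SO"
  shows "rotate_fun g u \<in> sphere_polys N"
proof -
  obtain h where h: "u = (\<lambda>x. \<Sum>n\<le>N. h n x)" "\<And>n. n \<le> N \<Longrightarrow> h n \<in> spherical_harmonics n"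
    using u by (auto simp: sphere_polys_def)
  then show ?thesis
    using g unfolding sphere_polys_def
    by (auto simp: rotate_fun_def intro!: exI[of _ "\<lambda>n. rotate_fun g (h n)"] spherical_harmonics_rotate)
qed

text \<open>Continuity in \<open>g\<close> is the route to measurability on the group. Bounds for
  \<open>u\<close> and \<open>v\<close> on the compact sphere supply the dominating
  constant.\<close>

lemma continuous_rotated_coefficient:
  assumes u: "continuous_on unit_sphere u" and v: "continuous_on unit_sphere v"
  shows "continuous_on SO (\<lambda>g. L2_inner \<omega> u (rotate_fun g v))"
  unfolding continuous_on_sequentially
proof (intro allI ballI impI, elim conjE)
  fix X :: "nat \<Rightarrow> real ^ 'd ^ 'd" and a
  assume a: "a \<in> SO" and X: "\<forall>n. X n \<in> SO" and lim: "X \<longlonglongrightarrow> a"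
  obtain C where C: "\<And>x. x \<in> unit_sphere \<Longrightarrow> cmod (u x) \<le> C" "C \<ge> 0"
    using continuous_bounded[OF u] by blast
  obtain D where D: "\<And>x. x \<in> unit_sphere \<Longrightarrow> cmod (v x) \<le> D" "D \<ge> 0"
    using continuous_bounded[OF v] by blast
  have sph: "transpose g *v x \<in> unit_sphere" if "x \<in> unit_sphere" "g \<in> SO" for g x
    using that(1) SO_norm[OF SO_transpose[OF that(2)], of x] by simp
  have "(\<lambda>n. \<integral>x. u x * cnj (rotate_fun (X n) v x) \<partial>\<omega>) \<longlonglongrightarrow> (\<integral>x. u x * cnj (rotate_fun a v x) \<partial>\<omega>)"
  proof (rule integral_dominated_convergence[where w = "\<lambda>_. C * D"])
    show "(\<lambda>x. u x * cnj (rotate_fun a v x)) \<in> borel_measurable \<omega>"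
      using u v a by (intro borel_measurable_times borel_measurable_cnj rotate_measurable continuous_measurable)
    show "(\<lambda>x. u x * cnj (rotate_fun (X n) v x)) \<in> borel_measurable \<omega>" for n
      using u v X by (intro borel_measurable_times borel_measurable_cnj rotate_measurable continuous_measurable) auto
    show "AE x in \<omega>. (\<lambda>n. u x * cnj (rotate_fun (X n) v x)) \<longlonglongrightarrow> u x * cnj (rotate_fun a v x)"
    proof (intro AE_I2)
      fix x assume "x \<in> space \<omega>"
      then have x: "x \<in> unit_sphere" by simp
      have "(\<lambda>n. transpose (X n) *v x) \<longlonglongrightarrow> transpose a *v x"
        unfolding matrix_vector_mult_def transpose_def
        by (intro vec_tendstoI) (auto intro!: tendsto_intros lim)
      then have "(\<lambda>n. v (transpose (X n) *v x)) \<longlonglongrightarrow> v (transpose a *v x)"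
        using sph[OF x] a X by (intro continuous_on_tendsto_compose[OF v]) auto
      then show "(\<lambda>n. u x * cnj (rotate_fun (X n) v x)) \<longlonglongrightarrow> u x * cnj (rotate_fun a v x)"
        using a X by (auto simp: rotate_fun_SO intro!: tendsto_intros)
    qed
    show "AE x in \<omega>. norm (u x * cnj (rotate_fun (X n) v x)) \<le> C * D" for n
      using C D X sph[of _ "X n"] by (auto simp: norm_mult rotate_fun_SO intro!: AE_I2 mult_mono)
  qed simp
  then show "((\<lambda>g. L2_inner \<omega> u (rotate_fun g v)) \<circ> X) \<longlonglongrightarrow> L2_inner \<omega> u (rotate_fun a v)"
    by (simp add: L2_inner_def comp_def)
qed

lemma bounded_rotated_coefficient:
  assumes u: "continuous_on unit_sphere u" and v: "continuous_on unit_sphere v"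
  obtains C where "\<And>g. g \<in> SO \<Longrightarrow> cmod (L2_inner \<omega> u (rotate_fun g v)) \<le> C" "C \<ge> 0"
proof -
  obtain C where C: "\<And>x. x \<in> unit_sphere \<Longrightarrow> cmod (u x) \<le> C" "C \<ge> 0"
    using continuous_bounded[OF u] by blast
  obtain D where D: "\<And>x. x \<in> unit_sphere \<Longrightarrow> cmod (v x) \<le> D" "D \<ge> 0"
    using continuous_bounded[OF v] by blast
  have "cmod (L2_inner \<omega> u (rotate_fun g v)) \<le> (\<integral>x. C * D \<partial>\<omega>)" if g: "g \<in> SO" for g
    unfolding L2_inner_def
  proof (rule Bochner_Integration.integral_norm_bound_integral)
    show "integrable \<omega> (\<lambda>x. u x * cnj (rotate_fun g v x))"
      using u v g by (intro L2_integrable_mult continuous_L2 rotate_continuous)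
    show "norm (u x * cnj (rotate_fun g v x)) \<le> C * D" if "x \<in> space \<omega>" for x
      using that C D g SO_norm[OF SO_transpose[OF g]]
      by (auto simp: norm_mult rotate_fun_SO intro!: mult_mono)
  qed simp
  then show ?thesis
    using that[of "\<integral>x. C * D \<partial>\<omega>"] C D by simp
qed

end

section \<open>Group averages against the Haar measure\<close>

locale spherical_haar = spherical_basis \<omega> I Y
  for \<omega> :: "(real ^ 'd) measure" and I :: "nat \<Rightarrow> 'k set" and Y +
  fixes \<mu> :: "(real ^ 'd ^ 'd) measure"
  assumes haar: "normalized_Haar_SO \<mu>"
begin

lemma sets_haar: "sets \<mu> = sets (restrict_space borel SO)"
  using haar by (simp add: normalized_Haar_SO_def)

lemma space_haar [simp]: "space \<mu> = SO"
  using sets_eq_imp_space_eq[OF sets_haar] by (simp add: space_restrict_space)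

lemma measure_haar: "measure \<mu> SO = 1"
  using haar by (simp add: normalized_Haar_SO_def measure_def)

lemma finite_haar: "finite_measure \<mu>"
  by standard (use haar in \<open>simp add: normalized_Haar_SO_def\<close>)

lemma haar_invariant:
  assumes h: "h \<in> SO"
  shows "(\<lambda>g. h ** g) \<in> \<mu> \<rightarrow>\<^sub>M \<mu>" "distr \<mu> \<mu> (\<lambda>g. h ** g) = \<mu>"
proof -
  have inv: "emeasure \<mu> ((\<lambda>g. transpose h ** g) ` A) = emeasure \<mu> A" if "A \<in> sets \<mu>" for A
    using haar SO_transpose[OF h] that unfolding normalized_Haar_SO_def by blast
  have c: "continuous_on SO (\<lambda>g. h ** g)"
    unfolding matrix_matrix_mult_def by (intro continuous_intros)
  have "(\<lambda>g. h ** g) \<in> SO \<rightarrow> SO" "(\<lambda>g. transpose h ** g) \<in> SO \<rightarrow> SO"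
    using SO_mult[OF h] SO_mult[OF SO_transpose[OF h]] by auto
  note * = distr_eq_of_invariant_image[OF sets_haar c this _ _ inv]
  show "(\<lambda>g. h ** g) \<in> \<mu> \<rightarrow>\<^sub>M \<mu>" "distr \<mu> \<mu> (\<lambda>g. h ** g) = \<mu>"
    by (intro *; simp add: matrix_mul_assoc SO_transpose_mult[OF h])+
qed

lemma rotated_coefficient_measurable:
  assumes "continuous_on unit_sphere u" "continuous_on unit_sphere v"
  shows "(\<lambda>g. L2_inner \<omega> u (rotate_fun g v)) \<in> borel_measurable \<mu>"
  using borel_measurable_continuous_on_restrict[OF continuous_rotated_coefficient[OF assms]]
  by (simp add: measurable_cong_sets[OF sets_haar])

lemma rotated_coefficients_integrable:
  assumes u: "continuous_on unit_sphere u" and u': "continuous_on unit_sphere u'"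
    and v: "continuous_on unit_sphere v"
  shows "integrable \<mu> (\<lambda>g. L2_inner \<omega> u (rotate_fun g v) * cnj (L2_inner \<omega> u' (rotate_fun g v)))"
proof -
  interpret haar: finite_measure \<mu> by (rule finite_haar)
  obtain C where C: "\<And>g. g \<in> SO \<Longrightarrow> cmod (L2_inner \<omega> u (rotate_fun g v)) \<le> C" "C \<ge> 0"
    using bounded_rotated_coefficient[OF u v] by blast
  obtain D where D: "\<And>g. g \<in> SO \<Longrightarrow> cmod (L2_inner \<omega> u' (rotate_fun g v)) \<le> D" "D \<ge> 0"
    using bounded_rotated_coefficient[OF u' v] by blast
  show ?thesis
  proof (rule haar.integrable_const_bound[of _ "C * D"])
    show "AE g in \<mu>. norm (L2_inner \<omega> u (rotate_fun g v) * cnj (L2_inner \<omega> u' (rotate_fun g v))) \<le> C * D"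
      using C D by (auto simp: norm_mult intro!: AE_I2 mult_mono)
    show "(\<lambda>g. L2_inner \<omega> u (rotate_fun g v) * cnj (L2_inner \<omega> u' (rotate_fun g v))) \<in> borel_measurable \<mu>"
      using assms by (intro borel_measurable_times borel_measurable_cnj rotated_coefficient_measurable)
  qed
qed

text \<open>The polarized version of the average of the squared modulus; Schur's lemma requires a
  form in two arguments.\<close>

definition orbit_form :: "(real ^ 'd \<Rightarrow> complex) \<Rightarrow> (real ^ 'd \<Rightarrow> complex) \<Rightarrow> (real ^ 'd \<Rightarrow> complex) \<Rightarrow> complex" where
  "orbit_form \<psi> u v = (\<integral>g. L2_inner \<omega> u (rotate_fun g \<psi>) * cnj (L2_inner \<omega> v (rotate_fun g \<psi>)) \<partial>\<mu>)"

text \<open>The hypotheses constrain pairings with the orbit of \<psi>, not the functions: a general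
  square-integrable \<open>f\<close> is no finite combination of basis functions, but its pairings
  with rotated polynomials are.\<close>

lemma orbit_form_combination:
  assumes \<psi>: "continuous_on unit_sphere \<psi>" and S: "\<And>p. p \<in> S \<Longrightarrow> continuous_on unit_sphere (u p)"
    and S': "\<And>p. p \<in> S' \<Longrightarrow> continuous_on unit_sphere (u' p)"
    and f: "\<And>g. g \<in> SO \<Longrightarrow> L2_inner \<omega> f (rotate_fun g \<psi>) = (\<Sum>p\<in>S. a p * L2_inner \<omega> (u p) (rotate_fun g \<psi>))"
    and f': "\<And>g. g \<in> SO \<Longrightarrow> L2_inner \<omega> f' (rotate_fun g \<psi>) = (\<Sum>q\<in>S'. a' q * L2_inner \<omega> (u' q) (rotate_fun g \<psi>))"
  shows "orbit_form \<psi> f f' = (\<Sum>p\<in>S. \<Sum>q\<in>S'. a p * cnj (a' q) * orbit_form \<psi> (u p) (u' q))"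
proof -
  let ?E = "\<lambda>u g. L2_inner \<omega> u (rotate_fun g \<psi>)"
  have int: "integrable \<mu> (\<lambda>g. a p * cnj (a' q) * (?E (u p) g * cnj (?E (u' q) g)))" if "p \<in> S" "q \<in> S'" for p q
    using that S S' \<psi> by (intro integrable_mult_right rotated_coefficients_integrable)
  have "orbit_form \<psi> f f' = (\<integral>g. (\<Sum>p\<in>S. \<Sum>q\<in>S'. a p * cnj (a' q) * (?E (u p) g * cnj (?E (u' q) g))) \<partial>\<mu>)"
    unfolding orbit_form_def
    by (intro Bochner_Integration.integral_cong) (auto simp: f f' sum_product mult_ac)
  also have "\<dots> = (\<Sum>p\<in>S. \<integral>g. (\<Sum>q\<in>S'. a p * cnj (a' q) * (?E (u p) g * cnj (?E (u' q) g))) \<partial>\<mu>)"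
    by (intro Bochner_Integration.integral_sum Bochner_Integration.integrable_sum int)
  also have "\<dots> = (\<Sum>p\<in>S. \<Sum>q\<in>S'. \<integral>g. a p * cnj (a' q) * (?E (u p) g * cnj (?E (u' q) g)) \<partial>\<mu>)"
    by (intro sum.cong refl Bochner_Integration.integral_sum int)
  also have "\<dots> = (\<Sum>p\<in>S. \<Sum>q\<in>S'. a p * cnj (a' q) * orbit_form \<psi> (u p) (u' q))"
    by (simp add: orbit_form_def)
  finally show ?thesis .
qed

text \<open>Moving \<open>g\<close> to the other side of the pairing replaces \<open>g'\<close> by
  \<open>transpose g ** g'\<close>, and left invariance of the Haar measure absorbs this
  translation.\<close>

lemma orbit_form_invariant:
  assumes \<psi>: "continuous_on unit_sphere \<psi>"
  shows "invariant_form n m (orbit_form \<psi>)"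
  unfolding invariant_form_def
proof (intro conjI ballI)
  fix u v :: "real ^ 'd \<Rightarrow> complex"
  assume u: "u \<in> spherical_harmonics n" and v: "v \<in> spherical_harmonics m"
  have L2: "rotate_fun g \<psi> \<in> L2_space \<omega>" if "g \<in> SO" for g
    using that \<psi> by (intro continuous_L2 rotate_continuous)
  have cY: "k \<in> I n \<Longrightarrow> continuous_on unit_sphere (Y n k)" for n k
    using spherical_harmonics_continuous Y_harmonic by blast
  show "orbit_form \<psi> u v = (\<Sum>k\<in>I n. \<Sum>l\<in>I m. L2_inner \<omega> u (Y n k) * cnj (L2_inner \<omega> v (Y m l)) * orbit_form \<psi> (Y n k) (Y m l))"
    using cY inner_harmonic_left[OF u L2] inner_harmonic_left[OF v L2] by (intro orbit_form_combination \<psi>) auto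
  show "orbit_form \<psi> (rotate_fun g u) (rotate_fun g v) = orbit_form \<psi> u v" if g: "g \<in> SO" for g
  proof -
    note inv = haar_invariant[OF SO_transpose[OF g]]
    have meas: "\<psi> \<in> borel_measurable \<omega>"
      by (rule continuous_measurable[OF \<psi>])
    have E: "L2_inner \<omega> (rotate_fun g h) (rotate_fun g' \<psi>) = L2_inner \<omega> h (rotate_fun (transpose g ** g') \<psi>)"
      if "g' \<in> SO" "h \<in> spherical_harmonics k" for g' h k
      using that g meas
      by (simp add: L2_inner_rotate_left rotate_rotate[OF SO_transpose] harmonics_measurable rotate_measurable)
    have "orbit_form \<psi> u v = (\<integral>g. L2_inner \<omega> u (rotate_fun g \<psi>) * cnj (L2_inner \<omega> v (rotate_fun g \<psi>))
      \<partial>distr \<mu> \<mu> (\<lambda>g'. transpose g ** g'))"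
      by (simp add: inv(2) orbit_form_def)
    also have "\<dots> = (\<integral>g'. L2_inner \<omega> u (rotate_fun (transpose g ** g') \<psi>) *
        cnj (L2_inner \<omega> v (rotate_fun (transpose g ** g') \<psi>)) \<partial>\<mu>)"
      using \<psi> spherical_harmonics_continuous[OF u] spherical_harmonics_continuous[OF v]
      by (intro integral_distr inv borel_measurable_times borel_measurable_cnj rotated_coefficient_measurable)
    also have "\<dots> = orbit_form \<psi> (rotate_fun g u) (rotate_fun g v)"
      unfolding orbit_form_def using u v by (intro Bochner_Integration.integral_cong) (auto simp: E)
    finally show ?thesis
      by simp
  qed
qed

text \<open>Schur's constant is found from the trace: the diagonal entries add up to the average of
  the spectrum of the rotated \<psi>, which does not depend on the rotation, while the group has
  mass 1.\<close>

lemma orbit_form_basis: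
  assumes \<psi>: "continuous_on unit_sphere \<psi>" and k: "k \<in> I n" and l: "l \<in> I m"
  shows "orbit_form \<psi> (Y n k) (Y m l) =
    (if n = m \<and> k = l then of_real (power_spectrum \<psi> n / card (I n)) else 0)"
proof (cases "n = m")
  case False
  then show ?thesis
    using schur_inequivalent[OF orbit_form_invariant[OF \<psi>] False k l] by simp
next
  case True
  obtain c where c: "\<And>k l. k \<in> I n \<Longrightarrow> l \<in> I n \<Longrightarrow> orbit_form \<psi> (Y n k) (Y n l) = (if k = l then c else 0)"
    using schur_irreducible[OF orbit_form_invariant[OF \<psi>]] by blast
  have cY: "k \<in> I n \<Longrightarrow> continuous_on unit_sphere (Y n k)" for k
    using spherical_harmonics_continuous Y_harmonic by blast
  have "of_nat (card (I n)) * c = (\<Sum>k\<in>I n. orbit_form \<psi> (Y n k) (Y n k))"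
    by (simp add: c)
  also have "\<dots> = (\<integral>g. (\<Sum>k\<in>I n. L2_inner \<omega> (Y n k) (rotate_fun g \<psi>) * cnj (L2_inner \<omega> (Y n k) (rotate_fun g \<psi>))) \<partial>\<mu>)"
    unfolding orbit_form_def using cY \<psi>
    by (intro Bochner_Integration.integral_sum[symmetric] rotated_coefficients_integrable)
  also have "\<dots> = (\<integral>g. of_real (power_spectrum \<psi> n) \<partial>\<mu>)"
  proof (rule Bochner_Integration.integral_cong[OF refl])
    fix g assume "g \<in> space \<mu>"
    then have g: "g \<in> SO" by simp
    have "(\<Sum>k\<in>I n. L2_inner \<omega> (Y n k) (rotate_fun g \<psi>) * cnj (L2_inner \<omega> (Y n k) (rotate_fun g \<psi>))) =
       of_real (power_spectrum (rotate_fun g \<psi>) n)"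
      by (simp add: power_spectrum_def L2_inner_commute[of _ "Y n _"] complex_norm_square mult.commute del: of_real_power)
    then show "(\<Sum>k\<in>I n. L2_inner \<omega> (Y n k) (rotate_fun g \<psi>) * cnj (L2_inner \<omega> (Y n k) (rotate_fun g \<psi>))) =
       of_real (power_spectrum \<psi> n)"
      by (simp add: power_spectrum_rotate[OF g continuous_L2[OF \<psi>]])
  qed
  also have "\<dots> = of_real (power_spectrum \<psi> n)"
    by (simp add: measure_haar)
  finally have "c = of_real (power_spectrum \<psi> n / card (I n))"
    using I_nonempty[of n] by (simp add: field_simps)
  then show ?thesis
    using c[OF k, of l] l True by simp
qed

theorem haar_average_coefficient:
  assumes f: "f \<in> L2_space \<omega>" and \<psi>: "\<psi> \<in> sphere_polys N"
  shows "(\<integral>g. complex_of_real ((cmod (L2_inner \<omega> f (rotate_fun g \<psi>)))\<^sup>2) \<partial>\<mu>) =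
    of_real (\<Sum>n\<le>N. power_spectrum f n * power_spectrum \<psi> n / card (I n))"
proof -
  \<comment> \<open>Degrees up to \<open>N\<close> suffice, because components of \<open>f\<close>
    of higher degree are orthogonal to every rotation of \<psi>.\<close>
  define S where "S = (SIGMA n:{..N}. I n)"
  define a where "a p = L2_inner \<omega> f (Y (fst p) (snd p))" for p
  have S: "finite S"
    by (simp add: S_def)
  have c\<psi>: "continuous_on unit_sphere \<psi>"
    using \<psi> by (rule sphere_polys_continuous)
  have cY: "p \<in> S \<Longrightarrow> continuous_on unit_sphere (Y (fst p) (snd p))" for p
    by (rule spherical_harmonics_continuous[of _ "fst p"]) (auto simp: S_def)
  have E: "L2_inner \<omega> f (rotate_fun g \<psi>) = (\<Sum>p\<in>S. a p * L2_inner \<omega> (Y (fst p) (snd p)) (rotate_fun g \<psi>))"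
    if "g \<in> SO" for g
    using inner_sphere_poly[OF f sphere_polys_rotate[OF \<psi> that]]
    by (simp add: a_def S_def sum.Sigma split_beta)
  have O: "orbit_form \<psi> (Y (fst p) (snd p)) (Y (fst q) (snd q)) =
      (if q = p then of_real (power_spectrum \<psi> (fst p) / card (I (fst p))) else 0)" if "p \<in> S" "q \<in> S" for p q
    using that by (subst orbit_form_basis[OF c\<psi>]) (auto simp: S_def prod_eq_iff)
  have "(\<integral>g. complex_of_real ((cmod (L2_inner \<omega> f (rotate_fun g \<psi>)))\<^sup>2) \<partial>\<mu>) = orbit_form \<psi> f f"
    unfolding orbit_form_def complex_norm_square ..
  also have "\<dots> = (\<Sum>p\<in>S. \<Sum>q\<in>S. a p * cnj (a q) * orbit_form \<psi> (Y (fst p) (snd p)) (Y (fst q) (snd q)))"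
    by (rule orbit_form_combination[OF c\<psi> cY cY E E])
  also have "\<dots> = (\<Sum>p\<in>S. \<Sum>q\<in>S. if q = p then a p * cnj (a p) * of_real (power_spectrum \<psi> (fst p) / card (I (fst p))) else 0)"
    by (intro sum.cong refl) (simp add: O)
  also have "\<dots> = (\<Sum>p\<in>S. of_real ((cmod (a p))\<^sup>2 * (power_spectrum \<psi> (fst p) / card (I (fst p)))))"
    using S by (simp add: sum.delta complex_norm_square del: of_real_power)
  also have "\<dots> = of_real (\<Sum>n\<le>N. \<Sum>k\<in>I n. (cmod (L2_inner \<omega> f (Y n k)))\<^sup>2 * (power_spectrum \<psi> n / card (I n)))"
    unfolding S_def a_def by (subst sum.Sigma) (simp_all add: split_beta)
  also have "\<dots> = of_real (\<Sum>n\<le>N. power_spectrum f n * power_spectrum \<psi> n / card (I n))"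
    by (intro arg_cong[where f = complex_of_real] sum.cong refl)
       (simp add: power_spectrum_def[of f] sum_distrib_right sum_divide_distrib)
  finally show ?thesis .
qed

section \<open>The quadrature rule\<close>

lemma SO_polys_cmult_sum:
  assumes "\<And>i. i \<in> A \<Longrightarrow> F i \<in> SO_polys \<omega> I Y N"
  shows "(\<lambda>g. \<Sum>i\<in>A. c i * F i g) \<in> SO_polys \<omega> I Y N"
  using assms
proof (induction A rule: infinite_finite_induct)
  case (insert i A)
  then have "(\<lambda>g. c i * F i g) + (\<lambda>g. \<Sum>i\<in>A. c i * F i g) \<in> SO_polys \<omega> I Y N"
    unfolding SO_polys_def by (intro cfun.span_add cfun.span_scale) auto
  then show ?case
    using insert by (simp add: plus_fun_def)
qed (use cfun.span_zero in \<open>simp_all add: SO_polys_def zero_fun_def\<close>)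

text \<open>Expanding first \<open>u\<close> and then each rotated basis function exhibits the
  matrix coefficients. The last expansion needs rotated harmonics to be harmonic, so equality is
  claimed on \<open>SO\<close>, while \<open>F\<close> itself is defined on all matrices.\<close>

lemma rotated_coefficient_SO_polys:
  assumes u: "u \<in> sphere_polys N" and v: "v \<in> L2_space \<omega>"
  obtains F where "F \<in> SO_polys \<omega> I Y N" "\<And>g. g \<in> SO \<Longrightarrow> F g = L2_inner \<omega> (rotate_fun g u) v"
proof
  \<comment> \<open>The factor 1 gives the outer sum the weighted shape expected by
    \<open>SO_polys_cmult_sum\<close>.\<close>
  define F where "F = (\<lambda>g. \<Sum>n\<le>N. 1 * (\<Sum>m\<in>I n. L2_inner \<omega> u (Y n m) *
      (\<Sum>k\<in>I n. L2_inner \<omega> (Y n k) v * matrix_coeff \<omega> Y n k m g)))"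
  show "F \<in> SO_polys \<omega> I Y N"
    unfolding F_def by (intro SO_polys_cmult_sum) (auto simp: SO_polys_def intro!: cfun.span_base)
  fix g :: "real ^ 'd ^ 'd" assume g: "g \<in> SO"
  have H: "m \<in> I n \<Longrightarrow> rotate_fun g (Y n m) \<in> spherical_harmonics n" for n m
    using g by (intro spherical_harmonics_rotate) auto
  have H2: "m \<in> I n \<Longrightarrow> rotate_fun g (Y n m) \<in> L2_space \<omega>" for n m
    using H by (rule harmonics_L2)
  have "rotate_fun g u = (\<lambda>x. \<Sum>n\<le>N. \<Sum>m\<in>I n. L2_inner \<omega> u (Y n m) * rotate_fun g (Y n m) x)"
    using sphere_polys_expansion[OF u] by (simp add: rotate_fun_def fun_eq_iff)
  then have "L2_inner \<omega> (rotate_fun g u) v = (\<Sum>n\<le>N. \<Sum>m\<in>I n. L2_inner \<omega> u (Y n m) * L2_inner \<omega> (rotate_fun g (Y n m)) v)"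
    using v H2 by (simp add: L2_inner_sum_left L2_space_sum L2_space_cmult L2_inner_cmult_left)
  also have "\<dots> = F g"
    unfolding F_def using v H
    by (intro sum.cong refl) (simp add: inner_harmonic_left[OF H v] matrix_coeff_def mult.commute)
  finally show "F g = L2_inner \<omega> (rotate_fun g u) v" ..
qed

text \<open>The rule is exact for products, not for squared moduli. The factor \<open>F\<close>
  comes from \<psi> and \<open>f\<close>, its complex conjugate \<open>G\<close> from their
  conjugates; conjugating \<psi> keeps the degree bound, so both factors are admissible.\<close>

lemma quadrature_rotated_coefficient:
  assumes Q: "quadrature_SO \<mu> (SO_polys \<omega> I Y N) r g w"
    and f: "f \<in> L2_space \<omega>" and \<psi>: "\<psi> \<in> sphere_polys N"
  shows "(\<Sum>i=1..r. w i * (cmod (L2_inner \<omega> f (rotate_fun (g i) \<psi>)))\<^sup>2) =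
    (\<Sum>n\<le>N. power_spectrum f n * power_spectrum \<psi> n / card (I n))"
proof -
  obtain F where F: "F \<in> SO_polys \<omega> I Y N" "\<And>g. g \<in> SO \<Longrightarrow> F g = L2_inner \<omega> (rotate_fun g \<psi>) f"
    using rotated_coefficient_SO_polys[OF \<psi> f] by blast
  have cf: "(\<lambda>x. cnj (f x)) \<in> L2_space \<omega>"
    using f by (auto simp: L2_space_def)
  obtain G where G: "G \<in> SO_polys \<omega> I Y N"
      "\<And>g. g \<in> SO \<Longrightarrow> G g = L2_inner \<omega> (rotate_fun g (\<lambda>x. cnj (\<psi> x))) (\<lambda>x. cnj (f x))"
    using rotated_coefficient_SO_polys[OF sphere_polys_cnj[OF \<psi>] cf] by blast
  have GF: "G g = L2_inner \<omega> f (rotate_fun g \<psi>)" if "g \<in> SO" for g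
    using G(2)[OF that] by (simp add: L2_inner_def rotate_fun_def mult.commute)
  have FG: "F g * G g = of_real ((cmod (L2_inner \<omega> f (rotate_fun g \<psi>)))\<^sup>2)" if "g \<in> SO" for g
    unfolding F(2)[OF that] GF[OF that] complex_norm_square L2_inner_commute[of \<omega> f] by simp
  have gi: "\<And>i. i \<in> {1..r} \<Longrightarrow> g i \<in> SO"
    using Q by (auto simp: quadrature_SO_def)
  have "complex_of_real (\<Sum>i=1..r. w i * (cmod (L2_inner \<omega> f (rotate_fun (g i) \<psi>)))\<^sup>2) =
      (\<Sum>i=1..r. complex_of_real (w i) * F (g i) * G (g i))"
    using FG[OF gi] by (simp add: mult.assoc)
  also have "\<dots> = (\<integral>h. F h * G h \<partial>\<mu>)"
    using Q F(1) G(1) by (auto simp: quadrature_SO_def)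
  also have "\<dots> = (\<integral>h. complex_of_real ((cmod (L2_inner \<omega> f (rotate_fun h \<psi>)))\<^sup>2) \<partial>\<mu>)"
    by (intro Bochner_Integration.integral_cong) (auto simp: FG)
  also have "\<dots> = complex_of_real (\<Sum>n\<le>N. power_spectrum f n * power_spectrum \<psi> n / card (I n))"
    by (rule haar_average_coefficient[OF f \<psi>])
  finally show ?thesis
    by (simp only: of_real_eq_iff)
qed

end

section \<open>Density of the polynomials and Parseval's identity\<close>

lemma L2_norm_squared: "(L2_norm M f)\<^sup>2 = (\<integral>x. (cmod (f x))\<^sup>2 \<partial>M)"
  by (simp add: L2_norm_def)

text \<open>A cheap substitute for Minkowski's inequality on squared norms; its factors 2 are the
  source of the tolerances \<open>\<epsilon> / 4\<close> below.\<close>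

lemma L2_norm_squared_add_le:
  assumes "f \<in> L2_space M" "f' \<in> L2_space M"
  shows "(L2_norm M (\<lambda>x. f x + f' x))\<^sup>2 \<le> 2 * (L2_norm M f)\<^sup>2 + 2 * (L2_norm M f')\<^sup>2"
proof -
  have "(\<integral>x. (cmod (f x + f' x))\<^sup>2 \<partial>M) \<le> (\<integral>x. 2 * (cmod (f x))\<^sup>2 + 2 * (cmod (f' x))\<^sup>2 \<partial>M)"
    using assms L2_space_add[OF assms]
    by (intro integral_mono cmod_add_squared_le) (auto simp: L2_space_def)
  also have "\<dots> = 2 * (\<integral>x. (cmod (f x))\<^sup>2 \<partial>M) + 2 * (\<integral>x. (cmod (f' x))\<^sup>2 \<partial>M)"
    using assms by (simp add: L2_space_def)
  finally show ?thesis
    by (simp add: L2_norm_squared)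
qed

lemma L2_norm_squared_diff_triangle:
  assumes "f \<in> L2_space M" "h \<in> L2_space M" "p \<in> L2_space M"
  shows "(L2_norm M (\<lambda>x. f x - p x))\<^sup>2 \<le> 2 * (L2_norm M (\<lambda>x. f x - h x))\<^sup>2 + 2 * (L2_norm M (\<lambda>x. h x - p x))\<^sup>2"
  using L2_norm_squared_add_le[OF L2_space_diff[OF assms(1,2)] L2_space_diff[OF assms(2,3)]] by simp

context spherical_basis
begin

text \<open>Square-integrability is demanded explicitly: the integral of a non-integrable function
  is 0 by convention, so a small \<open>L2_norm\<close> alone would prove nothing.\<close>

definition approximable :: "(real ^ 'd \<Rightarrow> complex) \<Rightarrow> bool" where
  "approximable f \<longleftrightarrow> f \<in> L2_space \<omega> \<and>
     (\<forall>\<epsilon>>0. \<exists>N. \<exists>p\<in>sphere_polys N. (L2_norm \<omega> (\<lambda>x. f x - p x))\<^sup>2 < \<epsilon>)"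

lemma approximable_L2: "approximable f \<Longrightarrow> f \<in> L2_space \<omega>"
  by (simp add: approximable_def)

lemma approximable_closed:
  assumes f: "f \<in> L2_space \<omega>"
    and h: "\<And>\<epsilon>. \<epsilon> > 0 \<Longrightarrow> \<exists>h. approximable h \<and> (L2_norm \<omega> (\<lambda>x. f x - h x))\<^sup>2 < \<epsilon>"
  shows "approximable f"
  unfolding approximable_def
proof (intro conjI allI impI f)
  fix \<epsilon> :: real assume "\<epsilon> > 0"
  then obtain h where h: "approximable h" "(L2_norm \<omega> (\<lambda>x. f x - h x))\<^sup>2 < \<epsilon> / 4"
    using assms(2)[of "\<epsilon> / 4"] by auto
  then obtain N p where p: "p \<in> sphere_polys N" "(L2_norm \<omega> (\<lambda>x. h x - p x))\<^sup>2 < \<epsilon> / 4"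
    using \<open>\<epsilon> > 0\<close> unfolding approximable_def by (meson divide_pos_pos zero_less_numeral)
  have "(L2_norm \<omega> (\<lambda>x. f x - p x))\<^sup>2 < \<epsilon>"
    using L2_norm_squared_diff_triangle[OF f approximable_L2[OF h(1)] sphere_polys_L2[OF p(1)]] h(2) p(2) by linarith
  then show "\<exists>N. \<exists>p\<in>sphere_polys N. (L2_norm \<omega> (\<lambda>x. f x - p x))\<^sup>2 < \<epsilon>"
    using p(1) by blast
qed

text \<open>Dominated convergence, applied to the squared error, packaged for the limits below:
  cutoff functions, disjoint unions and simple functions.\<close>

lemma approximable_limit:
  assumes F: "\<And>i. approximable (F i)" and w: "integrable \<omega> w" and f: "f \<in> borel_measurable \<omega>"
    and lim: "\<And>x. x \<in> unit_sphere \<Longrightarrow> (\<lambda>i. F i x) \<longlonglongrightarrow> f x"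
    and dom: "\<And>i x. x \<in> unit_sphere \<Longrightarrow> (cmod (f x - F i x))\<^sup>2 \<le> w x" "\<And>x. x \<in> unit_sphere \<Longrightarrow> (cmod (f x))\<^sup>2 \<le> w x"
  shows "approximable f"
proof (rule approximable_closed)
  have Fm: "F i \<in> borel_measurable \<omega>" for i
    using approximable_L2[OF F] by (simp add: L2_space_def)
  have "integrable \<omega> (\<lambda>x. (cmod (f x))\<^sup>2)"
    using f dom(2) by (intro Bochner_Integration.integrable_bound[OF w]) (auto intro!: AE_I2 order_trans[OF _ abs_ge_self])
  then show "f \<in> L2_space \<omega>"
    using f by (simp add: L2_space_def)
  fix \<epsilon> :: real assume e: "\<epsilon> > 0"
  have "(\<lambda>i. \<integral>x. (cmod (f x - F i x))\<^sup>2 \<partial>\<omega>) \<longlonglongrightarrow> (\<integral>x. 0 \<partial>\<omega>)"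
  proof (rule integral_dominated_convergence[OF _ _ w])
    show "AE x in \<omega>. (\<lambda>i. (cmod (f x - F i x))\<^sup>2) \<longlonglongrightarrow> 0"
    proof (intro AE_I2)
      fix x assume "x \<in> space \<omega>"
      then have "(\<lambda>i. (cmod (f x - F i x))\<^sup>2) \<longlonglongrightarrow> (cmod (f x - f x))\<^sup>2"
        by (intro tendsto_intros lim) auto
      then show "(\<lambda>i. (cmod (f x - F i x))\<^sup>2) \<longlonglongrightarrow> 0"
        by simp
    qed
  qed (use f Fm dom in auto)
  then have "eventually (\<lambda>i. (\<integral>x. (cmod (f x - F i x))\<^sup>2 \<partial>\<omega>) < \<epsilon>) sequentially"
    using e by (intro order_tendstoD(2)) auto
  then obtain i where "(\<integral>x. (cmod (f x - F i x))\<^sup>2 \<partial>\<omega>) < \<epsilon>"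
    by (auto simp: eventually_sequentially)
  then show "\<exists>h. approximable h \<and> (L2_norm \<omega> (\<lambda>x. f x - h x))\<^sup>2 < \<epsilon>"
    using F by (intro exI[of _ "F i"]) (simp add: L2_norm_squared)
qed

lemma approximable_cong:
  assumes f: "approximable f" and eq: "\<And>x. x \<in> unit_sphere \<Longrightarrow> f x = f' x"
  shows "approximable f'"
proof -
  have L2: "f \<in> borel_measurable \<omega>" "integrable \<omega> (\<lambda>x. (cmod (f x))\<^sup>2)"
    using approximable_L2[OF f] by (auto simp: L2_space_def)
  have "f' \<in> borel_measurable \<omega>"
    using L2(1) eq measurable_cong[of \<omega> f f' borel] by simp
  then show ?thesis
    by (rule approximable_limit[OF f L2(2)]) (simp_all add: eq)
qed

lemma approximable_sphere_polys: "p \<in> sphere_polys N \<Longrightarrow> approximable p"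
  unfolding approximable_def by (auto intro!: exI[of _ N] bexI[of _ p] sphere_polys_L2 simp: L2_norm_squared)

lemma approximable_add:
  assumes f: "approximable f" and f': "approximable f'"
  shows "approximable (\<lambda>x. f x + f' x)"
  unfolding approximable_def
proof (intro conjI allI impI)
  show "(\<lambda>x. f x + f' x) \<in> L2_space \<omega>"
    using assms by (intro L2_space_add approximable_L2)
  fix \<epsilon> :: real assume e: "\<epsilon> > 0"
  obtain N p where p: "p \<in> sphere_polys N" "(L2_norm \<omega> (\<lambda>x. f x - p x))\<^sup>2 < \<epsilon> / 4"
    using f e unfolding approximable_def by (meson divide_pos_pos zero_less_numeral)
  obtain N' p' where p': "p' \<in> sphere_polys N'" "(L2_norm \<omega> (\<lambda>x. f' x - p' x))\<^sup>2 < \<epsilon> / 4"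
    using f' e unfolding approximable_def by (meson divide_pos_pos zero_less_numeral)
  have "(\<lambda>x. p x + p' x) \<in> sphere_polys (max N N')"
    using p p' by (intro sphere_polys_add sphere_polys_mono[OF p(1)] sphere_polys_mono[OF p'(1)]) auto
  moreover have "(L2_norm \<omega> (\<lambda>x. (f x - p x) + (f' x - p' x)))\<^sup>2 < \<epsilon>"
    using L2_norm_squared_add_le[of "\<lambda>x. f x - p x" \<omega> "\<lambda>x. f' x - p' x"] p p'
      L2_space_diff[OF approximable_L2[OF f] sphere_polys_L2[OF p(1)]] L2_space_diff[OF approximable_L2[OF f'] sphere_polys_L2[OF p'(1)]]
    by fastforce
  ultimately show "\<exists>N. \<exists>p\<in>sphere_polys N. (L2_norm \<omega> (\<lambda>x. f x + f' x - p x))\<^sup>2 < \<epsilon>"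
    by (intro exI[of _ "max N N'"] bexI[of _ "\<lambda>x. p x + p' x"]) (auto simp: algebra_simps)
qed

lemma approximable_cmult:
  assumes f: "approximable f"
  shows "approximable (\<lambda>x. c * f x)"
  unfolding approximable_def
proof (intro conjI allI impI)
  show "(\<lambda>x. c * f x) \<in> L2_space \<omega>"
    using assms by (intro L2_space_cmult approximable_L2)
  fix \<epsilon> :: real assume e: "\<epsilon> > 0"
  define K where "K = (cmod c)\<^sup>2 + 1"
  have K: "K > 0"
    by (simp add: K_def add_nonneg_pos)
  obtain N p where p: "p \<in> sphere_polys N" "(L2_norm \<omega> (\<lambda>x. f x - p x))\<^sup>2 < \<epsilon> / K"
    using f e K unfolding approximable_def by (meson divide_pos_pos)
  have "(L2_norm \<omega> (\<lambda>x. c * f x - c * p x))\<^sup>2 = (cmod c)\<^sup>2 * (L2_norm \<omega> (\<lambda>x. f x - p x))\<^sup>2"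
    by (simp add: L2_norm_squared norm_mult power_mult_distrib flip: right_diff_distrib)
  also have "\<dots> \<le> K * (L2_norm \<omega> (\<lambda>x. f x - p x))\<^sup>2"
    by (intro mult_right_mono) (auto simp: K_def)
  also have "\<dots> < \<epsilon>"
    using p(2) K by (simp add: field_simps)
  finally show "\<exists>N. \<exists>p\<in>sphere_polys N. (L2_norm \<omega> (\<lambda>x. c * f x - p x))\<^sup>2 < \<epsilon>"
    using sphere_polys_cmult[OF p(1), of c] by (intro exI[of _ N] bexI[of _ "\<lambda>x. c * p x"])
qed

lemma approximable_sum:
  "(\<And>i. i \<in> A \<Longrightarrow> approximable (f i)) \<Longrightarrow> approximable (\<lambda>x. \<Sum>i\<in>A. f i x)"
  by (induction A rule: infinite_finite_induct)
     (auto intro: approximable_add approximable_sphere_polys[OF sphere_polys_zero])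

text \<open>Stone-Weierstrass yields real polynomial functions that need not be homogeneous. Letting
  them act as multipliers avoids splitting them into homogeneous parts.\<close>

lemma real_polynomial_mult_sphere_polys:
  fixes q :: "real ^ 'd \<Rightarrow> real"
  assumes "real_polynomial_function q"
  shows "f \<in> sphere_polys N \<Longrightarrow> \<exists>M. (\<lambda>x. complex_of_real (q x) * f x) \<in> sphere_polys M"
  using assms
proof (induction arbitrary: f N rule: real_polynomial_function.induct)
  case (linear q)
  have qx: "q x = (\<Sum>i\<in>UNIV. x $ i * q (axis i 1))" for x
  proof -
    have "q x = q (\<Sum>i\<in>UNIV. x $ i *\<^sub>R axis i 1)"
      by (simp add: basis_expansion flip: scalar_mult_eq_scaleR)
    then show ?thesis
      using linear(1) by (simp add: linear_sum linear_scale bounded_linear.linear)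
  qed
  have "(\<lambda>x. complex_of_real (q x) * f x) =
      (\<lambda>x. \<Sum>i\<in>UNIV. complex_of_real (q (axis i 1)) * (complex_of_real (x $ i) * f x))"
    by (rule ext, subst qx) (simp add: sum_distrib_left sum_distrib_right mult_ac)
  also have "\<dots> \<in> sphere_polys (Suc N)"
    by (intro sphere_polys_sum sphere_polys_cmult sphere_polys_coord_mult dim linear)
  finally show ?case ..
next
  case (const c)
  then show ?case
    using sphere_polys_cmult by blast
next
  case (add p q)
  obtain M M' where M: "(\<lambda>x. complex_of_real (p x) * f x) \<in> sphere_polys M"
    "(\<lambda>x. complex_of_real (q x) * f x) \<in> sphere_polys M'"
    using add by metis
  have "(\<lambda>x. complex_of_real (p x) * f x + complex_of_real (q x) * f x) \<in> sphere_polys (max M M')"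
    by (intro sphere_polys_add sphere_polys_mono[OF M(1)] sphere_polys_mono[OF M(2)]) auto
  then show ?case
    by (auto simp: ring_distribs)
next
  case (mult p q)
  obtain M where M: "(\<lambda>x. complex_of_real (q x) * f x) \<in> sphere_polys M"
    using mult by metis
  then show ?case
    using mult.IH(1)[OF M] by (simp add: mult.assoc)
qed

lemma approximable_continuous:
  fixes f :: "real ^ 'd \<Rightarrow> real"
  assumes f: "continuous_on unit_sphere f"
  shows "approximable (\<lambda>x. complex_of_real (f x))"
proof (rule approximable_closed)
  have f': "continuous_on unit_sphere (\<lambda>x. complex_of_real (f x))"
    using f by (intro continuous_intros)
  then show L2: "(\<lambda>x. complex_of_real (f x)) \<in> L2_space \<omega>"
    by (rule continuous_L2)
  fix \<epsilon> :: real assume e: "\<epsilon> > 0"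
  \<comment> \<open>The total mass is 1, so a uniform error below \<delta> bounds the squared norm
    by half the tolerance.\<close>
  define \<delta> where "\<delta> = sqrt (\<epsilon> / 2)"
  have \<delta>: "\<delta> > 0" "\<delta>\<^sup>2 = \<epsilon> / 2"
    using e by (auto simp: \<delta>_def)
  obtain q where q: "real_polynomial_function q" "\<And>x. x \<in> unit_sphere \<Longrightarrow> \<bar>f x - q x\<bar> < \<delta>"
    using Stone_Weierstrass_real_polynomial_function[OF compact_sphere f \<delta>(1)] by blast
  \<comment> \<open>Multiplying this function by \<open>q\<close> cuts \<open>q\<close> off outside
    the sphere, as membership in \<open>sphere_polys\<close> demands.\<close>
  have "sphere_restrict (\<lambda>x :: real ^ 'd. 1) \<in> sphere_polys 0"
    by (rule sphere_polys_hpoly[OF dim hpoly.const]) simp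
  then obtain M where M: "(\<lambda>x. complex_of_real (q x) * sphere_restrict (\<lambda>x. 1) x) \<in> sphere_polys M" (is "?p \<in> _")
    using real_polynomial_mult_sphere_polys[OF q(1)] by blast
  have "(L2_norm \<omega> (\<lambda>x. complex_of_real (f x) - ?p x))\<^sup>2 \<le> (\<integral>x. \<delta>\<^sup>2 \<partial>\<omega>)"
    unfolding L2_norm_squared
  proof (rule integral_mono)
    show "integrable \<omega> (\<lambda>x. (cmod (complex_of_real (f x) - ?p x))\<^sup>2)"
      using L2_space_diff[OF L2 sphere_polys_L2[OF M]] by (simp add: L2_space_def)
    fix x assume "x \<in> space \<omega>"
    then have x: "x \<in> unit_sphere" by simp
    have "cmod (complex_of_real (f x) - ?p x) = \<bar>f x - q x\<bar>"
      using x by (simp add: sphere_restrict_def flip: of_real_diff)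
    then show "(cmod (complex_of_real (f x) - ?p x))\<^sup>2 \<le> \<delta>\<^sup>2"
      using q(2)[OF x] by (intro power_mono) auto
  qed simp
  also have "\<dots> = \<epsilon> / 2"
    using normalized \<delta> by (simp add: normalized_sphere_measure_def measure_def)
  also have "\<dots> < \<epsilon>"
    using e by simp
  finally show "\<exists>h. approximable h \<and> (L2_norm \<omega> (\<lambda>x. complex_of_real (f x) - h x))\<^sup>2 < \<epsilon>"
    using approximable_sphere_polys[OF M] by blast
qed

section \<open>From indicators to all square-integrable functions\<close>

lemma indicator_measurable:
  assumes "B \<in> sets borel"
  shows "(\<lambda>x. complex_of_real (indicator B x)) \<in> borel_measurable \<omega>"
proof -
  have "(\<lambda>x. complex_of_real (indicator B x)) \<in> borel_measurable (restrict_space borel unit_sphere)"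
    using assms by (intro measurable_restrict_space1) auto
  then show ?thesis
    by (simp add: measurable_cong_sets[OF sets_sphere])
qed

text \<open>The functions \<open>F i\<close> fall linearly from 1 on \<open>C\<close> to 0 at
  distance 1/i. Closedness gives every other point a positive distance, so they converge to the
  indicator.\<close>

lemma approximable_indicator_closed:
  fixes C :: "(real ^ 'd) set"
  assumes C: "closed C"
  shows "approximable (\<lambda>x. complex_of_real (indicator C x))"
\<comment> \<open>The distance to the empty set is 0 by convention, and the cutoff functions would
  then be constantly 1.\<close>
proof (cases "C = {}")
  case True
  then show ?thesis
    using approximable_sphere_polys[OF sphere_polys_zero] by simp
next
  case False
  define F where "F = (\<lambda>i x. max 0 (1 - real i * infdist x C))"
  show ?thesis
  proof (rule approximable_limit[where F = "\<lambda>i x. complex_of_real (F i x)" and w = "\<lambda>_. 1"])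
    show "approximable (\<lambda>x. complex_of_real (F i x))" for i
      unfolding F_def by (intro approximable_continuous continuous_intros)
    show "(\<lambda>x. complex_of_real (indicator C x)) \<in> borel_measurable \<omega>"
      using C by (intro indicator_measurable) auto
    have F: "0 \<le> F i x" "F i x \<le> 1" for i x
      by (auto simp: F_def infdist_nonneg)
    show "(cmod (complex_of_real (indicator C x) - complex_of_real (F i x)))\<^sup>2 \<le> 1" for i x
    proof -
      have "\<bar>indicator C x - F i x\<bar> \<le> 1"
        using F[of i x] by (auto simp: indicator_def)
      then have "\<bar>indicator C x - F i x\<bar>\<^sup>2 \<le> 1"
        by (intro power_le_one) auto
      then show ?thesis
        by (simp flip: of_real_diff)
    qed
    show "(cmod (complex_of_real (indicator C x)))\<^sup>2 \<le> 1" for x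
      by (auto simp: indicator_def)
    show "(\<lambda>i. complex_of_real (F i x)) \<longlonglongrightarrow> complex_of_real (indicator C x)" for x
    proof (cases "x \<in> C")
      case True
      then show ?thesis
        by (simp add: F_def)
    next
      case x: False
      have "infdist x C > 0"
        using x C False by (metis in_closed_iff_infdist_zero infdist_nonneg less_eq_real_def)
      then obtain n where n: "1 < real n * infdist x C"
        using reals_Archimedean3 by blast
      have "F i x = 0" if "i \<ge> n" for i
      proof -
        have "real n * infdist x C \<le> real i * infdist x C"
          using that by (intro mult_right_mono) (auto simp: infdist_nonneg)
        then show ?thesis
          using n by (simp add: F_def)
      qed
      then have "eventually (\<lambda>i. complex_of_real (F i x) = complex_of_real (indicator C x)) sequentially"
        using x by (auto simp: eventually_sequentially)
      then show ?thesis
        by (rule tendsto_eventually)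
    qed
  qed simp_all
qed

text \<open>Closed sets generate the Borel sets and are stable under intersection, so Dynkin's
  induction reduces unions to disjoint ones, where partial sums of indicators are again indicators,
  bounded by 1.\<close>

lemma approximable_indicator:
  fixes B :: "(real ^ 'd) set"
  assumes "B \<in> sets borel"
  shows "approximable (\<lambda>x. complex_of_real (indicator B x))"
proof -
  have sig: "sets borel = sigma_sets UNIV (Collect (closed :: (real ^ 'd) set \<Rightarrow> bool))"
    by (simp add: borel_eq_closed)
  have "Int_stable (Collect (closed :: (real ^ 'd) set \<Rightarrow> bool))" "Collect closed \<subseteq> Pow (UNIV :: (real ^ 'd) set)"
    by (auto simp: Int_stable_def)
  then show ?thesis
    using assms[unfolded sig]
  proof (induct rule: sigma_sets_induct_disjoint)
    case (basic A)
    then show ?case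
      by (simp add: approximable_indicator_closed)
  next
    case empty
    then show ?case
      using approximable_sphere_polys[OF sphere_polys_zero] by simp
  next
    case (compl A)
    have "approximable (\<lambda>x. complex_of_real 1 + (- 1) * complex_of_real (indicator A x))"
      by (intro approximable_add approximable_cmult compl approximable_continuous continuous_intros)
    then show ?case
      by (rule approximable_cong) (auto simp: indicator_def)
  next
    case (union A)
    show ?case
    proof (rule approximable_limit[where F = "\<lambda>n x. \<Sum>i<n. complex_of_real (indicator (A i) x)" and w = "\<lambda>_. 1"])
      show "approximable (\<lambda>x. \<Sum>i<n. complex_of_real (indicator (A i) x))" for n
        by (intro approximable_sum union)
      show "(\<lambda>x. complex_of_real (indicator (\<Union>i. A i) x)) \<in> borel_measurable \<omega>"
        using union(2) unfolding sig[symmetric] by (intro indicator_measurable sets.countable_UN) auto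
      have fin: "(\<Sum>i<n. complex_of_real (indicator (A i) x)) = complex_of_real (indicator (\<Union>i<n. A i) x)" for n x
        using union(1) by (subst indicator_UN_disjoint) (auto simp: disjoint_family_on_def)
      show "(cmod (complex_of_real (indicator (\<Union>i. A i) x) - (\<Sum>i<n. complex_of_real (indicator (A i) x))))\<^sup>2 \<le> 1" for n x
        unfolding fin by (auto simp: indicator_def)
      show "(cmod (complex_of_real (indicator (\<Union>i. A i) x)))\<^sup>2 \<le> 1" for x
        by (auto simp: indicator_def)
      show "(\<lambda>n. \<Sum>i<n. complex_of_real (indicator (A i) x)) \<longlonglongrightarrow> complex_of_real (indicator (\<Union>i. A i) x)" for x
        unfolding fin by (intro tendsto_of_real LIMSEQ_indicator_UN)
    qed simp_all
  qed
qed

lemma approximable_simple_function: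
  assumes F: "simple_function \<omega> F"
  shows "approximable F"
proof (rule approximable_cong)
  have "approximable (\<lambda>x. complex_of_real (indicator (F -` {y} \<inter> space \<omega>) x))" for y
  proof -
    have "F -` {y} \<inter> space \<omega> \<in> sets \<omega>"
      using F by (rule simple_functionD)
    \<comment> \<open>Measurable sets of \<omega> are traces on the sphere of Borel sets of the
      whole space.\<close>
    then obtain B where B: "B \<in> sets borel" "F -` {y} \<inter> space \<omega> = unit_sphere \<inter> B"
      by (auto simp: sets_sphere sets_restrict_space)
    have "x \<in> B \<longleftrightarrow> x \<in> F -` {y} \<inter> space \<omega>" if "x \<in> unit_sphere" for x
      using that B(2) by blast
    then show ?thesis
      by (intro approximable_cong[OF approximable_indicator[OF B(1)]]) (simp only: indicator_def)
  qed
  then show "approximable (\<lambda>x. \<Sum>y\<in>F ` space \<omega>. y * complex_of_real (indicator (F -` {y} \<inter> space \<omega>) x))"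
    by (intro approximable_sum approximable_cmult)
  show "(\<Sum>y\<in>F ` space \<omega>. y * complex_of_real (indicator (F -` {y} \<inter> space \<omega>) x)) = F x" if "x \<in> unit_sphere" for x
    using that by (subst simple_function_indicator_representation_banach[OF F, of x])
      (simp_all add: scaleR_conv_of_real mult.commute)
qed

theorem L2_approximable:
  assumes f: "f \<in> L2_space \<omega>"
  shows "approximable f"
proof -
  have fm: "f \<in> borel_measurable \<omega>" and fi: "integrable \<omega> (\<lambda>x. (cmod (f x))\<^sup>2)"
    using f by (auto simp: L2_space_def)
  obtain F where F: "\<And>i. simple_function \<omega> (F i)" "\<And>x. x \<in> space \<omega> \<Longrightarrow> (\<lambda>i. F i x) \<longlonglongrightarrow> f x"
     "\<And>i x. x \<in> space \<omega> \<Longrightarrow> dist (F i x) 0 \<le> 2 * dist (f x) 0"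
    using borel_measurable_implies_sequence_metric[OF fm, of 0] by blast
  show ?thesis
  \<comment> \<open>The simple functions are bounded by twice the modulus of \<open>f\<close>, hence
    the error by three times it; squaring gives 9.\<close>
  proof (rule approximable_limit[where F = F and w = "\<lambda>x. 9 * (cmod (f x))\<^sup>2"])
    show "(cmod (f x - F i x))\<^sup>2 \<le> 9 * (cmod (f x))\<^sup>2" if "x \<in> unit_sphere" for i x
    proof -
      have "cmod (f x - F i x) \<le> cmod (f x) + cmod (F i x)"
        by (rule norm_triangle_ineq4)
      also have "\<dots> \<le> 3 * cmod (f x)"
        using F(3)[of x i] that by simp
      finally have "(cmod (f x - F i x))\<^sup>2 \<le> (3 * cmod (f x))\<^sup>2"
        by (intro power_mono) auto
      then show ?thesis
        by (simp add: power_mult_distrib)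
    qed
  qed (use F fm fi in \<open>auto intro: approximable_simple_function\<close>)
qed

text \<open>Completing the square in each coefficient. With \<open>p\<close> the projection of
  \<open>f\<close> this is Bessel's inequality; discarding the first squares gives the opposite
  estimate for Parseval's identity.\<close>

lemma L2_norm_diff_sphere_poly:
  assumes f: "f \<in> L2_space \<omega>" and p: "p \<in> sphere_polys N"
  shows "(L2_norm \<omega> (\<lambda>x. f x - p x))\<^sup>2 = (L2_norm \<omega> f)\<^sup>2 +
    (\<Sum>n\<le>N. \<Sum>k\<in>I n. (cmod (L2_inner \<omega> f (Y n k) - L2_inner \<omega> p (Y n k)))\<^sup>2 - (cmod (L2_inner \<omega> f (Y n k)))\<^sup>2)"
proof -
  note L2 = f sphere_polys_L2[OF p]
  note d = L2_space_diff[OF L2]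
  let ?a = "\<lambda>n k. L2_inner \<omega> f (Y n k)" and ?c = "\<lambda>n k. L2_inner \<omega> p (Y n k)"
  have fp: "L2_inner \<omega> h p = (\<Sum>n\<le>N. \<Sum>k\<in>I n. L2_inner \<omega> h (Y n k) * cnj (?c n k))" if "h \<in> L2_space \<omega>" for h
    unfolding inner_sphere_poly[OF that p] by (simp flip: L2_inner_commute)
  have "complex_of_real ((L2_norm \<omega> (\<lambda>x. f x - p x))\<^sup>2) = L2_inner \<omega> f (\<lambda>x. f x - p x) - L2_inner \<omega> p (\<lambda>x. f x - p x)"
    by (simp only: L2_inner_self[symmetric] L2_inner_diff_left[OF L2 d])
  also have "\<dots> = cnj (L2_inner \<omega> f f - L2_inner \<omega> p f) - cnj (L2_inner \<omega> f p - L2_inner \<omega> p p)"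
    by (subst (1 2) L2_inner_commute) (simp only: L2_inner_diff_left[OF L2 L2(1)] L2_inner_diff_left[OF L2 L2(2)])
  also have "\<dots> = L2_inner \<omega> f f - L2_inner \<omega> f p - cnj (L2_inner \<omega> f p) + L2_inner \<omega> p p"
    by (simp flip: L2_inner_commute)
  also have "\<dots> = L2_inner \<omega> f f + (\<Sum>n\<le>N. \<Sum>k\<in>I n.
      (?a n k - ?c n k) * cnj (?a n k - ?c n k) - ?a n k * cnj (?a n k))"
    unfolding fp[OF L2(1)] fp[OF L2(2)]
    by (simp add: sum_subtractf sum.distrib algebra_simps)
  also have "\<dots> = of_real ((L2_norm \<omega> f)\<^sup>2 + (\<Sum>n\<le>N. \<Sum>k\<in>I n. (cmod (?a n k - ?c n k))\<^sup>2 - (cmod (?a n k))\<^sup>2))"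
    by (simp add: L2_inner_self complex_norm_square del: of_real_power)
  finally show ?thesis
    by (simp only: of_real_eq_iff)
qed

lemma bessel_inequality:
  assumes f: "f \<in> L2_space \<omega>"
  shows "(\<Sum>n\<le>N. power_spectrum f n) \<le> (L2_norm \<omega> f)\<^sup>2"
proof -
  define h where "h = (\<lambda>n x. \<Sum>k\<in>I n. L2_inner \<omega> f (Y n k) * Y n k x)"
  define p where "p = (\<lambda>x. \<Sum>n\<le>N. h n x)"
  have h: "h n \<in> spherical_harmonics n" for n
    unfolding h_def by (rule combination_harmonic)
  then have p: "p \<in> sphere_polys N"
    unfolding p_def sphere_polys_def by blast
  have c: "L2_inner \<omega> p (Y n k) = L2_inner \<omega> f (Y n k)" if "n \<le> N" "k \<in> I n" for n k
  proof -
    have "L2_inner \<omega> p (Y n k) = (\<Sum>m\<le>N. L2_inner \<omega> (h m) (Y n k))"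
      unfolding p_def using h that by (intro L2_inner_sum_left) (auto intro: harmonics_L2)
    also have "\<dots> = (\<Sum>m\<le>N. if m = n then L2_inner \<omega> f (Y n k) else 0)"
      using h that harmonics_orthogonal[OF h, of "Y n k" n]
      by (intro sum.cong) (auto simp: h_def inner_combination)
    finally show ?thesis
      using that by simp
  qed
  show ?thesis
    using L2_norm_diff_sphere_poly[OF f p] zero_le_power2[of "L2_norm \<omega> (\<lambda>x. f x - p x)"]
    by (simp add: c sum_negf power_spectrum_def)
qed

theorem parseval:
  assumes f: "f \<in> L2_space \<omega>"
  shows "(\<lambda>n. power_spectrum f n) sums (L2_norm \<omega> f)\<^sup>2"
  unfolding sums_def_le
proof (rule LIMSEQ_I)
  fix \<epsilon> :: real assume e: "\<epsilon> > 0"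
  obtain N p where p: "p \<in> sphere_polys N" "(L2_norm \<omega> (\<lambda>x. f x - p x))\<^sup>2 < \<epsilon>"
    using L2_approximable[OF f] e unfolding approximable_def by blast
  have "norm ((\<Sum>n\<le>M. power_spectrum f n) - (L2_norm \<omega> f)\<^sup>2) < \<epsilon>" if "N \<le> M" for M
  proof -
    \<comment> \<open>The truncated expansion of \<open>f\<close> approximates at least as well as
      any \<open>p\<close> of the same degree.\<close>
    have "(L2_norm \<omega> f)\<^sup>2 - (\<Sum>n\<le>N. power_spectrum f n) \<le> (L2_norm \<omega> (\<lambda>x. f x - p x))\<^sup>2"
      unfolding L2_norm_diff_sphere_poly[OF f p(1)] power_spectrum_def
      by (simp add: sum_subtractf sum_nonneg)
    moreover have "(\<Sum>n\<le>N. power_spectrum f n) \<le> (\<Sum>n\<le>M. power_spectrum f n)"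
      using that by (intro sum_mono2) (auto simp: power_spectrum_nonneg)
    ultimately show ?thesis
      using bessel_inequality[OF f, of M] p(2) by simp
  qed
  then show "\<exists>N. \<forall>M\<ge>N. norm ((\<Sum>n\<le>M. power_spectrum f n) - (L2_norm \<omega> f)\<^sup>2) < \<epsilon>"
    by blast
qed

end

section \<open>Frames\<close>

text \<open>Tonelli's theorem for counting measures.\<close>

lemma suminf_swap_ennreal:
  fixes f :: "nat \<Rightarrow> nat \<Rightarrow> ennreal"
  shows "(\<Sum>i. \<Sum>j. f i j) = (\<Sum>j. \<Sum>i. f i j)"
  using nn_integral_suminf[of "\<lambda>j i. f i j" "count_space UNIV"] by (simp add: nn_integral_count_space_nat)

text \<open>Both sides are suprema of finite sums: a finite set of pairs lies below some
  \<open>m\<close> in its first component, and each block below \<open>m\<close> is itself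
  finite.\<close>

lemma infsum_Sigma_ennreal:
  fixes f :: "nat \<times> 'i \<Rightarrow> ennreal"
  assumes fin: "\<And>j. finite (A j)"
  shows "(\<Sum>\<^sub>\<infinity>p\<in>(SIGMA j:UNIV. A j). f p) = (\<Sum>j. \<Sum>i\<in>A j. f (j, i))"
proof (rule antisym)
  have inf: "(\<Sum>\<^sub>\<infinity>p\<in>(SIGMA j:UNIV. A j). f p) = (SUP F\<in>{F. finite F \<and> F \<subseteq> (SIGMA j:UNIV. A j)}. sum f F)"
    by (rule nonneg_infsum_complete) simp
  have part: "(\<Sum>j<m. \<Sum>i\<in>A j. f (j, i)) = sum f (SIGMA j:{..<m}. A j)" for m
    by (subst sum.Sigma) (auto simp: fin)
  show "(\<Sum>\<^sub>\<infinity>p\<in>(SIGMA j:UNIV. A j). f p) \<le> (\<Sum>j. \<Sum>i\<in>A j. f (j, i))"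
    unfolding inf
  proof (rule SUP_least)
    fix F assume "F \<in> {F. finite F \<and> F \<subseteq> (SIGMA j:UNIV. A j)}"
    then have F: "finite F" "F \<subseteq> (SIGMA j:UNIV. A j)"
      by auto
    obtain m where m: "\<And>j. j \<in> fst ` F \<Longrightarrow> j < m"
      using finite_nat_set_iff_bounded[of "fst ` F"] F(1) by auto
    have "sum f F \<le> sum f (SIGMA j:{..<m}. A j)"
      using F m by (intro sum_mono2) (force simp: fin)+
    also have "\<dots> \<le> (\<Sum>j. \<Sum>i\<in>A j. f (j, i))"
      unfolding part[symmetric] by (rule sum_le_suminf) auto
    finally show "sum f F \<le> (\<Sum>j. \<Sum>i\<in>A j. f (j, i))" .
  qed
  show "(\<Sum>j. \<Sum>i\<in>A j. f (j, i)) \<le> (\<Sum>\<^sub>\<infinity>p\<in>(SIGMA j:UNIV. A j). f p)"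
    unfolding inf suminf_eq_SUP part
    by (intro SUP_least SUP_upper) (auto simp: fin)
qed

context spherical_basis
begin

lemma power_spectrum_sphere_polys:
  assumes "\<psi> \<in> sphere_polys N" "N < n"
  shows "power_spectrum \<psi> n = 0"
  using sphere_polys_orthogonal[OF assms(1) _ assms(2)] by (simp add: power_spectrum_def)

lemma power_spectrum_Y:
  assumes "k \<in> I n"
  shows "power_spectrum (Y n k) m = (if m = n then 1 else 0)"
proof (cases "m = n")
  case True
  have "power_spectrum (Y n k) n = (\<Sum>l\<in>I n. if l = k then 1 else 0)"
    unfolding power_spectrum_def using assms by (intro sum.cong) (auto simp: Y_orthonormal)
  then show ?thesis
    using assms True by simp
next
  case False
  then show ?thesis
    using assms by (auto simp: power_spectrum_def Y_orthogonal)
qed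

lemma L2_norm_Y: "k \<in> I n \<Longrightarrow> L2_norm \<omega> (Y n k) = 1"
  using Y_orthonormal[of k n k] by (simp add: L2_norm_def L2_inner_self[unfolded L2_norm_def])

end

section \<open>The frame inequality as a weighted Parseval identity\<close>

context spherical_haar
begin

text \<open>The exchange of sums collects, degree by degree, the contributions of all scales
  \<open>j\<close>; the spectrum of \<open>f\<close> is common to them and factors out.\<close>

lemma quadrature_series:
  assumes Q: "\<And>j. quadrature_SO \<mu> (SO_polys \<omega> I Y (N j)) (r j) (g j) (w j)"
    and \<psi>: "\<And>j. \<psi> j \<in> sphere_polys (N j)" and f: "f \<in> L2_space \<omega>"
  shows "(\<Sum>j. \<Sum>i=1..r j. ennreal (w j i * (cmod (L2_inner \<omega> f (rotate_fun (g j i) (\<psi> j))))\<^sup>2)) =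
    (\<Sum>n. ennreal (power_spectrum f n) * (\<Sum>j. ennreal (power_spectrum (\<psi> j) n / card (I n))))"
proof -
  have "(\<Sum>i=1..r j. ennreal (w j i * (cmod (L2_inner \<omega> f (rotate_fun (g j i) (\<psi> j))))\<^sup>2)) =
      (\<Sum>n. ennreal (power_spectrum f n * (power_spectrum (\<psi> j) n / card (I n))))" for j
  proof -
    have "w j i \<ge> 0" if "i \<in> {1..r j}" for i
      using Q[of j] that by (auto simp: quadrature_SO_def intro: less_imp_le)
    then have "(\<Sum>i=1..r j. ennreal (w j i * (cmod (L2_inner \<omega> f (rotate_fun (g j i) (\<psi> j))))\<^sup>2)) =
       ennreal (\<Sum>n\<le>N j. power_spectrum f n * (power_spectrum (\<psi> j) n / card (I n)))"
      using quadrature_rotated_coefficient[OF Q f \<psi>, of j] by (subst sum_ennreal) auto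
    also have "\<dots> = (\<Sum>n\<le>N j. ennreal (power_spectrum f n * (power_spectrum (\<psi> j) n / card (I n))))"
      by (subst sum_ennreal) (auto simp: power_spectrum_nonneg)
    \<comment> \<open>Beyond degree \<open>N j\<close> the spectrum of \<open>\<psi> j\<close>
      vanishes. Extending the sum to a series makes its range independent of \<open>j\<close>, ready
      for the exchange.\<close>
    also have "\<dots> = (\<Sum>n. ennreal (power_spectrum f n * (power_spectrum (\<psi> j) n / card (I n))))"
      using power_spectrum_sphere_polys[OF \<psi>] by (intro suminf_finite[symmetric]) auto
    finally show ?thesis .
  qed
  then have "(\<Sum>j. \<Sum>i=1..r j. ennreal (w j i * (cmod (L2_inner \<omega> f (rotate_fun (g j i) (\<psi> j))))\<^sup>2)) =
      (\<Sum>n. \<Sum>j. ennreal (power_spectrum f n * (power_spectrum (\<psi> j) n / card (I n))))"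
    by (simp only:) (rule suminf_swap_ennreal)
  then show ?thesis
    by (simp only: ennreal_mult'[OF power_spectrum_nonneg] ennreal_suminf_cmult)
qed

lemma wavelet_frame_iff:
  assumes Q: "\<And>j. quadrature_SO \<mu> (SO_polys \<omega> I Y (N j)) (r j) (g j) (w j)"
    and \<psi>: "\<And>j. \<psi> j \<in> sphere_polys (N j)"
  shows "frame_with_bounds \<omega> (SIGMA j:UNIV. {1..r j}) (wavelet_system g w \<psi>) C1 C2 \<longleftrightarrow>
    (\<forall>f\<in>L2_space \<omega>.
      ennreal (C1 * (L2_norm \<omega> f)\<^sup>2)
        \<le> (\<Sum>j. \<Sum>i=1..r j. ennreal (w j i * (cmod (L2_inner \<omega> f (rotate_fun (g j i) (\<psi> j))))\<^sup>2)) \<and>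
      (\<Sum>j. \<Sum>i=1..r j. ennreal (w j i * (cmod (L2_inner \<omega> f (rotate_fun (g j i) (\<psi> j))))\<^sup>2))
        \<le> ennreal (C2 * (L2_norm \<omega> f)\<^sup>2))"
proof -
  have gw: "g j i \<in> SO" "w j i > 0" if "i \<in> {1..r j}" for i j
    using Q[of j] that by (auto simp: quadrature_SO_def)
  have "wavelet_system g w \<psi> p \<in> L2_space \<omega>" if "p \<in> (SIGMA j:UNIV. {1..r j})" for p
    using that sphere_polys_L2[OF sphere_polys_rotate[OF \<psi> gw(1)]]
    by (auto simp: wavelet_system_def intro!: L2_space_cmult)
  moreover have "(\<Sum>\<^sub>\<infinity>p\<in>(SIGMA j:UNIV. {1..r j}). ennreal ((cmod (L2_inner \<omega> f (wavelet_system g w \<psi> p)))\<^sup>2)) =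
     (\<Sum>j. \<Sum>i=1..r j. ennreal (w j i * (cmod (L2_inner \<omega> f (rotate_fun (g j i) (\<psi> j))))\<^sup>2))" for f
  proof -
    have "ennreal ((cmod (L2_inner \<omega> f (wavelet_system g w \<psi> (j, i))))\<^sup>2) =
       ennreal (w j i * (cmod (L2_inner \<omega> f (rotate_fun (g j i) (\<psi> j))))\<^sup>2)" if "i \<in> {1..r j}" for i j
      using gw(2)[OF that]
      by (simp add: wavelet_system_def L2_inner_cmult_right norm_mult power_mult_distrib)
    then show ?thesis
      by (subst infsum_Sigma_ennreal) simp_all
  qed
  ultimately show ?thesis
    by (simp add: frame_with_bounds_def)
qed

text \<open>The weights take values in \<open>ennreal\<close> and may a priori be infinite, so
  neither side presupposes convergence. Bounds on the individual weights add up because the spectrum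
  is nonnegative.\<close>

lemma weighted_parseval_bounds_iff:
  fixes S :: "nat \<Rightarrow> ennreal"
  assumes "C1 \<ge> 0" "C2 \<ge> 0"
  shows "(\<forall>f\<in>L2_space \<omega>. ennreal (C1 * (L2_norm \<omega> f)\<^sup>2) \<le> (\<Sum>n. ennreal (power_spectrum f n) * S n) \<and>
      (\<Sum>n. ennreal (power_spectrum f n) * S n) \<le> ennreal (C2 * (L2_norm \<omega> f)\<^sup>2)) \<longleftrightarrow>
    (\<forall>n. ennreal C1 \<le> S n \<and> S n \<le> ennreal C2)" (is "?L \<longleftrightarrow> ?R")
proof
  assume L: ?L
  show ?R
  proof
    fix n
    obtain k where k: "k \<in> I n"
      using I_nonempty by blast
    have "(\<Sum>m. ennreal (power_spectrum (Y n k) m) * S m) = (\<Sum>m\<in>{n}. ennreal (power_spectrum (Y n k) m) * S m)"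
      using k by (intro suminf_finite) (auto simp: power_spectrum_Y)
    then have "(\<Sum>m. ennreal (power_spectrum (Y n k) m) * S m) = S n"
      using k by (simp add: power_spectrum_Y)
    then show "ennreal C1 \<le> S n \<and> S n \<le> ennreal C2"
      using L[rule_format, OF Y_L2[OF k]] k by (simp add: L2_norm_Y)
  qed
next
  assume R: ?R
  show ?L
  proof
    fix f assume f: "f \<in> L2_space \<omega>"
    have P: "ennreal (C * (L2_norm \<omega> f)\<^sup>2) = (\<Sum>n. ennreal (power_spectrum f n) * ennreal C)" if "C \<ge> 0" for C
    proof -
      have "(\<Sum>n. ennreal (power_spectrum f n)) = ennreal ((L2_norm \<omega> f)\<^sup>2)"
        by (rule suminf_ennreal_eq[OF power_spectrum_nonneg parseval[OF f]])
      then show ?thesis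
        using that by (simp add: ennreal_mult mult.commute)
    qed
    show "ennreal (C1 * (L2_norm \<omega> f)\<^sup>2) \<le> (\<Sum>n. ennreal (power_spectrum f n) * S n) \<and>
      (\<Sum>n. ennreal (power_spectrum f n) * S n) \<le> ennreal (C2 * (L2_norm \<omega> f)\<^sup>2)"
      unfolding P[OF assms(1)] P[OF assms(2)] using R by (intro conjI suminf_le mult_left_mono) auto
  qed
qed

end

text \<open>The first equivalence reconciles the unordered sum in the definition of a frame with the
  iterated series over scales and nodes.\<close>

theorem proposition3p1:
  fixes \<omega> :: "(real ^ 'd) measure"
    and \<mu> :: "(real ^ 'd ^ 'd) measure"
    and I :: "nat \<Rightarrow> 'k set"
    and Y :: "nat \<Rightarrow> 'k \<Rightarrow> real ^ 'd \<Rightarrow> complex"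
    and N r :: "nat \<Rightarrow> nat"
    and g :: "nat \<Rightarrow> nat \<Rightarrow> real ^ 'd ^ 'd"
    and w :: "nat \<Rightarrow> nat \<Rightarrow> real"
    and \<Psi> :: "nat \<Rightarrow> real ^ 'd \<Rightarrow> complex"
    and C1 C2 :: real
  assumes "3 \<le> CARD('d)"
    and "normalized_sphere_measure \<omega>"
    and "normalized_Haar_SO \<mu>"
    and "\<And>n. orthonormal_basis_harmonics \<omega> n (I n) (Y n)"
    and "mono N"
    and "\<And>j. quadrature_SO \<mu> (SO_polys \<omega> I Y (N j)) (r j) (g j) (w j)"
    and "0 < C1" and "C1 \<le> C2"
    and "\<And>j. \<Psi> j \<in> sphere_polys (N j)"
  shows "(frame_with_bounds \<omega> (SIGMA j:UNIV. {1..r j}) (wavelet_system g w \<Psi>) C1 C2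
           \<longleftrightarrow> (\<forall>f\<in>L2_space \<omega>.
                let S = (\<Sum>j. \<Sum>i=1..r j.
                           ennreal (w j i * (cmod (L2_inner \<omega> f (rotate_fun (g j i) (\<Psi> j))))\<^sup>2))
                in ennreal (C1 * (L2_norm \<omega> f)\<^sup>2) \<le> S \<and> S \<le> ennreal (C2 * (L2_norm \<omega> f)\<^sup>2)))
       \<and> (frame_with_bounds \<omega> (SIGMA j:UNIV. {1..r j}) (wavelet_system g w \<Psi>) C1 C2
           \<longleftrightarrow> (\<forall>n.
                let S = ennreal (1 / real (cfun.dim (spherical_harmonics n :: (real ^ 'd \<Rightarrow> complex) set)))
                          * (\<Sum>j. \<Sum>k\<in>I n. ennreal ((cmod (L2_inner \<omega> (\<Psi> j) (Y n k)))\<^sup>2))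
                in ennreal C1 \<le> S \<and> S \<le> ennreal C2))"
proof -
  interpret spherical_haar \<omega> I Y \<mu>
    by unfold_locales (use assms in auto)
  have C: "0 \<le> C1" "0 \<le> C2"
    using assms(7,8) by auto
  \<comment> \<open>The reciprocal dimension is carried inside the series as division by
    \<open>card (I n)\<close>, the form in which the group average produces it.\<close>
  define S where "S n = (\<Sum>j. ennreal (power_spectrum (\<Psi> j) n / card (I n)))" for n
  have S: "ennreal (1 / real (cfun.dim (spherical_harmonics n :: (real ^ 'd \<Rightarrow> complex) set)))
      * (\<Sum>j. \<Sum>k\<in>I n. ennreal ((cmod (L2_inner \<omega> (\<Psi> j) (Y n k)))\<^sup>2)) = S n" for n
  proof -
    have "(\<Sum>k\<in>I n. ennreal ((cmod (L2_inner \<omega> (\<Psi> j) (Y n k)))\<^sup>2)) = ennreal (power_spectrum (\<Psi> j) n)" for j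
      unfolding power_spectrum_def by (rule sum_ennreal) simp
    then show ?thesis
      by (simp add: S_def power_spectrum_nonneg flip: card_I ennreal_suminf_cmult ennreal_mult)
  qed
  have "(\<forall>f\<in>L2_space \<omega>.
      ennreal (C1 * (L2_norm \<omega> f)\<^sup>2)
        \<le> (\<Sum>j. \<Sum>i=1..r j. ennreal (w j i * (cmod (L2_inner \<omega> f (rotate_fun (g j i) (\<Psi> j))))\<^sup>2)) \<and>
      (\<Sum>j. \<Sum>i=1..r j. ennreal (w j i * (cmod (L2_inner \<omega> f (rotate_fun (g j i) (\<Psi> j))))\<^sup>2))
        \<le> ennreal (C2 * (L2_norm \<omega> f)\<^sup>2)) \<longleftrightarrow> (\<forall>n. ennreal C1 \<le> S n \<and> S n \<le> ennreal C2)"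
    using weighted_parseval_bounds_iff[OF C, of S] quadrature_series[OF assms(6,9)] by (simp add: S_def)
  then show ?thesis
    using wavelet_frame_iff[OF assms(6,9)] by (simp only: Let_def S)
qed

end
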